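(* Let $\mathcal R=\{R_1,\ldots,R_h\}$ be a set of $h\ge 1$ distinct points of $\mathbb P^n(\mathbb K)$, $n\ge 1$, given by homogeneous coordinates, let $J=\mathcal I(\mathcal R)$, and let $s\ge 1$ be an integer. Assuming exact arithmetic in $\mathbb K$ with unit cost per operation: (1) there is an algorithm that computes a complement of $J$ up to degree $s$ together with the associated border basis of $J$ up to degree $s$ (a set of generators of the ideal $I(J_1,\ldots,J_s)$) with complexity $O(s\,n\,h^3)$; (2) there is an algorithm that computes a minimal set of generators of the ideal $I(J_1,\ldots,J_s)$ with complexity $O(s\,n^4\,h^3)$.
   Context: $\mathbb K$ is an algebraically closed field; $\mathcal P=\mathbb K[x_0,\ldots,x_n]$; $\mathcal T_k$ is the set of monomials of degree $k$ and $\mathcal P_k$ is its $\mathbb K$-span. $\mathcal I(\mathcal R)$ is the homogeneous radical ideal of all polynomials vanishing on $\mathcal R$. For a homogeneous ideal $J$, $J_k=J\cap\mathcal P_k$, and $I(J_1,\ldots,J_s)$ is the ideal generated by $J_1\cup\ldots\cup J_s$. For $S\subset\mathcal P_k$, $\langle S\rangle$ denotes the $\mathbb K$-span of $S$ and $S^+=\bigcup_{j=0}^n x_jS\subset\mathcal P_{k+1}$. Complement: for a proper homogeneous ideal $J$, a family $\mathcal N=\{\mathcal N_0,\ldots,\mathcal N_s\}$ is a complement of $J$ up to degree $s$ if $\mathcal N_0=\{1\}$ and, for each $k=1,\ldots,s$, $\mathcal N_k\subseteq\mathcal T_k$ is a set of monomials with $\mathcal N_k\subset\mathcal N_{k-1}^+$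 and $\mathcal P_k=J_k\oplus\langle\mathcal N_k\rangle$. Border basis: let $(\partial\mathcal N)_k=\mathcal N_{k-1}^+\setminus\mathcal N_k$. For $m\in(\partial\mathcal N)_k$ let $\psi(m)$ be the unique polynomial in $\langle\mathcal N_k\rangle$ with $m+\psi(m)\in J_k$. Let $\mathcal B_k=\{m+\psi(m) : m\in(\partial\mathcal N)_k\}$; then $\mathcal B=\mathcal B_1\cup\ldots\cup\mathcal B_s$ is the border basis of $J$ up to degree $s$ associated to $\mathcal N$. A set of generators of an ideal is minimal if no proper subset of it generates the ideal. Complexity counts arithmetic operations in $\mathbb K$ (each of unit cost); Gaussian elimination on an $m\times p$ matrix has complexity $O(mp\min(m,p))$. The implied constants in $O(\cdot)$ are absolute. *)

theory Defs
  imports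
    "HOL-Library.Poly_Mapping"
    "HOL-Computational_Algebra.Polynomial"
    "HOL.Hull"
begin

section \<open>Polynomials in \<open>x\<^sub>0, \<dots>, x\<^sub>n\<close>\<close>

text \<open>
  A monomial is its exponent vector, with \<open>0\<close> for the monomial 1. The number \<open>n\<close> is a parameter of
  the statements, so the ring of polynomials in \<open>x\<^sub>0, \<dots>, x\<^sub>n\<close> is a subset of the
  ring of polynomials in all the variables \<open>x\<^sub>i\<close>, \<open>i :: nat\<close>.
\<close>

type_synonym monomial = "nat \<Rightarrow>\<^sub>0 nat"
type_synonym 'k mpoly = "monomial \<Rightarrow>\<^sub>0 'k"

definition mon :: "monomial \<Rightarrow> 'k::field mpoly" where
  "mon m = Poly_Mapping.single m 1"

definition scale :: "'k::field \<Rightarrow> 'k mpoly \<Rightarrow> 'k mpoly" where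
  "scale c p = Poly_Mapping.single 0 c * p"

definition kspan :: "'k::field mpoly set \<Rightarrow> 'k mpoly set" where
  "kspan = module.span scale"

definition polys :: "nat \<Rightarrow> 'k::field mpoly set" where
  "polys n = {p. \<forall>m \<in> Poly_Mapping.keys p. Poly_Mapping.keys m \<subseteq> {..n}}"

definition total_degree :: "monomial \<Rightarrow> nat" where
  "total_degree m = (\<Sum>i \<in> Poly_Mapping.keys m. Poly_Mapping.lookup m i)"

definition monomials :: "nat \<Rightarrow> nat \<Rightarrow> monomial set" where
  "monomials n k = {m. Poly_Mapping.keys m \<subseteq> {..n} \<and> total_degree m = k}"

definition homog :: "nat \<Rightarrow> nat \<Rightarrow> 'k::field mpoly set" where
  "homog n k = kspan (mon ` monomials n k)"

definition eval_poly :: "(nat \<Rightarrow> 'k::field) \<Rightarrow> 'k mpoly \<Rightarrow> 'k" where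
  "eval_poly x p =
     (\<Sum>m \<in> Poly_Mapping.keys p.
        Poly_Mapping.lookup p m * (\<Prod>i \<in> Poly_Mapping.keys m. x i ^ Poly_Mapping.lookup m i))"

definition is_ideal :: "nat \<Rightarrow> 'k::field mpoly set \<Rightarrow> bool" where
  "is_ideal n I \<longleftrightarrow>
     I \<subseteq> polys n \<and> 0 \<in> I \<and> (\<forall>p \<in> I. \<forall>q \<in> I. p + q \<in> I) \<and>
     (\<forall>a \<in> polys n. \<forall>p \<in> I. a * p \<in> I)"

definition ideal_gen :: "nat \<Rightarrow> 'k::field mpoly set \<Rightarrow> 'k mpoly set" where
  "ideal_gen n S = is_ideal n hull S"

definition minimal_generators :: "nat \<Rightarrow> 'k::field mpoly set \<Rightarrow> 'k mpoly set \<Rightarrow> bool" where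
  "minimal_generators n G I \<longleftrightarrow>
     G \<subseteq> polys n \<and> ideal_gen n G = I \<and> (\<forall>G'. G' \<subset> G \<longrightarrow> ideal_gen n G' \<noteq> I)"


section \<open>Points of projective space and their ideal\<close>

text \<open>The point \<open>R i\<close> has homogeneous coordinates \<open>R i 0, \<dots>, R i n\<close>, for \<open>i < h\<close>.\<close>

definition distinct_points :: "nat \<Rightarrow> nat \<Rightarrow> (nat \<Rightarrow> nat \<Rightarrow> 'k::field) \<Rightarrow> bool" where
  "distinct_points n h R \<longleftrightarrow>
     (\<forall>i<h. \<exists>j\<le>n. R i j \<noteq> 0) \<and>
     (\<forall>i<h. \<forall>i'<h. i \<noteq> i' \<longrightarrow> \<not> (\<exists>c. c \<noteq> 0 \<and> (\<forall>j\<le>n. R i' j = c * R i j)))"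

text \<open>A polynomial vanishes at a point if it vanishes for every choice of its homogeneous coordinates.\<close>

definition vanishing_ideal :: "nat \<Rightarrow> nat \<Rightarrow> (nat \<Rightarrow> nat \<Rightarrow> 'k::field) \<Rightarrow> 'k mpoly set" where
  "vanishing_ideal n h R =
     {p \<in> polys n. \<forall>i<h. \<forall>c. c \<noteq> 0 \<longrightarrow> eval_poly (\<lambda>j. c * R i j) p = 0}"

definition truncated_ideal :: "nat \<Rightarrow> 'k::field mpoly set \<Rightarrow> nat \<Rightarrow> 'k mpoly set" where
  "truncated_ideal n J s = ideal_gen n (\<Union>k \<in> {1..s}. J \<inter> homog n k)"


section \<open>Complements and border bases\<close>

definition mono_plus :: "nat \<Rightarrow> monomial set \<Rightarrow> monomial set" where
  "mono_plus n S = (\<Union>j\<le>n. (\<lambda>m. Poly_Mapping.single j 1 + m) ` S)"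

definition direct_sum :: "'k::field mpoly set \<Rightarrow> 'k mpoly set \<Rightarrow> 'k mpoly set \<Rightarrow> bool" where
  "direct_sum V A B \<longleftrightarrow> V = {a + b |a b. a \<in> A \<and> b \<in> B} \<and> A \<inter> B = {0}"

definition complement ::
    "nat \<Rightarrow> 'k::field mpoly set \<Rightarrow> nat \<Rightarrow> (nat \<Rightarrow> monomial set) \<Rightarrow> bool" where
  "complement n J s \<N> \<longleftrightarrow>
     \<N> 0 = {0} \<and>
     (\<forall>k \<in> {1..s}. \<N> k \<subseteq> monomials n k \<and> \<N> k \<subseteq> mono_plus n (\<N> (k - 1)) \<and>
        direct_sum (homog n k) (J \<inter> homog n k) (kspan (mon ` \<N> k)))"

definition border :: "nat \<Rightarrow> (nat \<Rightarrow> monomial set) \<Rightarrow> nat \<Rightarrow> monomial set" where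
  "border n \<N> k = mono_plus n (\<N> (k - 1)) - \<N> k"

definition psi ::
    "nat \<Rightarrow> 'k::field mpoly set \<Rightarrow> (nat \<Rightarrow> monomial set) \<Rightarrow> nat \<Rightarrow> monomial \<Rightarrow> 'k mpoly" where
  "psi n J \<N> k m = (THE g. g \<in> kspan (mon ` \<N> k) \<and> mon m + g \<in> J \<inter> homog n k)"

definition border_basis ::
    "nat \<Rightarrow> 'k::field mpoly set \<Rightarrow> nat \<Rightarrow> (nat \<Rightarrow> monomial set) \<Rightarrow> 'k mpoly set" where
  "border_basis n J s \<N> = (\<Union>k \<in> {1..s}. (\<lambda>m. mon m + psi n J \<N> k m) ` border n \<N> k)"


section \<open>Algorithms over a field\<close>

text \<open>
  Programs work on a memory of natural numbers and a memory of field elements. Each memory is a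
  collection of arrays, an array being named by a number and addressed by a list of indices. The
  program text does not mention the field: the only field constants are 0 and 1, and the only way in
  which field elements influence the control flow is the zero test. The cost of a run
  is the number of arithmetic operations and zero tests performed in the field; copying, indexing
  and natural-number computations are free. Division by zero has no successor state.
\<close>

datatype nexp =
    Num nat
  | Rd nat "nexp list"
  | Plus nexp nexp
  | Minus nexp nexp
  | Times nexp nexp
  | Less nexp nexp

datatype aop = FAdd | FSub | FMul | FDiv

type_synonym loc = "nat \<times> nexp list"

datatype com =
    Skip
  | NSet loc nexp
  | FZero loc
  | FOne loc
  | FCopy loc loc
  | FOp aop loc loc loc
  | Seq com com
  | Cond nexp com com
  | IfZero loc com com
  | While nexp com

type_synonym 'v mem = "nat \<Rightarrow> nat list \<Rightarrow> 'v"

primrec nval :: "nat mem \<Rightarrow> nexp \<Rightarrow> nat" where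
  "nval N (Num c) = c"
| "nval N (Rd a es) = N a (map (nval N) es)"
| "nval N (Plus e f) = nval N e + nval N f"
| "nval N (Minus e f) = nval N e - nval N f"
| "nval N (Times e f) = nval N e * nval N f"
| "nval N (Less e f) = (if nval N e < nval N f then 1 else 0)"

definition rd :: "nat mem \<Rightarrow> 'v mem \<Rightarrow> loc \<Rightarrow> 'v" where
  "rd N M l = M (fst l) (map (nval N) (snd l))"

definition wr :: "nat mem \<Rightarrow> 'v mem \<Rightarrow> loc \<Rightarrow> 'v \<Rightarrow> 'v mem" where
  "wr N M l v = M(fst l := (M (fst l))(map (nval N) (snd l) := v))"

fun aop_val :: "aop \<Rightarrow> 'k::field \<Rightarrow> 'k \<Rightarrow> 'k" where
  "aop_val FAdd x y = x + y"
| "aop_val FSub x y = x - y"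
| "aop_val FMul x y = x * y"
| "aop_val FDiv x y = x / y"

type_synonym 'k state = "nat mem \<times> 'k mem"

text \<open>\<open>exec c \<sigma> t \<tau>\<close>: started in \<open>\<sigma>\<close>, \<open>c\<close> terminates in \<open>\<tau>\<close> with cost \<open>t\<close>.\<close>

inductive exec :: "com \<Rightarrow> 'k::field state \<Rightarrow> nat \<Rightarrow> 'k state \<Rightarrow> bool" where
  Skip: "exec Skip \<sigma> 0 \<sigma>"
| NSet: "exec (NSet l e) (N, F) 0 (wr N N l (nval N e), F)"
| FZero: "exec (FZero l) (N, F) 0 (N, wr N F l 0)"
| FOne: "exec (FOne l) (N, F) 0 (N, wr N F l 1)"
| FCopy: "exec (FCopy l l1) (N, F) 0 (N, wr N F l (rd N F l1))"
| FOp: "(f = FDiv \<longrightarrow> rd N F l2 \<noteq> 0) \<Longrightarrow>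
    exec (FOp f l l1 l2) (N, F) 1 (N, wr N F l (aop_val f (rd N F l1) (rd N F l2)))"
| Seq: "\<lbrakk>exec c \<sigma> t \<sigma>'; exec d \<sigma>' u \<tau>\<rbrakk> \<Longrightarrow> exec (Seq c d) \<sigma> (t + u) \<tau>"
| CondTrue: "\<lbrakk>nval (fst \<sigma>) e \<noteq> 0; exec c \<sigma> t \<tau>\<rbrakk> \<Longrightarrow> exec (Cond e c d) \<sigma> t \<tau>"
| CondFalse: "\<lbrakk>nval (fst \<sigma>) e = 0; exec d \<sigma> t \<tau>\<rbrakk> \<Longrightarrow> exec (Cond e c d) \<sigma> t \<tau>"
| IfZeroTrue: "\<lbrakk>rd (fst \<sigma>) (snd \<sigma>) l = 0; exec c \<sigma> t \<tau>\<rbrakk> \<Longrightarrow> exec (IfZero l c d) \<sigma> (Suc t) \<tau>"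
| IfZeroFalse: "\<lbrakk>rd (fst \<sigma>) (snd \<sigma>) l \<noteq> 0; exec d \<sigma> t \<tau>\<rbrakk> \<Longrightarrow> exec (IfZero l c d) \<sigma> (Suc t) \<tau>"
| WhileFalse: "nval (fst \<sigma>) e = 0 \<Longrightarrow> exec (While e c) \<sigma> 0 \<sigma>"
| WhileTrue: "\<lbrakk>nval (fst \<sigma>) e \<noteq> 0; exec c \<sigma> t \<sigma>'; exec (While e c) \<sigma>' u \<tau>\<rbrakk> \<Longrightarrow>
    exec (While e c) \<sigma> (t + u) \<tau>"

text \<open>
  Input: \<open>n\<close>, \<open>h\<close>, \<open>s\<close> are in the natural-number array 0 and the homogeneous coordinates in the field array 0;
  everything else is 0.
\<close>

definition input :: "nat \<Rightarrow> nat \<Rightarrow> nat \<Rightarrow> (nat \<Rightarrow> nat \<Rightarrow> 'k::field) \<Rightarrow> 'k state" where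
  "input n h s R =
     ((\<lambda>a is. if a = 0 \<and> is = [0] then n else if a = 0 \<and> is = [1] then h
              else if a = 0 \<and> is = [2] then s else 0),
      (\<lambda>a is. if a = 0 \<and> length is = 2 \<and> is ! 0 < h \<and> is ! 1 \<le> n then R (is ! 0) (is ! 1) else 0))"

text \<open>
  Output, in natural-number arrays 1 to 5 and field array 1. The family \<open>\<N>\<close>: array 1 holds at \<open>[k]\<close>
  the number of listed elements of \<open>\<N> k\<close> and array 2 holds at \<open>[k, i, j]\<close> the exponent of \<open>x\<^sub>j\<close> in the
  \<open>i\<close>-th of them. A set of polynomials, as sums of terms: array 3 holds at \<open>[]\<close> their number, array
  4 at \<open>[p]\<close> the number of terms of the \<open>p\<close>-th one, array 5 at \<open>[p, t, j]\<close> the exponent of \<open>x\<^sub>j\<close> in its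
  \<open>t\<close>-th term, and field array 1 at \<open>[p, t]\<close> the coefficient of this term.
\<close>

definition exponents :: "nat \<Rightarrow> (nat \<Rightarrow> nat) \<Rightarrow> monomial" where
  "exponents n e = (\<Sum>j\<le>n. Poly_Mapping.single j (e j))"

definition out_family :: "nat \<Rightarrow> 'k::field state \<Rightarrow> nat \<Rightarrow> monomial set" where
  "out_family n \<sigma> k = (\<lambda>i. exponents n (\<lambda>j. fst \<sigma> 2 [k, i, j])) ` {..<fst \<sigma> 1 [k]}"

definition out_poly :: "nat \<Rightarrow> 'k::field state \<Rightarrow> nat \<Rightarrow> 'k mpoly" where
  "out_poly n \<sigma> p =
     (\<Sum>t < fst \<sigma> 4 [p]. Poly_Mapping.single (exponents n (\<lambda>j. fst \<sigma> 5 [p, t, j])) (snd \<sigma> 1 [p, t]))"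

definition out_polys :: "nat \<Rightarrow> 'k::field state \<Rightarrow> 'k mpoly set" where
  "out_polys n \<sigma> = out_poly n \<sigma> ` {..<fst \<sigma> 3 []}"

text \<open>
  The constants implied by \<open>O\<close> are absolute. A constant bound by an existential quantifier inside
  the theorem could depend on the type of field elements, and HOL has no quantification over types; a
  numeral cannot depend on it. Its value is a generous choice without further significance.
\<close>

definition implied_constant :: nat where
  "implied_constant = 1000000"

end

theory Submission
  imports Defs
begin

text \<open>
  Only the values at the points matter: modulo \<open>J\<close>, a form of degree \<open>k\<close> is determined by its \<open>h\<close> values
  at the points. If \<open>\<N> (k - 1)\<close> is a basis of the forms of degree \<open>k - 1\<close> modulo \<open>J\<close>, then the at most
  \<open>(n + 1) h\<close> products of its elements with the variables span the forms of degree \<open>k\<close> modulo \<open>J\<close>, and the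
  value vector of such a product costs \<open>h\<close> multiplications. These vectors are inserted one by one into
  an elimination in dimension \<open>h\<close>, at cost \<open>O(h\<^sup>2)\<close> each. A product whose vector is independent of the
  earlier ones enters \<open>\<N> k\<close>; for every other one the elimination supplies the coefficients of its
  border polynomial. This costs \<open>O(n h\<^sup>3)\<close> per degree. That the result is a complement, and that the
  border polynomials generate, is linear algebra degree by degree (\<open>decompose\<close>, \<open>J_deg_eq_J_times_span\<close>).

  For minimal generators a border polynomial is kept only if it lies outside the span of
  \<open>x\<^sub>0 J\<^sub>k\<^sub>-\<^sub>1 + \<dots> + x\<^sub>n J\<^sub>k\<^sub>-\<^sub>1\<close> and the polynomials kept before. Comparing degrees shows that such a
  choice is irredundant (\<open>minimal_truncated\<close>). To test membership, a form \<open>x\<^sub>0 f\<^sub>0 + \<dots> + x\<^sub>n f\<^sub>n\<close> is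
  represented by the values of all the \<open>f\<^sub>j\<close>, a vector of length \<open>(n + 1) h\<close>. Changing the \<open>f\<^sub>j\<close> by elements of
  \<open>J\<close> does not change the vector, so what remains is the ambiguity in the choice of the \<open>f\<^sub>j\<close>, that is
  the relations \<open>x\<^sub>0 g\<^sub>0 + \<dots> + x\<^sub>n g\<^sub>n = 0\<close>. Their vectors are spanned by those of the Koszul
  relations \<open>x\<^sub>i (x\<^sub>j q) = x\<^sub>j (x\<^sub>i q)\<close> with \<open>q \<in> \<N> (k - 2)\<close> (\<open>koszul_span\<close>). Inserting these
  \<open>O(n\<^sup>2 h)\<close> vectors into an elimination in dimension \<open>(n + 1) h\<close> costs \<open>O(n\<^sup>4 h\<^sup>3)\<close> per degree.

  Both eliminations are one program fragment (\<open>insertion\<close>), and both algorithms are one program (\<open>main_prog\<close>)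
  that differs only in a preparation and in the test deciding whether a dependent product is output. The
  program is verified once for all tests, in the locale \<open>selection\<close>, with a weakest precondition
  calculus that also counts the cost.
\<close>

section \<open>Spans of monomials\<close>

interpretation sc: vector_space "scale :: 'k::field \<Rightarrow> 'k mpoly \<Rightarrow> 'k mpoly"
  by standard (simp_all add: scale_def algebra_simps single_add mult_single flip: mult.assoc)

lemma lookup_scale [simp]: "Poly_Mapping.lookup (scale c p) m = c * Poly_Mapping.lookup p m"
  by (simp add: scale_def mult_map_scale_conv_mult[symmetric] Poly_Mapping.map.rep_eq when_def)

lemma scale_single [simp]: "scale c (Poly_Mapping.single m d) = Poly_Mapping.single m (c * d)"
  by (simp add: scale_def mult_single)

lemma keys_scale: "Poly_Mapping.keys (scale c p) \<subseteq> Poly_Mapping.keys p"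
  by (auto simp: in_keys_iff)

lemma scale_mult_left: "p * scale c q = scale c (p * q)"
  by (simp add: scale_def mult_ac)

lemma poly_expand: "p = (\<Sum>m\<in>Poly_Mapping.keys p. Poly_Mapping.single m (Poly_Mapping.lookup p m))"
  by (rule poly_mapping_eqI)
     (auto simp: lookup_sum lookup_single when_def sum.delta in_keys_iff)

lemma kspan_mon: "kspan (mon ` A) = {p :: 'k::field mpoly. Poly_Mapping.keys p \<subseteq> A}"
proof
  have "Poly_Mapping.keys (p + q) \<subseteq> A"
    if "Poly_Mapping.keys p \<subseteq> A" "Poly_Mapping.keys q \<subseteq> A" for p q :: "'k mpoly"
    using that keys_add[of p q] by blast
  moreover have "Poly_Mapping.keys (scale c p) \<subseteq> A" if "Poly_Mapping.keys p \<subseteq> A" for c and p :: "'k mpoly"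
    using that keys_scale[of c p] by blast
  ultimately have "sc.subspace {p :: 'k mpoly. Poly_Mapping.keys p \<subseteq> A}"
    by (simp add: sc.subspace_def)
  then show "kspan (mon ` A) \<subseteq> {p :: 'k mpoly. Poly_Mapping.keys p \<subseteq> A}"
    unfolding kspan_def by (rule sc.span_minimal[rotated]) (auto simp: mon_def)
  show "{p :: 'k mpoly. Poly_Mapping.keys p \<subseteq> A} \<subseteq> kspan (mon ` A)"
  proof clarify
    fix p :: "'k mpoly" assume p: "Poly_Mapping.keys p \<subseteq> A"
    have "(\<Sum>m\<in>Poly_Mapping.keys p. scale (Poly_Mapping.lookup p m) (mon m)) \<in> kspan (mon ` A)"
      unfolding kspan_def using p
      by (intro sc.span_sum sc.span_scale sc.span_base) auto
    then show "p \<in> kspan (mon ` A)"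
      by (simp add: mon_def poly_expand[symmetric])
  qed
qed

lemma homog_iff: "p \<in> homog n k \<longleftrightarrow> Poly_Mapping.keys p \<subseteq> monomials n k"
  by (simp add: homog_def kspan_mon)

lemma mon_in_kspan: "m \<in> A \<Longrightarrow> mon m \<in> kspan (mon ` A)"
  unfolding kspan_def by (intro sc.span_base imageI)

lemma subspace_kspan: "sc.subspace (kspan A)"
  by (simp add: kspan_def)

lemma kspan_mono: "A \<subseteq> B \<Longrightarrow> kspan A \<subseteq> kspan B"
  by (simp add: kspan_def sc.span_mono)

lemma kspan_induct_mon:
  assumes "p \<in> kspan (mon ` A)" "sc.subspace S" "\<And>m. m \<in> A \<Longrightarrow> mon m \<in> S"
  shows "p \<in> S"
  using assms sc.span_minimal[of "mon ` A" S] by (auto simp: kspan_def)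

section \<open>Monomials\<close>

lemma total_degree_superset:
  "finite A \<Longrightarrow> Poly_Mapping.keys m \<subseteq> A \<Longrightarrow> total_degree m = (\<Sum>i\<in>A. Poly_Mapping.lookup m i)"
  unfolding total_degree_def by (rule sum.mono_neutral_left) (auto simp: in_keys_iff)

lemma total_degree_add: "total_degree (a + b) = total_degree a + total_degree b"
proof -
  let ?A = "Poly_Mapping.keys a \<union> Poly_Mapping.keys b"
  show ?thesis
    using keys_add[of a b]
    by (simp add: total_degree_superset[of ?A] lookup_add sum.distrib)
qed

lemma keys_add_nat: "Poly_Mapping.keys (a + b :: monomial) = Poly_Mapping.keys a \<union> Poly_Mapping.keys b"
  by (auto simp: in_keys_iff lookup_add)

definition var :: "nat \<Rightarrow> monomial" where
  "var j = Poly_Mapping.single j 1"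

lemma keys_var [simp]: "Poly_Mapping.keys (var j) = {j}"
  by (simp add: var_def)

lemma lookup_var: "Poly_Mapping.lookup (var j) i = (if i = j then 1 else 0)"
  by (simp add: var_def lookup_single when_def)

lemma total_degree_var [simp]: "total_degree (var j) = 1"
  by (simp add: total_degree_def lookup_var)

lemma mono_plus_var: "mono_plus n S = (\<Union>j\<le>n. (\<lambda>m. var j + m) ` S)"
  by (simp add: mono_plus_def var_def)

lemma var_monomials: "j \<le> n \<Longrightarrow> m \<in> monomials n k \<Longrightarrow> var j + m \<in> monomials n (Suc k)"
  by (auto simp: monomials_def keys_add_nat total_degree_add split: if_splits)

lemma monomials_0: "monomials n 0 = {0}"
proof -
  have "m = 0" if "total_degree m = 0" for m
    using that by (auto simp: total_degree_def in_keys_iff intro!: poly_mapping_eqI)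
  then show ?thesis by (auto simp: monomials_def total_degree_def)
qed

lemma var_diff: "j \<in> Poly_Mapping.keys m \<Longrightarrow> var j + (m - var j) = m"
  by (rule poly_mapping_eqI)
     (auto simp: lookup_add lookup_minus lookup_var in_keys_iff)

lemma monomials_diff:
  assumes "m \<in> monomials n (Suc k)" "j \<in> Poly_Mapping.keys m"
  shows "m - var j \<in> monomials n k" "j \<le> n"
proof -
  have e: "var j + (m - var j) = m" using assms(2) by (rule var_diff)
  have "Suc (total_degree (m - var j)) = Suc k"
    using total_degree_add[of "var j" "m - var j"] assms(1) unfolding e by (simp add: monomials_def)
  moreover have "Poly_Mapping.keys (m - var j) \<subseteq> Poly_Mapping.keys m"
    using keys_add_nat[of "var j" "m - var j"] unfolding e by blast
  ultimately show "m - var j \<in> monomials n k" "j \<le> n" using assms by (auto simp: monomials_def)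
qed

lemma monomials_Suc_nonempty_keys: "m \<in> monomials n (Suc k) \<Longrightarrow> Poly_Mapping.keys m \<noteq> {}"
  by (auto simp: monomials_def total_degree_def)

lemma mono_plus_monomials: "A \<subseteq> monomials n k \<Longrightarrow> mono_plus n A \<subseteq> monomials n (Suc k)"
  by (auto simp: mono_plus_var intro!: var_monomials)

lemma mon_mult: "mon a * mon b = mon (a + b)"
  by (simp add: mon_def mult_single)

lemma homog_mult_var: "j \<le> n \<Longrightarrow> p \<in> homog n k \<Longrightarrow> mon (var j) * p \<in> homog n (Suc k)"
proof -
  assume j: "j \<le> n" and p: "p \<in> homog n k"
  show ?thesis unfolding homog_iff
  proof
    fix m assume "m \<in> Poly_Mapping.keys (mon (var j) * p)"
    then obtain b where "m = var j + b" "b \<in> Poly_Mapping.keys p"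
      using keys_mult[of "mon (var j)" p] by (auto simp: mon_def split: if_splits)
    then show "m \<in> monomials n (Suc k)" using p j var_monomials by (auto simp: homog_iff)
  qed
qed

lemma subspace_homog: "sc.subspace (homog n k)"
  by (simp add: homog_def subspace_kspan)

lemma homog_polys: "p \<in> homog n k \<Longrightarrow> p \<in> polys n"
  by (auto simp: homog_iff polys_def monomials_def)

section \<open>Evaluation\<close>

definition mono_value :: "(nat \<Rightarrow> 'k::field) \<Rightarrow> monomial \<Rightarrow> 'k" where
  "mono_value x m = (\<Prod>i\<in>Poly_Mapping.keys m. x i ^ Poly_Mapping.lookup m i)"

lemma mono_value_superset:
  "finite A \<Longrightarrow> Poly_Mapping.keys m \<subseteq> A \<Longrightarrow> mono_value x m = (\<Prod>i\<in>A. x i ^ Poly_Mapping.lookup m i)"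
  unfolding mono_value_def by (rule prod.mono_neutral_left) (auto simp: in_keys_iff)

lemma mono_value_add: "mono_value x (a + b) = mono_value x a * mono_value x b"
proof -
  let ?A = "Poly_Mapping.keys a \<union> Poly_Mapping.keys b"
  show ?thesis
    by (simp add: keys_add_nat mono_value_superset[of ?A] lookup_add power_add prod.distrib)
qed

lemma mono_value_var [simp]: "mono_value x (var j) = x j"
  by (simp add: mono_value_def lookup_var)

lemma mono_value_0 [simp]: "mono_value x 0 = 1"
  by (simp add: mono_value_def)

lemma mono_value_scale: "mono_value (\<lambda>j. c * x j) m = c ^ total_degree m * mono_value x m"
  by (simp add: mono_value_def total_degree_def power_mult_distrib prod.distrib power_sum)

definition lin_ext :: "(monomial \<Rightarrow> 'k) \<Rightarrow> 'k::field mpoly \<Rightarrow> 'k" where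
  "lin_ext g p = (\<Sum>m\<in>Poly_Mapping.keys p. Poly_Mapping.lookup p m * g m)"

lemma lin_ext_superset:
  "finite A \<Longrightarrow> Poly_Mapping.keys p \<subseteq> A \<Longrightarrow> lin_ext g p = (\<Sum>m\<in>A. Poly_Mapping.lookup p m * g m)"
  unfolding lin_ext_def by (rule sum.mono_neutral_left) (auto simp: in_keys_iff)

lemma lin_ext_0 [simp]: "lin_ext g 0 = 0"
  by (simp add: lin_ext_def)

lemma lin_ext_add: "lin_ext g (p + q) = lin_ext g p + lin_ext g q"
proof -
  let ?A = "Poly_Mapping.keys p \<union> Poly_Mapping.keys q"
  show ?thesis
    using keys_add[of p q]
    by (simp add: lin_ext_superset[of ?A] lookup_add distrib_right sum.distrib)
qed

lemma lin_ext_scale: "lin_ext g (scale c p) = c * lin_ext g p"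
  using keys_scale[of c p]
  by (simp add: lin_ext_superset[of "Poly_Mapping.keys p"] sum_distrib_left mult.assoc)

lemma lin_ext_sum: "lin_ext g (sum f A) = (\<Sum>a\<in>A. lin_ext g (f a))"
  by (induction A rule: infinite_finite_induct) (auto simp: lin_ext_add)

lemma lin_ext_single [simp]: "lin_ext g (Poly_Mapping.single m c) = c * g m"
  by (cases "c = 0") (simp_all add: lin_ext_def)

lemma eval_lin_ext: "eval_poly x = lin_ext (mono_value x)"
  by (simp add: fun_eq_iff eval_poly_def lin_ext_def mono_value_def)

lemma eval_add: "eval_poly x (p + q) = eval_poly x p + eval_poly x q"
  by (simp add: eval_lin_ext lin_ext_add)

lemma eval_0 [simp]: "eval_poly x 0 = 0"
  by (simp add: eval_lin_ext)

lemma eval_scale: "eval_poly x (scale c p) = c * eval_poly x p"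
  by (simp add: eval_lin_ext lin_ext_scale)

lemma eval_uminus: "eval_poly x (- p) = - eval_poly x p"
proof -
  have "eval_poly x p + eval_poly x (- p) = 0" by (simp flip: eval_add)
  then show ?thesis by (simp add: add_eq_0_iff)
qed

lemma eval_diff: "eval_poly x (p - q) = eval_poly x p - eval_poly x q"
  using eval_add[of x p "- q"] by (simp add: eval_uminus)

lemma eval_sum: "eval_poly x (sum f A) = (\<Sum>a\<in>A. eval_poly x (f a))"
  by (simp add: eval_lin_ext lin_ext_sum)

lemma eval_single [simp]: "eval_poly x (Poly_Mapping.single m c) = c * mono_value x m"
  by (simp add: eval_lin_ext)

lemma eval_mon [simp]: "eval_poly x (mon m) = mono_value x m"
  by (simp add: mon_def)

lemma eval_mult: "eval_poly x (p * q) = eval_poly x p * eval_poly x q"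
proof -
  let ?s = "\<lambda>p m. Poly_Mapping.single m (Poly_Mapping.lookup p m)"
  have "p * q = (\<Sum>a\<in>Poly_Mapping.keys p. \<Sum>b\<in>Poly_Mapping.keys q. ?s p a * ?s q b)"
    unfolding sum_product[symmetric] poly_expand[symmetric] ..
  then have "eval_poly x (p * q) = (\<Sum>a\<in>Poly_Mapping.keys p. \<Sum>b\<in>Poly_Mapping.keys q.
      (Poly_Mapping.lookup p a * mono_value x a) * (Poly_Mapping.lookup q b * mono_value x b))"
    by (simp add: eval_sum mult_single mono_value_add mult_ac)
  also have "\<dots> = eval_poly x p * eval_poly x q"
    unfolding sum_product[symmetric] by (simp add: eval_poly_def mono_value_def)
  finally show ?thesis .
qed

lemma eval_homog_scale:
  assumes "p \<in> homog n k"
  shows "eval_poly (\<lambda>j. c * x j) p = c ^ k * eval_poly x p"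
proof -
  have "total_degree m = k" if "m \<in> Poly_Mapping.keys p" for m
    using assms that by (auto simp: homog_iff monomials_def)
  then show ?thesis
    by (simp add: eval_lin_ext lin_ext_def mono_value_scale sum_distrib_left mult_ac)
qed

section \<open>Ideals\<close>

lemma polys_add: "p \<in> polys n \<Longrightarrow> q \<in> polys n \<Longrightarrow> p + q \<in> polys n"
  using keys_add[of p q] by (fastforce simp: polys_def)

lemma polys_mult: "p \<in> polys n \<Longrightarrow> q \<in> polys n \<Longrightarrow> p * q \<in> polys n"
  using keys_mult[of p q] by (fastforce simp: polys_def keys_add_nat)

lemma single_polys: "Poly_Mapping.keys m \<subseteq> {..n} \<Longrightarrow> Poly_Mapping.single m c \<in> polys n"
  by (simp add: polys_def)

lemma is_ideal_Inter: "(\<And>I. I \<in> F \<Longrightarrow> is_ideal n I) \<Longrightarrow> F \<noteq> {} \<Longrightarrow> is_ideal n (\<Inter> F)"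
  unfolding is_ideal_def by blast

lemma is_ideal_polys: "is_ideal n (polys n)"
  by (auto simp: is_ideal_def polys_add polys_mult) (simp add: polys_def)

lemma is_ideal_ideal_gen: "S \<subseteq> polys n \<Longrightarrow> is_ideal n (ideal_gen n S)"
  unfolding ideal_gen_def hull_def using is_ideal_polys by (intro is_ideal_Inter) auto

lemma ideal_gen_incl: "S \<subseteq> ideal_gen n S"
  unfolding ideal_gen_def by (rule hull_subset)

lemma ideal_gen_least: "S \<subseteq> I \<Longrightarrow> is_ideal n I \<Longrightarrow> ideal_gen n S \<subseteq> I"
  unfolding ideal_gen_def by (rule hull_minimal)

lemma is_ideal_subspace:
  fixes I :: "'k::field mpoly set"
  assumes "is_ideal n I"
  shows "sc.subspace I"
proof -
  have "Poly_Mapping.single 0 c \<in> polys n" for c :: 'k by (simp add: single_polys)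
  then show ?thesis using assms unfolding is_ideal_def sc.subspace_def scale_def by blast
qed

text \<open>Closure under multiplication by variables suffices, since every polynomial is a linear combination of
  products of variables.\<close>
lemma is_idealI:
  assumes "sc.subspace I" "I \<subseteq> polys n" "\<And>j p. j \<le> n \<Longrightarrow> p \<in> I \<Longrightarrow> mon (var j) * p \<in> I"
  shows "is_ideal n I"
proof -
  have m: "mon m * p \<in> I" if "p \<in> I" "m \<in> monomials n k" for m p k
    using that(2)
  proof (induction k arbitrary: m)
    case 0
    then show ?case using that(1) by (simp add: monomials_0 mon_def)
  next
    case (Suc k)
    then obtain j where j: "j \<in> Poly_Mapping.keys m" using monomials_Suc_nonempty_keys by blast
    have "mon (var j) * (mon (m - var j) * p) \<in> I"
      using monomials_diff[OF Suc.prems j] Suc.IH assms(3) by blast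
    then show ?case by (simp add: mult.assoc[symmetric] mon_mult var_diff[OF j])
  qed
  have "a * p \<in> I" if a: "a \<in> polys n" and p: "p \<in> I" for a p
  proof -
    have "a * p = (\<Sum>m\<in>Poly_Mapping.keys a. Poly_Mapping.single m (Poly_Mapping.lookup a m)) * p"
      by (simp add: poly_expand[symmetric])
    also have "\<dots> = (\<Sum>m\<in>Poly_Mapping.keys a. scale (Poly_Mapping.lookup a m) (mon m * p))"
      by (simp add: sum_distrib_right mon_def scale_def mult_single flip: mult.assoc)
    also have "\<dots> \<in> I"
      using a p by (intro sc.subspace_sum[OF assms(1)] sc.subspace_scale[OF assms(1)] m)
        (auto simp: polys_def monomials_def)
    finally show ?thesis .
  qed
  with assms(1,2) show ?thesis by (auto simp: is_ideal_def sc.subspace_def)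
qed

definition hom_component :: "nat \<Rightarrow> 'k::field mpoly \<Rightarrow> 'k mpoly" where
  "hom_component d p = (\<Sum>m\<in>{m \<in> Poly_Mapping.keys p. total_degree m = d}. Poly_Mapping.single m (Poly_Mapping.lookup p m))"

lemma lookup_hom_component:
  "Poly_Mapping.lookup (hom_component d p) m = (if total_degree m = d then Poly_Mapping.lookup p m else 0)"
  by (auto simp: hom_component_def lookup_sum lookup_single when_def sum.delta in_keys_iff)

lemma hom_component_add: "hom_component d (p + q) = hom_component d p + hom_component d q"
  by (rule poly_mapping_eqI) (simp add: lookup_hom_component lookup_add)

lemma hom_component_scale: "hom_component d (scale c p) = scale c (hom_component d p)"
  by (rule poly_mapping_eqI) (simp add: lookup_hom_component)

lemma hom_component_0 [simp]: "hom_component d 0 = 0"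
  by (simp add: hom_component_def)

lemma hom_component_homog:
  assumes "p \<in> homog n k"
  shows "hom_component d p = (if d = k then p else 0)"
proof (rule poly_mapping_eqI)
  fix m
  have "total_degree m = k" if "Poly_Mapping.lookup p m \<noteq> 0"
    using assms that by (auto simp: homog_iff monomials_def in_keys_iff)
  then show "Poly_Mapping.lookup (hom_component d p) m = Poly_Mapping.lookup (if d = k then p else 0) m"
    by (auto simp: lookup_hom_component)
qed

lemma hom_component_sum: "hom_component d (sum f A) = (\<Sum>a\<in>A. hom_component d (f a))"
  by (induction A rule: infinite_finite_induct) (auto simp: hom_component_add)

lemma hom_component_single: "hom_component d (Poly_Mapping.single m c) = (if total_degree m = d then Poly_Mapping.single m c else 0)"
  by (rule poly_mapping_eqI) (auto simp: lookup_hom_component lookup_single when_def)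

lemma hom_component_mult_var: "hom_component d (mon (var j) * p) = (if d = 0 then 0 else mon (var j) * hom_component (d - 1) p)"
proof -
  let ?s = "\<lambda>m. Poly_Mapping.single m (Poly_Mapping.lookup p m)"
  have "mon (var j) * p = (\<Sum>m\<in>Poly_Mapping.keys p. mon (var j) * ?s m)"
    by (simp add: sum_distrib_left[symmetric] poly_expand[symmetric])
  then have "hom_component d (mon (var j) * p) = (\<Sum>m\<in>Poly_Mapping.keys p. hom_component d (mon (var j) * ?s m))"
    by (simp add: hom_component_sum)
  also have "\<dots> = (\<Sum>m\<in>Poly_Mapping.keys p. if d = 0 then 0 else mon (var j) * hom_component (d - 1) (?s m))"
    by (intro sum.cong refl) (auto simp: mon_def mult_single hom_component_single total_degree_add)
  also have "\<dots> = (if d = 0 then 0 else mon (var j) * hom_component (d - 1) (\<Sum>m\<in>Poly_Mapping.keys p. ?s m))"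
    by (simp add: hom_component_sum sum_distrib_left)
  finally show ?thesis by (simp add: poly_expand[symmetric])
qed

section \<open>Border bases and minimal generators, degree by degree\<close>
locale points =
  fixes n h :: nat and R :: "nat \<Rightarrow> nat \<Rightarrow> 'k::field"
  assumes h_pos: "h \<ge> 1"
begin

definition vanish :: "'k mpoly \<Rightarrow> bool" where
  "vanish p \<longleftrightarrow> (\<forall>c<h. eval_poly (R c) p = 0)"

definition J_deg :: "nat \<Rightarrow> 'k mpoly set" where
  "J_deg k = {p \<in> homog n k. vanish p}"

abbreviation J :: "'k mpoly set" where
  "J \<equiv> vanishing_ideal n h R"

abbreviation X :: "nat \<Rightarrow> 'k mpoly" where
  "X j \<equiv> mon (var j)"

lemma vanish_0 [simp]: "vanish 0"
  by (simp add: vanish_def)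

lemma vanish_add: "vanish p \<Longrightarrow> vanish q \<Longrightarrow> vanish (p + q)"
  by (simp add: vanish_def eval_add)

lemma vanish_diff: "vanish p \<Longrightarrow> vanish q \<Longrightarrow> vanish (p - q)"
  by (simp add: vanish_def eval_diff)

lemma vanish_scale: "vanish p \<Longrightarrow> vanish (scale a p)"
  by (simp add: vanish_def eval_scale)

lemma vanish_mult: "vanish p \<Longrightarrow> vanish (q * p)"
  by (simp add: vanish_def eval_mult)

lemma J_homog: "J \<inter> homog n k = J_deg k"
proof
  show "J \<inter> homog n k \<subseteq> J_deg k"
  proof
    fix p assume p: "p \<in> J \<inter> homog n k"
    have "eval_poly (R c) p = 0" if "c < h" for c
    proof -
      have "\<forall>a. a \<noteq> 0 \<longrightarrow> eval_poly (\<lambda>j. a * R c j) p = 0"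
        using p that by (simp add: vanishing_ideal_def)
      from spec[OF this, of 1] show ?thesis by simp
    qed
    then show "p \<in> J_deg k" using p by (simp add: J_deg_def vanish_def)
  qed
  show "J_deg k \<subseteq> J \<inter> homog n k"
    by (auto simp: J_deg_def vanishing_ideal_def vanish_def eval_homog_scale homog_polys)
qed

lemma subspace_J_deg: "sc.subspace (J_deg k)"
  using subspace_homog[of n k]
  by (auto simp: J_deg_def sc.subspace_def vanish_add vanish_scale)

lemma J_deg_homog: "p \<in> J_deg k \<Longrightarrow> p \<in> homog n k"
  by (simp add: J_deg_def)

lemma J_deg_mult_var: "p \<in> J_deg k \<Longrightarrow> j \<le> n \<Longrightarrow> X j * p \<in> J_deg (Suc k)"
  by (simp add: J_deg_def homog_mult_var vanish_mult)

lemma homog_0: "p \<in> homog n 0 \<Longrightarrow> p = Poly_Mapping.single 0 (Poly_Mapping.lookup p 0)"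
  by (rule poly_mapping_eqI)
     (auto simp: homog_iff monomials_0 lookup_single when_def in_keys_iff subset_iff)

lemma J_deg_0: "J_deg 0 = {0}"
proof -
  have "p = 0" if "p \<in> J_deg 0" for p
  proof -
    have p: "p = Poly_Mapping.single 0 (Poly_Mapping.lookup p 0)"
      using that by (intro homog_0) (simp add: J_deg_def)
    have "eval_poly (R 0) p = 0" using that h_pos by (simp add: J_deg_def vanish_def)
    then have "Poly_Mapping.lookup p 0 = 0" by (subst (asm) p) simp
    then show ?thesis by (subst p) simp
  qed
  then show ?thesis using sc.subspace_0[OF subspace_J_deg[of 0]] by auto
qed

text \<open>The degree \<open>k\<close> part of the ideal generated by the forms of degree \<open>k - 1\<close> in \<open>J\<close>, and its sum with the
  span of \<open>G\<close>: what is generated in degree \<open>k\<close> once \<open>G\<close> has been chosen there.\<close>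
definition J_times :: "nat \<Rightarrow> 'k mpoly set" where
  "J_times k = {\<Sum>j\<le>n. X j * f j | f. \<forall>j\<le>n. f j \<in> J_deg (k - 1)}"

definition J_times_span :: "nat \<Rightarrow> 'k mpoly set \<Rightarrow> 'k mpoly set" where
  "J_times_span k G = {a + b | a b. a \<in> J_times k \<and> b \<in> kspan G}"

lemma subspace_J_times: "sc.subspace (J_times k)"
  unfolding sc.subspace_def
proof (intro conjI ballI allI)
  show "0 \<in> J_times k" unfolding J_times_def mem_Collect_eq
    by (intro exI[of _ "\<lambda>_. 0"]) (simp add: sc.subspace_0 subspace_J_deg)
next
  fix x y assume "x \<in> J_times k" "y \<in> J_times k"
  then obtain f g where f: "\<forall>j\<le>n. f j \<in> J_deg (k - 1)" "x = (\<Sum>j\<le>n. X j * f j)"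
    and g: "\<forall>j\<le>n. g j \<in> J_deg (k - 1)" "y = (\<Sum>j\<le>n. X j * g j)" unfolding J_times_def by blast
  show "x + y \<in> J_times k" unfolding J_times_def mem_Collect_eq using f g
    by (intro exI[of _ "\<lambda>j. f j + g j"]) (simp add: sc.subspace_add subspace_J_deg sum.distrib distrib_left)
next
  fix c x assume "x \<in> J_times k"
  then obtain f where f: "\<forall>j\<le>n. f j \<in> J_deg (k - 1)" "x = (\<Sum>j\<le>n. X j * f j)" unfolding J_times_def by blast
  show "scale c x \<in> J_times k" unfolding J_times_def mem_Collect_eq using f
    by (intro exI[of _ "\<lambda>j. scale c (f j)"])
       (simp add: sc.subspace_scale subspace_J_deg scale_mult_left sc.scale_sum_right)
qed

lemma subspace_J_times_span: "sc.subspace (J_times_span k G)"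
  unfolding J_times_span_def by (intro sc.subspace_sums subspace_J_times subspace_kspan)

lemma J_times_subset_J_deg: "k \<ge> 1 \<Longrightarrow> J_times k \<subseteq> J_deg k"
  using J_deg_mult_var[of _ "k - 1"]
  by (auto simp: J_times_def intro!: sc.subspace_sum[OF subspace_J_deg])

lemma J_times_subset_J_times_span: "J_times k \<subseteq> J_times_span k G"
  unfolding J_times_span_def using sc.subspace_0[OF subspace_kspan[of G]] by force

lemma subset_J_times_span: "G \<subseteq> J_times_span k G"
  unfolding J_times_span_def kspan_def using sc.subspace_0[OF subspace_J_times[of k]] sc.span_base by force

lemma J_times_span_mono: "G \<subseteq> G' \<Longrightarrow> J_times_span k G \<subseteq> J_times_span k G'"
  unfolding J_times_span_def using kspan_mono by blast

lemma J_times_span_insert: "J_times_span k (insert b G) = {z + scale c b | z c. z \<in> J_times_span k G}"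
proof -
  have "kspan (insert b G) = {x + scale c b | x c. x \<in> kspan G}"
    unfolding kspan_def sc.span_insert
  proof (intro subset_antisym subsetI)
    fix x assume "x \<in> {x. \<exists>k. x - scale k b \<in> sc.span G}"
    then obtain c where "x - scale c b \<in> sc.span G" by blast
    moreover have "x = (x - scale c b) + scale c b" by simp
    ultimately show "x \<in> {x + scale c b |x c. x \<in> sc.span G}" by blast
  next
    fix x assume "x \<in> {x + scale c b |x c. x \<in> sc.span G}"
    then obtain y c where "x = y + scale c b" "y \<in> sc.span G" by blast
    then have "x - scale c b \<in> sc.span G" by simp
    then show "x \<in> {x. \<exists>k. x - scale k b \<in> sc.span G}" by blast
  qed
  then show ?thesis
    unfolding J_times_span_def by (force simp: add.assoc)
qed

lemma J_times_span_subset_J_deg: "k \<ge> 1 \<Longrightarrow> G \<subseteq> J_deg k \<Longrightarrow> J_times_span k G \<subseteq> J_deg k"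
  unfolding J_times_span_def kspan_def using J_times_subset_J_deg[of k] sc.span_minimal[of G "J_deg k"] subspace_J_deg[of k]
  by (auto intro!: sc.subspace_add[of "J_deg k"])

lemma J_times_var: "p \<in> J_deg (k - 1) \<Longrightarrow> j \<le> n \<Longrightarrow> X j * p \<in> J_times k"
  unfolding J_times_def mem_Collect_eq
  by (intro exI[of _ "\<lambda>i. if i = j then p else 0"])
     (auto simp: sc.subspace_0 subspace_J_deg if_distrib[of "\<lambda>x. _ * x"] cong: if_cong)

text \<open>What the elimination provides directly: the monomials of each degree have independent value
  vectors, and these span the value vectors of all products of the previous monomials with a variable.
  By \<open>staircase_complement\<close> this amounts to a complement.\<close>
definition staircase :: "nat \<Rightarrow> (nat \<Rightarrow> monomial set) \<Rightarrow> bool" where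
  "staircase s \<N> \<longleftrightarrow> \<N> 0 = {0} \<and>
     (\<forall>k<s. \<N> (Suc k) \<subseteq> mono_plus n (\<N> k) \<and>
        (\<forall>p\<in>kspan (mon ` \<N> (Suc k)). vanish p \<longrightarrow> p = 0) \<and>
        (\<forall>m\<in>mono_plus n (\<N> k). \<exists>r\<in>kspan (mon ` \<N> (Suc k)). vanish (mon m + r)))"

lemma staircase_Suc:
  assumes "staircase s \<N>" "Suc k \<le> s"
  shows "\<N> (Suc k) \<subseteq> mono_plus n (\<N> k)"
    and "p \<in> kspan (mon ` \<N> (Suc k)) \<Longrightarrow> vanish p \<Longrightarrow> p = 0"
    and "m \<in> mono_plus n (\<N> k) \<Longrightarrow> \<exists>r\<in>kspan (mon ` \<N> (Suc k)). vanish (mon m + r)"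
  using assms by (auto simp: staircase_def Suc_le_eq)

lemma staircase_independent:
  "staircase s \<N> \<Longrightarrow> k \<in> {1..s} \<Longrightarrow> p \<in> kspan (mon ` \<N> k) \<Longrightarrow> vanish p \<Longrightarrow> p = 0"
  using staircase_Suc(2)[of s \<N> "k - 1" p] by simp

lemma staircase_monomials:
  assumes "staircase s \<N>"
  shows "k \<le> s \<Longrightarrow> \<N> k \<subseteq> monomials n k"
proof (induction k)
  case 0
  then show ?case using assms by (simp add: staircase_def monomials_0)
next
  case (Suc k)
  then have "\<N> (Suc k) \<subseteq> mono_plus n (\<N> k)" using staircase_Suc(1)[OF assms] by simp
  then show ?case using Suc mono_plus_monomials[of "\<N> k" n k] by auto
qed

lemma staircase_homog:
  assumes "staircase s \<N>" "k \<le> s" "b \<in> kspan (mon ` \<N> k)"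
  shows "b \<in> homog n k"
  using assms(3) staircase_monomials[OF assms(1,2)] by (auto simp: homog_iff kspan_mon)

text \<open>A monomial of degree \<open>k + 1\<close> is a variable times one of degree \<open>k\<close>, to which the decomposition in
  degree \<open>k\<close> applies. Keeping \<open>J_times\<close> instead of all of \<open>J\<close> on the left is what the
  generation statement needs.\<close>
lemma decompose_step:
  assumes "\<And>p. p \<in> homog n k \<Longrightarrow> \<exists>a\<in>J_deg k. \<exists>b\<in>kspan (mon ` A). p = a + b"
    and "p \<in> homog n (Suc k)"
  shows "\<exists>a\<in>J_times (Suc k). \<exists>b\<in>kspan (mon ` mono_plus n A). p = a + b"
proof -
  let ?S = "{a + b | a b. a \<in> J_times (Suc k) \<and> b \<in> kspan (mon ` mono_plus n A)}"
  have "p \<in> ?S"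
  proof (rule kspan_induct_mon)
    show "p \<in> kspan (mon ` monomials n (Suc k))" using assms(2) by (simp add: homog_def)
    show "sc.subspace ?S" by (intro sc.subspace_sums subspace_J_times subspace_kspan)
    fix m assume m: "m \<in> monomials n (Suc k)"
    then obtain j where j: "j \<in> Poly_Mapping.keys m" using monomials_Suc_nonempty_keys by blast
    note d = monomials_diff[OF m j] var_diff[OF j]
    have "mon (m - var j) \<in> homog n k" unfolding homog_def using d by (auto intro: mon_in_kspan)
    then obtain a b where ab: "a \<in> J_deg k" "b \<in> kspan (mon ` A)" "mon (m - var j) = a + b"
      using assms(1) by blast
    have "Poly_Mapping.keys (X j * b) \<subseteq> mono_plus n A"
    proof
      fix m' assume "m' \<in> Poly_Mapping.keys (X j * b)"
      then obtain b' where "m' = var j + b'" "b' \<in> Poly_Mapping.keys b"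
        using keys_mult[of "X j" b] by (auto simp: mon_def)
      then show "m' \<in> mono_plus n A" using ab(2) d(2) by (auto simp: mono_plus_var kspan_mon)
    qed
    moreover have "mon m = X j * a + X j * b"
      using ab(3) d(3) mon_mult[of "var j" "m - var j"] by (metis distrib_left)
    moreover have "X j * a \<in> J_times (Suc k)" using ab(1) d(2) by (intro J_times_var) auto
    ultimately show "mon m \<in> ?S" unfolding mem_Collect_eq kspan_mon by blast
  qed
  then show ?thesis by blast
qed

lemma decompose:
  assumes st: "staircase s \<N>"
  shows "k \<le> s \<Longrightarrow> p \<in> homog n k \<Longrightarrow> \<exists>a\<in>J_deg k. \<exists>b\<in>kspan (mon ` \<N> k). p = a + b"
proof (induction k arbitrary: p)
  case 0
  have "\<N> 0 = {0}" using st by (simp add: staircase_def)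
  then show ?case using 0
    by (intro bexI[of _ 0] bexI[of _ p]) (auto simp: homog_def monomials_0 J_deg_0)
next
  case (Suc k)
  obtain a b where ab: "a \<in> J_times (Suc k)" "b \<in> kspan (mon ` mono_plus n (\<N> k))" "p = a + b"
    using decompose_step[of k "\<N> k" p] Suc by auto
  let ?S = "{a + b | a b. a \<in> J_deg (Suc k) \<and> b \<in> kspan (mon ` \<N> (Suc k))}"
  have sub: "sc.subspace ?S" by (intro sc.subspace_sums subspace_J_deg subspace_kspan)
  have "b \<in> ?S"
  proof (rule kspan_induct_mon[OF ab(2) sub])
    fix m assume m: "m \<in> mono_plus n (\<N> k)"
    then obtain r where r: "r \<in> kspan (mon ` \<N> (Suc k))" "vanish (mon m + r)"
      using staircase_Suc(3)[OF st Suc.prems(1)] by blast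
    have "m \<in> monomials n (Suc k)"
      using m mono_plus_monomials staircase_monomials[OF st, of k] Suc.prems(1) by auto
    then have "mon m \<in> homog n (Suc k)" by (auto simp: homog_def intro: mon_in_kspan)
    moreover have "r \<in> homog n (Suc k)"
      using r(1) staircase_homog[OF st Suc.prems(1)] by blast
    ultimately have "mon m + r \<in> J_deg (Suc k)"
      using r(2) sc.subspace_add[OF subspace_homog, of "mon m" n "Suc k" r] by (simp add: J_deg_def)
    moreover have "- r \<in> kspan (mon ` \<N> (Suc k))" using r(1) sc.subspace_neg[OF subspace_kspan] by blast
    moreover have "mon m = (mon m + r) + - r" by simp
    ultimately show "mon m \<in> ?S" by blast
  qed
  moreover have "a \<in> ?S"
    using ab(1) J_times_subset_J_deg[of "Suc k"] sc.subspace_0[OF subspace_kspan] by force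
  ultimately have "p \<in> ?S" using sc.subspace_add[OF sub] ab(3) by blast
  then show ?case by blast
qed

lemma staircase_complement:
  assumes st: "staircase s \<N>"
  shows "complement n J s \<N>"
  unfolding complement_def
proof (intro conjI ballI)
  show "\<N> 0 = {0}" using st by (simp add: staircase_def)
  fix k assume k: "k \<in> {1..s}"
  then show "\<N> k \<subseteq> monomials n k" using staircase_monomials[OF st] by simp
  show "\<N> k \<subseteq> mono_plus n (\<N> (k - 1))" using staircase_Suc(1)[OF st, of "k - 1"] k by simp
  show "direct_sum (homog n k) (J \<inter> homog n k) (kspan (mon ` \<N> k))"
    unfolding direct_sum_def J_homog
  proof
    show "homog n k = {a + b |a b. a \<in> J_deg k \<and> b \<in> kspan (mon ` \<N> k)}"
    proof (intro subset_antisym subsetI)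
      fix p :: "'k mpoly" assume "p \<in> homog n k"
      then show "p \<in> {a + b |a b. a \<in> J_deg k \<and> b \<in> kspan (mon ` \<N> k)}"
        using decompose[OF st, of k p] k by auto
    next
      fix p assume "p \<in> {a + b |a b. a \<in> J_deg k \<and> b \<in> kspan (mon ` \<N> k)}"
      then obtain a b where "a \<in> J_deg k" "b \<in> kspan (mon ` \<N> k)" "p = a + b" by blast
      then show "p \<in> homog n k"
        using staircase_homog[OF st, of k b] k J_deg_homog[of a k]
          sc.subspace_add[OF subspace_homog[of n k], of a b] by simp
    qed
    show "J_deg k \<inter> kspan (mon ` \<N> k) = {0}"
      using staircase_independent[OF st k] sc.subspace_0[OF subspace_J_deg] sc.subspace_0[OF subspace_kspan]
      by (auto simp: J_deg_def)
  qed
qed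

lemma psi_eq:
  assumes st: "staircase s \<N>" and k: "k \<in> {1..s}" and m: "m \<in> mono_plus n (\<N> (k - 1))"
    and r: "r \<in> kspan (mon ` \<N> k)" "vanish (mon m + r)"
  shows "psi n J \<N> k m = r"
proof -
  have hm: "mon m \<in> homog n k"
  proof -
    obtain k' where k': "k = Suc k'" using k by (cases k) auto
    have "m \<in> monomials n k"
      using m k mono_plus_monomials[OF staircase_monomials[OF st, of k']] unfolding k' by auto
    then show ?thesis by (auto simp: homog_def intro!: mon_in_kspan)
  qed
  have "g = r" if "g \<in> kspan (mon ` \<N> k)" "mon m + g \<in> J_deg k" for g
  proof -
    have "vanish (g - r)" using vanish_diff[of "mon m + g" "mon m + r"] r(2) that(2) by (simp add: J_deg_def)
    moreover have "g - r \<in> kspan (mon ` \<N> k)"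
      by (rule sc.subspace_diff[OF subspace_kspan that(1) r(1)])
    ultimately have "g - r = 0" by (intro staircase_independent[OF st k])
    then show ?thesis by simp
  qed
  moreover have "mon m + r \<in> J_deg k"
    using hm r k staircase_homog[OF st, of k r] sc.subspace_add[OF subspace_homog, of "mon m" n k r]
    by (simp add: J_deg_def)
  ultimately show ?thesis using r(1) unfolding psi_def J_homog by (intro the_equality conjI) blast+
qed

text \<open>Reducing the products of the previous monomials by elements of \<open>G\<close>
  leaves a remainder in the span of \<open>\<N> k\<close>, which vanishes at the points and hence is zero.\<close>
lemma J_deg_eq_J_times_span:
  assumes st: "staircase s \<N>" and k: "k \<in> {1..s}" and G: "G \<subseteq> J_deg k"
    and bor: "\<And>m. m \<in> mono_plus n (\<N> (k - 1)) \<Longrightarrow> \<exists>r\<in>kspan (mon ` \<N> k). mon m + r \<in> J_times_span k G"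
  shows "J_deg k = J_times_span k G"
proof
  show "J_times_span k G \<subseteq> J_deg k" using J_times_span_subset_J_deg G k by simp
  show "J_deg k \<subseteq> J_times_span k G"
  proof
    fix p assume p: "p \<in> J_deg k"
    obtain k' where k': "k = Suc k'" using k by (cases k) auto
    obtain a b where ab: "a \<in> J_times k" "b \<in> kspan (mon ` mono_plus n (\<N> k'))" "p = a + b"
      using decompose_step[of k' "\<N> k'" p] decompose[OF st, of k'] p k k' by (auto simp: J_deg_def)
    let ?S = "{z + b | z b. z \<in> J_times_span k G \<and> b \<in> kspan (mon ` \<N> k)}"
    have sub: "sc.subspace ?S" by (intro sc.subspace_sums subspace_J_times_span subspace_kspan)
    have "b \<in> ?S"
    proof (rule kspan_induct_mon[OF ab(2) sub])
      fix m assume "m \<in> mono_plus n (\<N> k')"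
      then obtain r where r: "r\<in>kspan (mon ` \<N> k)" "mon m + r \<in> J_times_span k G" using bor k' by auto
      have "- r \<in> kspan (mon ` \<N> k)" using r(1) sc.subspace_neg[OF subspace_kspan] by blast
      moreover have "mon m = (mon m + r) + - r" by simp
      ultimately show "mon m \<in> ?S" using r(2) by blast
    qed
    then obtain z t where zt: "z \<in> J_times_span k G" "t \<in> kspan (mon ` \<N> k)" "b = z + t" by blast
    have az: "a + z \<in> J_times_span k G" using ab(1) J_times_subset_J_times_span zt(1) sc.subspace_add[OF subspace_J_times_span] by blast
    have "a + z \<in> J_deg k" using az J_times_span_subset_J_deg[of k G] G k by auto
    then have "vanish (p - (a + z))" using p vanish_diff[of p "a + z"] by (simp add: J_deg_def)
    then have "vanish t" using ab(3) zt(3) by simp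
    then have "t = 0" using staircase_independent[OF st k zt(2)] by blast
    then show "p \<in> J_times_span k G" using az ab(3) zt(3) by (simp add: add.assoc)
  qed
qed

lemma J_deg_subset_ideal:
  assumes I: "is_ideal n I" and s: "\<And>k. k \<in> {1..s} \<Longrightarrow> J_deg k = J_times_span k (G k) \<and> G k \<subseteq> I"
  shows "k \<le> s \<Longrightarrow> J_deg k \<subseteq> I"
proof (induction k)
  case 0
  then show ?case using I by (simp add: J_deg_0 is_ideal_def)
next
  case (Suc k)
  note sub = is_ideal_subspace[OF I]
  have "X j * f \<in> I" if "f \<in> J_deg k" "j \<le> n" for f j
    using that Suc I single_polys[of "var j" n 1] unfolding is_ideal_def mon_def by auto
  then have "J_times (Suc k) \<subseteq> I" by (auto simp: J_times_def intro!: sc.subspace_sum[OF sub])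
  moreover have "kspan (G (Suc k)) \<subseteq> I" unfolding kspan_def
    using s[of "Suc k"] Suc.prems sc.span_minimal[OF _ sub] by auto
  ultimately have "J_times_span (Suc k) (G (Suc k)) \<subseteq> I" unfolding J_times_span_def using sc.subspace_add[OF sub] by blast
  then show ?case using s[of "Suc k"] Suc.prems by auto
qed

lemma ideal_gen_truncated:
  assumes s: "\<And>k. k \<in> {1..s} \<Longrightarrow> J_deg k = J_times_span k (G k)"
  shows "ideal_gen n (\<Union>k\<in>{1..s}. G k) = truncated_ideal n J s"
proof
  have GJ: "G k \<subseteq> J_deg k" if "k \<in> {1..s}" for k using s[OF that] subset_J_times_span by auto
  have Gp: "(\<Union>k\<in>{1..s}. G k) \<subseteq> polys n" and Jp: "(\<Union>k\<in>{1..s}. J_deg k) \<subseteq> polys n"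
    using GJ J_deg_homog homog_polys by blast+
  show "ideal_gen n (\<Union>k\<in>{1..s}. G k) \<subseteq> truncated_ideal n J s"
    unfolding truncated_ideal_def J_homog
    by (rule ideal_gen_least[OF _ is_ideal_ideal_gen[OF Jp]]) (use GJ ideal_gen_incl in blast)
  have "G k \<subseteq> ideal_gen n (\<Union>k\<in>{1..s}. G k)" if "k \<in> {1..s}" for k
    using that ideal_gen_incl[of "\<Union>k\<in>{1..s}. G k" n] by blast
  then have "J_deg k \<subseteq> ideal_gen n (\<Union>k\<in>{1..s}. G k)" if "k \<in> {1..s}" for k
    using s that by (intro J_deg_subset_ideal[OF is_ideal_ideal_gen[OF Gp], where G = G and s = s]) auto
  then show "truncated_ideal n J s \<subseteq> ideal_gen n (\<Union>k\<in>{1..s}. G k)"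
    unfolding truncated_ideal_def J_homog
    by (intro ideal_gen_least is_ideal_ideal_gen[OF Gp]) blast
qed

text \<open>Minimality of the generators of one degree modulo what the lower degrees generate there.\<close>
definition irredundant :: "nat \<Rightarrow> 'k mpoly set \<Rightarrow> bool" where
  "irredundant k G \<longleftrightarrow> (\<forall>g\<in>G. g \<notin> J_times_span k (G - {g}))"

text \<open>The exchange argument: if an old generator became redundant, its expression would involve \<open>b\<close> with a
  nonzero coefficient and could be solved for \<open>b\<close>. Hence greedy selection yields an irredundant set.\<close>
lemma irredundant_insert:
  assumes "irredundant k G" "b \<notin> J_times_span k G"
  shows "irredundant k (insert b G)"
  unfolding irredundant_def
proof
  have bG: "b \<notin> G" using assms(2) subset_J_times_span by blast
  fix g assume g: "g \<in> insert b G"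
  show "g \<notin> J_times_span k (insert b G - {g})"
  proof (cases "g = b")
    case True
    then show ?thesis using assms(2) bG by simp
  next
    case False
    show ?thesis
    proof
      assume "g \<in> J_times_span k (insert b G - {g})"
      then have "g \<in> J_times_span k (insert b (G - {g}))" using False by (simp add: insert_Diff_if)
      then obtain z c where z: "g = z + scale c b" "z \<in> J_times_span k (G - {g})" unfolding J_times_span_insert by blast
      have "c \<noteq> 0" using z assms(1) g False by (auto simp: irredundant_def)
      then have "b = scale (1 / c) (g - z)" using z(1) by (simp add: sc.scale_right_diff_distrib)
      moreover have "z \<in> J_times_span k G" using z(2) J_times_span_mono[of "G - {g}" G] by blast
      moreover have "g \<in> J_times_span k G" using g False subset_J_times_span by blast
      ultimately have "b \<in> J_times_span k G"
        using sc.subspace_scale[OF subspace_J_times_span] sc.subspace_diff[OF subspace_J_times_span] by metis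
      then show False using assms(2) by simp
    qed
  qed
qed

text \<open>If \<open>g\<close> of degree \<open>k\<close> is left out, the ideal of the remaining generators is contained in the
  set \<open>T\<close> of all polynomials whose components below degree \<open>k\<close> lie in \<open>J\<close> and whose component of
  degree \<open>k\<close> lies in the part of \<open>J\<close> generated without \<open>g\<close>. By irredundance \<open>g\<close> is not in \<open>T\<close>.\<close>
lemma minimal_truncated:
  assumes s: "\<And>k. k \<in> {1..s} \<Longrightarrow> J_deg k = J_times_span k (G k) \<and> irredundant k (G k)"
  shows "minimal_generators n (\<Union>k\<in>{1..s}. G k) (truncated_ideal n J s)"
  unfolding minimal_generators_def
proof (intro conjI allI impI)
  have GJ: "G k \<subseteq> J_deg k" if "k \<in> {1..s}" for k using s[OF that] subset_J_times_span by auto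
  show Gp: "(\<Union>k\<in>{1..s}. G k) \<subseteq> polys n" using GJ J_deg_homog homog_polys by blast
  show eq: "ideal_gen n (\<Union>k\<in>{1..s}. G k) = truncated_ideal n J s"
    using s by (intro ideal_gen_truncated) auto
  fix G' assume G': "G' \<subset> (\<Union>k\<in>{1..s}. G k)"
  then obtain g k where k: "k \<in> {1..s}" and g: "g \<in> G k" "g \<notin> G'" by blast
  let ?Z = "J_times_span k (G k - {g})"
  \<comment> \<open>An ideal that contains all of \<open>G'\<close> but not \<open>g\<close>.\<close>
  define T where "T = {p \<in> polys n. (\<forall>d<k. hom_component d p \<in> J_deg d) \<and> hom_component k p \<in> ?Z}"
  have subT: "sc.subspace T"
    unfolding sc.subspace_def T_def
    using sc.subspace_add[OF subspace_J_deg] sc.subspace_add[OF subspace_J_times_span]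
      sc.subspace_scale[OF subspace_J_deg] sc.subspace_scale[OF subspace_J_times_span]
      sc.subspace_0[OF subspace_J_deg] sc.subspace_0[OF subspace_J_times_span]
      sc.subspace_scale[OF is_ideal_subspace[OF is_ideal_polys]]
      sc.subspace_0[OF is_ideal_subspace[OF is_ideal_polys]]
    by (auto simp: hom_component_add hom_component_scale polys_add)
  have "is_ideal n T"
  proof (rule is_idealI[OF subT])
    show "T \<subseteq> polys n" by (auto simp: T_def)
    fix j p assume j: "j \<le> n" and p: "p \<in> T"
    have "hom_component d (X j * p) \<in> J_deg d" if "d < k" for d
      using that p j J_deg_mult_var[of "hom_component (d - 1) p" "d - 1" j]
      by (cases d) (auto simp: hom_component_mult_var T_def sc.subspace_0 subspace_J_deg)
    moreover have "hom_component k (X j * p) \<in> J_times k"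
      using p j k by (auto simp: hom_component_mult_var T_def intro!: J_times_var)
    moreover have "X j * p \<in> polys n"
      using p j by (auto simp: T_def mon_def intro!: polys_mult single_polys)
    ultimately show "X j * p \<in> T" using J_times_subset_J_times_span unfolding T_def by blast
  qed
  moreover have "G' \<subseteq> T"
  proof
    fix p assume p: "p \<in> G'"
    then obtain d where d: "d \<in> {1..s}" "p \<in> G d" using G' by blast
    then have pd: "p \<in> J_deg d" using GJ by blast
    then have "hom_component e p \<in> J_deg e" for e
      using hom_component_homog[OF J_deg_homog[OF pd], of e] sc.subspace_0[OF subspace_J_deg] by auto
    moreover have "hom_component k p \<in> ?Z"
    proof (cases "d = k")
      case True
      then have "p \<in> G k - {g}" using d(2) p g by auto
      then have "p \<in> ?Z" using subset_J_times_span[of "G k - {g}" k] by (rule rev_subsetD)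
      then show ?thesis using hom_component_homog[OF J_deg_homog[OF pd], of k] True by simp
    next
      case False
      then show ?thesis using hom_component_homog[OF J_deg_homog[OF pd], of k] sc.subspace_0[OF subspace_J_times_span] by simp
    qed
    ultimately show "p \<in> T" using homog_polys[OF J_deg_homog[OF pd]] by (simp add: T_def)
  qed
  ultimately have sub: "ideal_gen n G' \<subseteq> T" by (intro ideal_gen_least)
  show "ideal_gen n G' \<noteq> truncated_ideal n J s"
  proof
    assume "ideal_gen n G' = truncated_ideal n J s"
    moreover have "g \<in> (\<Union>k\<in>{1..s}. G k)" using k g(1) by blast
    ultimately have "g \<in> ideal_gen n G'" using eq ideal_gen_incl[of "\<Union>k\<in>{1..s}. G k" n] by auto
    then have "hom_component k g \<in> ?Z" using sub by (auto simp: T_def)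
    moreover have "hom_component k g = g" using hom_component_homog[of g n k k] J_deg_homog GJ[OF k] g(1) by auto
    ultimately show False using s[OF k] g(1) unfolding irredundant_def by auto
  qed
qed

end

section \<open>Elimination with a dual matrix\<close>
definition mat_vec :: "nat \<Rightarrow> (nat \<Rightarrow> nat \<Rightarrow> 'k::field) \<Rightarrow> (nat \<Rightarrow> 'k) \<Rightarrow> nat \<Rightarrow> 'k" where
  "mat_vec D L v i = (\<Sum>c<D. L i c * v c)"

text \<open>The elimination does not store the inserted vectors in echelon form but an injective matrix \<open>L\<close> that
  sends them to unit vectors: \<open>b i\<close> is the vector attached to the used row \<open>i\<close>, and \<open>L (b i)\<close> is the \<open>i\<close>-th unit
  vector. Then \<open>L v\<close> at once decides whether \<open>v\<close> lies in the span of the inserted vectors, namely whether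
  it vanishes on the unused rows, and lists the coefficients of \<open>v\<close>. The coefficients therefore need no
  separate bookkeeping.\<close>
definition dual_inv :: "nat \<Rightarrow> (nat \<Rightarrow> nat \<Rightarrow> 'k::field) \<Rightarrow> (nat \<Rightarrow> bool) \<Rightarrow> (nat \<Rightarrow> nat \<Rightarrow> 'k) \<Rightarrow> bool" where
  "dual_inv D L U b \<longleftrightarrow>
     (\<forall>v. (\<forall>i<D. mat_vec D L v i = 0) \<longrightarrow> (\<forall>c<D. v c = 0)) \<and>
     (\<forall>i<D. U i \<longrightarrow> (\<forall>i'<D. mat_vec D L (b i) i' = (if i' = i then 1 else 0)))"

definition used_span :: "nat \<Rightarrow> (nat \<Rightarrow> bool) \<Rightarrow> (nat \<Rightarrow> nat \<Rightarrow> 'k::field) \<Rightarrow> (nat \<Rightarrow> 'k) set" where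
  "used_span D U b = {v. \<exists>a. \<forall>c<D. v c = (\<Sum>i\<in>{i. i < D \<and> U i}. a i * b i c)}"

text \<open>One Gauss-Jordan step on \<open>L\<close>, with pivot row \<open>p\<close>, where \<open>w\<close> is the image of the new vector.\<close>
definition pivot :: "(nat \<Rightarrow> nat \<Rightarrow> 'k::field) \<Rightarrow> nat \<Rightarrow> (nat \<Rightarrow> 'k) \<Rightarrow> nat \<Rightarrow> nat \<Rightarrow> 'k" where
  "pivot L p w i c = (if i = p then L p c / w p else L i c - w i * (L p c / w p))"

lemma mat_vec_cong: "(\<And>c. c < D \<Longrightarrow> L i c = L' i c) \<Longrightarrow> (\<And>c. c < D \<Longrightarrow> v c = v' c) \<Longrightarrow> mat_vec D L v i = mat_vec D L' v' i"
  by (simp add: mat_vec_def)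

lemma dual_inv_cong:
  assumes "\<And>i c. i < D \<Longrightarrow> c < D \<Longrightarrow> L i c = L' i c" "\<And>i. i < D \<Longrightarrow> U i \<longleftrightarrow> U' i"
    "\<And>i c. i < D \<Longrightarrow> U i \<Longrightarrow> c < D \<Longrightarrow> b i c = b' i c"
  shows "dual_inv D L U b \<longleftrightarrow> dual_inv D L' U' b'"
proof -
  have "mat_vec D L v i = mat_vec D L' v i" if "i < D" for v i
    using that assms(1) by (intro mat_vec_cong) auto
  moreover have "mat_vec D L' (b i) i' = mat_vec D L' (b' i) i'" if "i < D" "U i" for i i'
    using that assms(3) by (intro mat_vec_cong) auto
  ultimately show ?thesis using assms(2) by (auto simp: dual_inv_def)
qed

lemma mat_vec_linear: "mat_vec D L (\<lambda>c. u c - (\<Sum>i\<in>A. a i * b i c)) k = mat_vec D L u k - (\<Sum>i\<in>A. a i * mat_vec D L (b i) k)"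
proof -
  have "(\<Sum>c<D. L k c * (\<Sum>i\<in>A. a i * b i c)) = (\<Sum>i\<in>A. a i * (\<Sum>c<D. L k c * b i c))"
    unfolding sum_distrib_left by (subst sum.swap) (simp add: mult_ac)
  then show ?thesis by (simp add: mat_vec_def right_diff_distrib sum_subtractf)
qed

lemma mat_vec_unit: "i < D \<Longrightarrow> (\<And>c. c < D \<Longrightarrow> L i c = (if i = c then 1 else 0)) \<Longrightarrow> mat_vec D L v i = v i"
  by (simp add: mat_vec_def if_distrib[of "\<lambda>x. x * _"] cong: if_cong)

lemma dual_inv_init:
  assumes "\<And>i c. i < D \<Longrightarrow> c < D \<Longrightarrow> L i c = (if i = c then 1 else 0)" "\<And>i. i < D \<Longrightarrow> \<not> U i"
  shows "dual_inv D L U b"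
  using assms by (auto simp: dual_inv_def mat_vec_unit)

lemma dual_inv_coeffs:
  assumes inv: "dual_inv D L U b" and a: "\<And>c. c < D \<Longrightarrow> v c = (\<Sum>i\<in>{i. i < D \<and> U i}. a i * b i c)"
    and k: "k < D"
  shows "mat_vec D L v k = (if U k then a k else 0)"
proof -
  have "mat_vec D L (\<lambda>c. v c - (\<Sum>i\<in>{i. i < D \<and> U i}. a i * b i c)) k = mat_vec D L (\<lambda>c. 0) k"
    using a by (intro mat_vec_cong) auto
  then have "mat_vec D L v k = (\<Sum>i\<in>{i. i < D \<and> U i}. a i * mat_vec D L (b i) k)"
    unfolding mat_vec_linear by (simp add: mat_vec_def)
  also have "\<dots> = (\<Sum>i\<in>{i. i < D \<and> U i}. if i = k then a i else 0)"
    using inv k by (intro sum.cong) (auto simp: dual_inv_def)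
  finally show ?thesis using k by (simp add: sum.delta)
qed

lemma dual_inv_dep:
  assumes inv: "dual_inv D L U b" and w: "\<And>i. i < D \<Longrightarrow> \<not> U i \<Longrightarrow> mat_vec D L v i = 0" and c: "c < D"
  shows "v c = (\<Sum>i\<in>{i. i < D \<and> U i}. mat_vec D L v i * b i c)"
proof -
  let ?u = "\<lambda>c. v c - (\<Sum>i\<in>{i. i < D \<and> U i}. mat_vec D L v i * b i c)"
  have "mat_vec D L ?u k = 0" if k: "k < D" for k
  proof -
    have "(\<Sum>i\<in>{i. i < D \<and> U i}. mat_vec D L v i * mat_vec D L (b i) k)
        = (\<Sum>i\<in>{i. i < D \<and> U i}. if i = k then mat_vec D L v i else 0)"
      using inv k by (intro sum.cong) (auto simp: dual_inv_def)
    then show ?thesis unfolding mat_vec_linear using k w[of k] by (simp add: sum.delta)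
  qed
  then have "?u c = 0" using inv c unfolding dual_inv_def by blast
  then show ?thesis by simp
qed

lemma mat_vec_pivot:
  "mat_vec D (pivot L p w) u i = (if i = p then mat_vec D L u p / w p else mat_vec D L u i - w i * (mat_vec D L u p / w p))"
proof (cases "i = p")
  case False
  have "(\<Sum>c<D. (L i c - w i * (L p c / w p)) * u c) = (\<Sum>c<D. L i c * u c - w i / w p * (L p c * u c))"
    by (intro sum.cong refl) (simp add: algebra_simps)
  also have "\<dots> = mat_vec D L u i - w i / w p * mat_vec D L u p"
    by (simp only: mat_vec_def sum_subtractf sum_distrib_left)
  finally show ?thesis using False by (simp add: mat_vec_def pivot_def)
qed (simp add: mat_vec_def pivot_def sum_divide_distrib)

text \<open>The rows already used stay dual to their vectors, because the image of each of these vectors is zero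
  in the unused row \<open>p\<close>, so subtracting multiples of that row changes nothing.\<close>
lemma dual_inv_pivot:
  assumes inv: "dual_inv D L U b" and p: "p < D" "\<not> U p" "mat_vec D L v p \<noteq> 0"
  shows "dual_inv D (pivot L p (mat_vec D L v)) (\<lambda>i. U i \<or> i = p) (b(p := v))"
  unfolding dual_inv_def
proof (intro conjI allI impI)
  fix u c assume u: "\<forall>i<D. mat_vec D (pivot L p (mat_vec D L v)) u i = 0" and c: "c < D"
  have "mat_vec D L u p = 0" using u p by (auto simp: mat_vec_pivot)
  then have "mat_vec D L u i = 0" if "i < D" for i
    using u[rule_format, OF that] by (auto simp: mat_vec_pivot split: if_splits)
  then show "u c = 0" using inv c unfolding dual_inv_def by blast
next
  fix i i' assume i: "i < D" "U i \<or> i = p" and i': "i' < D"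
  show "mat_vec D (pivot L p (mat_vec D L v)) ((b(p := v)) i) i' = (if i' = i then 1 else 0)"
    using inv p i i' by (auto simp: mat_vec_pivot dual_inv_def)
qed

lemma used_span_cong: "u \<in> used_span D U b \<Longrightarrow> (\<And>c. c < D \<Longrightarrow> u c = v c) \<Longrightarrow> v \<in> used_span D U b"
  by (auto simp: used_span_def)

lemma used_span_0: "(\<lambda>_. 0) \<in> used_span D U b"
  unfolding used_span_def by (auto intro!: exI[of _ "\<lambda>_. 0"])

lemma used_span_linear:
  assumes "u \<in> used_span D U b" "v \<in> used_span D U b"
  shows "(\<lambda>c. u c + a * v c) \<in> used_span D U b"
proof -
  obtain x y where "\<forall>c<D. u c = (\<Sum>i\<in>{i. i < D \<and> U i}. x i * b i c)"
    "\<forall>c<D. v c = (\<Sum>i\<in>{i. i < D \<and> U i}. y i * b i c)" using assms by (auto simp: used_span_def)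
  then show ?thesis unfolding used_span_def mem_Collect_eq
    by (intro exI[of _ "\<lambda>i. x i + a * y i"])
       (simp add: distrib_right sum.distrib sum_distrib_left mult.assoc)
qed

lemma used_span_pivot:
  assumes p: "p < D" "\<not> U p"
  shows "used_span D (\<lambda>i. U i \<or> i = p) (b(p := v)) = {u. \<exists>x\<in>used_span D U b. \<exists>a. \<forall>c<D. u c = x c + a * v c}"
proof -
  have e: "{i. i < D \<and> (U i \<or> i = p)} = insert p {i. i < D \<and> U i}" using p by auto
  have s: "(\<Sum>i\<in>{i. i < D \<and> (U i \<or> i = p)}. a i * (b(p := v)) i c)
      = (\<Sum>i\<in>{i. i < D \<and> U i}. a i * b i c) + a p * v c" for a c
    unfolding e using p(2) by (subst sum.insert) (auto intro!: sum.cong)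
  show ?thesis
  proof (intro subset_antisym subsetI)
    fix u assume "u \<in> used_span D (\<lambda>i. U i \<or> i = p) (b(p := v))"
    then obtain a where "\<forall>c<D. u c = (\<Sum>i\<in>{i. i < D \<and> U i}. a i * b i c) + a p * v c"
      unfolding used_span_def mem_Collect_eq s by blast
    moreover have "(\<lambda>c. \<Sum>i\<in>{i. i < D \<and> U i}. a i * b i c) \<in> used_span D U b" by (auto simp: used_span_def)
    ultimately show "u \<in> {u. \<exists>x\<in>used_span D U b. \<exists>a. \<forall>c<D. u c = x c + a * v c}"
      unfolding mem_Collect_eq by (intro bexI exI)
  next
    fix u assume "u \<in> {u. \<exists>x\<in>used_span D U b. \<exists>a. \<forall>c<D. u c = x c + a * v c}"
    then obtain x a where x: "x \<in> used_span D U b" and u: "\<forall>c<D. u c = x c + a * v c" by blast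
    from x obtain y where "\<forall>c<D. x c = (\<Sum>i\<in>{i. i < D \<and> U i}. y i * b i c)" by (auto simp: used_span_def)
    with u have y: "\<forall>c<D. u c = (\<Sum>i\<in>{i. i < D \<and> U i}. y i * b i c) + a * v c" by simp
    have "(\<Sum>i\<in>{i. i < D \<and> U i}. (y(p := a)) i * b i c) = (\<Sum>i\<in>{i. i < D \<and> U i}. y i * b i c)" for c
      using p by (intro sum.cong) auto
    with y show "u \<in> used_span D (\<lambda>i. U i \<or> i = p) (b(p := v))"
      unfolding used_span_def mem_Collect_eq s by (intro exI[of _ "y(p := a)"]) simp
  qed
qed

lemma used_span_iff:
  assumes "dual_inv D L U b"
  shows "v \<in> used_span D U b \<longleftrightarrow> (\<forall>i<D. \<not> U i \<longrightarrow> mat_vec D L v i = 0)"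
proof
  assume "v \<in> used_span D U b"
  then obtain a where "\<forall>c<D. v c = (\<Sum>i\<in>{i. i < D \<and> U i}. a i * b i c)" by (auto simp: used_span_def)
  then show "\<forall>i<D. \<not> U i \<longrightarrow> mat_vec D L v i = 0" using dual_inv_coeffs[OF assms, of v a] by auto
next
  assume "\<forall>i<D. \<not> U i \<longrightarrow> mat_vec D L v i = 0"
  then show "v \<in> used_span D U b" unfolding used_span_def using dual_inv_dep[OF assms, of v] by blast
qed

context points
begin

section \<open>Lifting to value vectors and Koszul relations\<close>

text \<open>A tuple \<open>f\<close> of forms is encoded by the values of its entries at the points: coordinate
  \<open>j * h + c\<close> holds the value of \<open>f j\<close> at the point \<open>c\<close>.\<close>
definition lift :: "(nat \<Rightarrow> 'k mpoly) \<Rightarrow> nat \<Rightarrow> 'k" where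
  "lift f x = eval_poly (R (x mod h)) (f (x div h))"

definition unlift :: "(nat \<Rightarrow> 'k mpoly) \<Rightarrow> 'k mpoly" where
  "unlift f = (\<Sum>j\<le>n. X j * f j)"

abbreviation "lift_dim \<equiv> (n + 1) * h"

definition lifts :: "nat \<Rightarrow> 'k mpoly set \<Rightarrow> (nat \<Rightarrow> 'k) set" where
  "lifts k Z = {v. \<exists>f. (\<forall>j\<le>n. f j \<in> homog n (k - 1)) \<and> unlift f \<in> Z \<and> (\<forall>x<lift_dim. v x = lift f x)}"

lemma lifts_I:
  assumes "\<And>j. j \<le> n \<Longrightarrow> f j \<in> homog n (k - 1)" "unlift f \<in> Z" "\<And>x. x < lift_dim \<Longrightarrow> v x = lift f x"
  shows "v \<in> lifts k Z"
  unfolding lifts_def mem_Collect_eq using assms by (intro exI[of _ f] conjI allI impI)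

lemma lifts_E:
  assumes "v \<in> lifts k Z"
  obtains f where "\<And>j. j \<le> n \<Longrightarrow> f j \<in> homog n (k - 1)" "unlift f \<in> Z" "\<And>x. x < lift_dim \<Longrightarrow> v x = lift f x"
  using assms unfolding lifts_def by blast

lemma unlift_linear: "unlift (\<lambda>j. f j + scale a (g j)) = unlift f + scale a (unlift g)"
  by (simp add: unlift_def distrib_left sum.distrib scale_mult_left sc.scale_sum_right)

lemma lift_linear: "lift (\<lambda>j. f j + scale a (g j)) x = lift f x + a * lift g x"
  by (simp add: lift_def eval_add eval_scale)

lemma block_bounds:
  assumes "x < lift_dim" shows "x mod h < h" "x div h \<le> n"
proof -
  show "x mod h < h" using h_pos by simp
  have "x div h < n + 1" using assms by (simp add: less_mult_imp_div_less)
  then show "x div h \<le> n" by simp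
qed

lemma lift_eqD:
  assumes "\<forall>x<lift_dim. lift f x = lift g x" "j \<le> n"
  shows "vanish (f j - g j)"
  unfolding vanish_def
proof (intro allI impI)
  fix c assume c: "c < h"
  have "j * h + c < lift_dim" using assms(2) c
    by (metis Suc_eq_plus1 add.commute add_less_cancel_left le_imp_less_Suc less_le_trans mult_Suc mult_le_mono1 Suc_leI)
  with assms(1) have "lift f (j * h + c) = lift g (j * h + c)" by blast
  then show "eval_poly (R c) (f j - g j) = 0" using c by (simp add: lift_def eval_diff)
qed

text \<open>Why membership can be tested on vectors: two tuples with the same vector differ by a tuple with entries
  in \<open>J\<close>, so that their images under \<open>unlift\<close> differ by an element of \<open>J_times\<close>.\<close>
lemma lifts_iff:
  assumes k: "k \<ge> 1" and f: "\<forall>j\<le>n. f j \<in> homog n (k - 1)" and v: "\<forall>x<lift_dim. v x = lift f x"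
  shows "v \<in> lifts k (J_times_span k G) \<longleftrightarrow> unlift f \<in> J_times_span k G"
proof
  assume "v \<in> lifts k (J_times_span k G)"
  then obtain g where g: "\<And>j. j \<le> n \<Longrightarrow> g j \<in> homog n (k - 1)" "unlift g \<in> J_times_span k G"
    "\<And>x. x < lift_dim \<Longrightarrow> v x = lift g x" by (erule lifts_E)
  then have g3: "\<forall>x<lift_dim. lift f x = lift g x" using v by simp
  have "f j - g j \<in> J_deg (k - 1)" if "j \<le> n" for j
    using lift_eqD[OF g3 that] f g(1) that sc.subspace_diff[OF subspace_homog, of "f j" n "k - 1" "g j"]
    by (simp add: J_deg_def)
  then have "unlift (\<lambda>j. f j - g j) \<in> J_times k"
    unfolding J_times_def unlift_def by (intro CollectI exI[of _ "\<lambda>j. f j - g j"]) simp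
  then have "unlift (\<lambda>j. f j - g j) \<in> J_times_span k G" by (rule rev_subsetD[OF _ J_times_subset_J_times_span])
  then have "unlift (\<lambda>j. f j - g j) + unlift g \<in> J_times_span k G" using g(2) by (rule sc.subspace_add[OF subspace_J_times_span])
  moreover have "unlift f = unlift (\<lambda>j. f j - g j) + unlift g"
    by (simp add: unlift_def sum.distrib[symmetric] distrib_left[symmetric])
  ultimately show "unlift f \<in> J_times_span k G" by simp
next
  assume "unlift f \<in> J_times_span k G"
  then show "v \<in> lifts k (J_times_span k G)" using f v by (intro lifts_I[of f]) auto
qed

lemma lifts_insert:
  assumes f: "\<forall>j\<le>n. f j \<in> homog n (k - 1)" and v: "\<forall>x<lift_dim. v x = lift f x"
  shows "lifts k (J_times_span k (insert (unlift f) G)) = {u. \<exists>x\<in>lifts k (J_times_span k G). \<exists>a. \<forall>c<lift_dim. u c = x c + a * v c}"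
proof (intro subset_antisym subsetI)
  have hom: "g j + scale a (f j) \<in> homog n (k - 1)" if "g j \<in> homog n (k - 1)" "j \<le> n" for g a j
    using that f by (intro sc.subspace_add[OF subspace_homog] sc.subspace_scale[OF subspace_homog]) auto
  {
    fix u assume "u \<in> lifts k (J_times_span k (insert (unlift f) G))"
    then obtain g where g: "\<And>j. j \<le> n \<Longrightarrow> g j \<in> homog n (k - 1)"
      "unlift g \<in> J_times_span k (insert (unlift f) G)" "\<And>x. x < lift_dim \<Longrightarrow> u x = lift g x" by (erule lifts_E)
    then obtain z a where z: "unlift g = z + scale a (unlift f)" "z \<in> J_times_span k G" unfolding J_times_span_insert by blast
    let ?g = "\<lambda>j. g j + scale (- a) (f j)"
    have "unlift ?g = z" unfolding unlift_linear z(1) by simp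
    then have "lift ?g \<in> lifts k (J_times_span k G)" using z(2)
      by (intro lifts_I[of ?g] hom g(1)) auto
    moreover have "\<forall>c<lift_dim. u c = lift ?g c + a * v c" unfolding lift_linear using g(3) v by simp
    ultimately show "u \<in> {u. \<exists>x\<in>lifts k (J_times_span k G). \<exists>a. \<forall>c<lift_dim. u c = x c + a * v c}"
      unfolding mem_Collect_eq by (intro bexI exI)
  }
  fix u assume "u \<in> {u. \<exists>x\<in>lifts k (J_times_span k G). \<exists>a. \<forall>c<lift_dim. u c = x c + a * v c}"
  then obtain x a where x: "x \<in> lifts k (J_times_span k G)" and u: "\<forall>c<lift_dim. u c = x c + a * v c" by auto
  from x obtain g where g: "\<And>j. j \<le> n \<Longrightarrow> g j \<in> homog n (k - 1)" "unlift g \<in> J_times_span k G"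
    "\<And>c. c < lift_dim \<Longrightarrow> x c = lift g c" by (erule lifts_E)
  have "unlift (\<lambda>j. g j + scale a (f j)) \<in> J_times_span k (insert (unlift f) G)"
    unfolding unlift_linear J_times_span_insert using g(2) by auto
  then show "u \<in> lifts k (J_times_span k (insert (unlift f) G))"
    using hom g(1,3) u v by (intro lifts_I[of "\<lambda>j. g j + scale a (f j)"]) (auto simp: lift_linear)
qed

text \<open>The Koszul relation of \<open>x\<^sub>i\<close> and \<open>x\<^sub>j\<close> times \<open>q\<close>.\<close>
definition koszul :: "nat \<Rightarrow> nat \<Rightarrow> 'k mpoly \<Rightarrow> nat \<Rightarrow> 'k mpoly" where
  "koszul i j q l = (if l = i then X j * q else 0) - (if l = j then X i * q else 0)"

lemma unlift_koszul: "i \<le> n \<Longrightarrow> j \<le> n \<Longrightarrow> unlift (koszul i j q) = 0"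
  by (simp add: unlift_def koszul_def right_diff_distrib sum_subtractf if_distrib[of "\<lambda>x. _ * x"] mult_ac cong: if_cong)

lemma koszul_homog: "i \<le> n \<Longrightarrow> j \<le> n \<Longrightarrow> q \<in> homog n k \<Longrightarrow> koszul i j q l \<in> homog n (Suc k)"
  unfolding koszul_def
  by (intro sc.subspace_diff[OF subspace_homog]) (auto simp: homog_mult_var sc.subspace_0 subspace_homog)

lemma koszul_in_lifts:
  "i \<le> n \<Longrightarrow> j \<le> n \<Longrightarrow> q \<in> homog n k \<Longrightarrow> \<forall>x<lift_dim. v x = lift (koszul i j q) x \<Longrightarrow> v \<in> lifts (Suc (Suc k)) (J_times (Suc (Suc k)))"
  unfolding lifts_def mem_Collect_eq
  by (rule exI[of _ "koszul i j q"]) (simp add: koszul_homog unlift_koszul sc.subspace_0 subspace_J_times)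

lemma lifts_J_times_subspace:
  shows "(\<lambda>_. 0) \<in> lifts k (J_times k)"
    and "u \<in> lifts k (J_times k) \<Longrightarrow> v \<in> lifts k (J_times k) \<Longrightarrow> \<forall>c<lift_dim. w c = u c + a * v c \<Longrightarrow> w \<in> lifts k (J_times k)"
proof -
  show "(\<lambda>_. 0) \<in> lifts k (J_times k)" unfolding lifts_def mem_Collect_eq
    by (rule exI[of _ "\<lambda>_. 0"]) (simp add: unlift_def lift_def sc.subspace_0 subspace_homog subspace_J_times)
  assume "u \<in> lifts k (J_times k)" "v \<in> lifts k (J_times k)" and w: "\<forall>c<lift_dim. w c = u c + a * v c"
  then obtain f g where "\<forall>j\<le>n. f j \<in> homog n (k - 1)" "unlift f \<in> J_times k" "\<forall>c<lift_dim. u c = lift f c"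
    "\<forall>j\<le>n. g j \<in> homog n (k - 1)" "unlift g \<in> J_times k" "\<forall>c<lift_dim. v c = lift g c" unfolding lifts_def by blast
  then show "w \<in> lifts k (J_times k)" unfolding lifts_def mem_Collect_eq using w
    by (intro exI[of _ "\<lambda>j. f j + scale a (g j)"])
      (simp add: unlift_linear lift_linear sc.subspace_add[OF subspace_homog] sc.subspace_scale[OF subspace_homog]
        sc.subspace_add[OF subspace_J_times] sc.subspace_scale[OF subspace_J_times])
qed

abbreviation least_var :: "monomial \<Rightarrow> nat" where "least_var m \<equiv> Min (Poly_Mapping.keys m)"

text \<open>The vector of the particular tuple in which every monomial is divided by its
  least variable. It is linear in the polynomial, which makes it a section of \<open>unlift\<close> on vectors.\<close>
definition standard_lift :: "'k mpoly \<Rightarrow> nat \<Rightarrow> 'k" where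
  "standard_lift p x = lin_ext (\<lambda>m. if least_var m = x div h then mono_value (R (x mod h)) (m - var (x div h)) else 0) p"

abbreviation at_block :: "nat \<Rightarrow> 'k mpoly \<Rightarrow> nat \<Rightarrow> 'k mpoly" where
  "at_block j f \<equiv> (\<lambda>l. if l = j then f else 0)"

lemma var_add_diff: "var j + m - var j = m"
  by (simp add: add.commute)

text \<open>A form \<open>f\<close> placed in block \<open>j\<close> and the standard lift of \<open>x\<^sub>j f\<close> differ by Koszul relations
  (\<open>blk\<close>): for a monomial either they agree or they are the two sides of one such relation. If
  \<open>x\<^sub>0 g\<^sub>0 + \<dots> + x\<^sub>n g\<^sub>n = 0\<close>, the standard lifts of the summands add up to zero, so the tuple \<open>g\<close> itself
  is a combination of Koszul relations. It suffices to take \<open>q\<close> in the staircase, because the vector of a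
  Koszul relation depends on \<open>q\<close> only modulo \<open>J\<close>.\<close>
theorem koszul_span:
  assumes st: "staircase s \<N>" and k: "k \<ge> 1" "k - 2 \<le> s"
    and S0: "(\<lambda>_. 0) \<in> S"
    and S1: "\<And>u v w a. u \<in> S \<Longrightarrow> v \<in> S \<Longrightarrow> \<forall>c<lift_dim. w c = u c + a * v c \<Longrightarrow> w \<in> S"
    and rel: "\<And>i j q. i \<le> n \<Longrightarrow> j \<le> n \<Longrightarrow> k \<ge> 2 \<Longrightarrow> q \<in> \<N> (k - 2) \<Longrightarrow> lift (koszul i j (mon q)) \<in> S"
  shows "lifts k (J_times k) \<subseteq> S"
proof -
  have Scong: "w \<in> S" if "u \<in> S" "\<forall>c<lift_dim. w c = u c" for u w
    using S1[OF that(1) S0, of w 0] that(2) by simp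
  have rel': "lift (koszul i j q) \<in> S" if ij: "i \<le> n" "j \<le> n" and k2: "k \<ge> 2" and q: "q \<in> homog n (k - 2)" for i j q
  proof -
    obtain a b where ab: "a \<in> J_deg (k - 2)" "b \<in> kspan (mon ` \<N> (k - 2))" "q = a + b"
      using decompose[OF st k(2) q] by blast
    have "b \<in> {b. lift (koszul i j b) \<in> S}"
    proof (rule kspan_induct_mon[OF ab(2)])
      have linear: "lift (koszul i j (x + scale c y)) z = lift (koszul i j x) z + c * lift (koszul i j y) z" for x y c z
        by (auto simp: lift_def koszul_def eval_diff eval_mult eval_add eval_scale algebra_simps)
      have z: "lift (koszul i j 0) = (\<lambda>_. 0)" by (auto simp: lift_def koszul_def fun_eq_iff)
      have a: "lift (koszul i j (x + scale c y)) \<in> S" if "lift (koszul i j x) \<in> S" "lift (koszul i j y) \<in> S" for x y c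
        using S1[OF that, of _ c] linear by simp
      show "sc.subspace {b. lift (koszul i j b) \<in> S}"
        unfolding sc.subspace_def using a[of _ _ 1] a[of 0] S0 z by simp
    qed (use rel ij k2 in auto)
    moreover have "\<forall>x<lift_dim. lift (koszul i j q) x = lift (koszul i j b) x"
      using ab(1) block_bounds
      by (auto simp: ab(3) lift_def koszul_def eval_diff eval_mult eval_add J_deg_def vanish_def)
    ultimately show ?thesis using Scong by blast
  qed
  have standard_lift_linear: "standard_lift (p + scale c q) x = standard_lift p x + c * standard_lift q x" for p q c x
    by (simp add: standard_lift_def lin_ext_add lin_ext_scale)
  have blk: "(\<lambda>x. lift (at_block j f) x - standard_lift (X j * f) x) \<in> S" (is "?d f \<in> S")
    if j: "j \<le> n" and f: "f \<in> homog n (k - 1)" for j f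
  proof -
    have "f \<in> {f. ?d f \<in> S}"
    proof (rule kspan_induct_mon)
      show "f \<in> kspan (mon ` monomials n (k - 1))" using f by (simp add: homog_def)
      have "X j * (p + scale c q) = X j * p + scale c (X j * q)" for p q c
        by (simp add: distrib_left scale_mult_left)
      then have linear: "?d (p + scale c q) x = ?d p x + c * ?d q x" for p q c x
        by (auto simp: standard_lift_linear lift_def eval_add eval_scale algebra_simps)
      have a: "?d (p + scale c q) \<in> S" if "?d p \<in> S" "?d q \<in> S" for p q c
        by (rule S1[OF that, of _ c]) (use linear in blast)
      have z: "?d 0 \<in> S" using S0 by (simp add: lift_def standard_lift_def)
      show "sc.subspace {f. ?d f \<in> S}"
      proof (intro sc.subspaceI CollectI)
        show "?d (x + y) \<in> S" if "x \<in> {f. ?d f \<in> S}" "y \<in> {f. ?d f \<in> S}" for x y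
          using a[of x y 1] that by (simp only: sc.scale_one mem_Collect_eq)
        show "?d (scale c x) \<in> S" if "x \<in> {f. ?d f \<in> S}" for x c
          using a[OF z, of x c] that by (simp only: add_0 mem_Collect_eq)
      qed (rule z)
      fix m assume m: "m \<in> monomials n (k - 1)"
      define l where "l = least_var (var j + m)"
      have l: "l \<in> insert j (Poly_Mapping.keys m)"
        using Min_in[of "Poly_Mapping.keys (var j + m)"] by (simp add: l_def keys_add_nat)
      have e: "?d (mon m) x = (if x div h = j then mono_value (R (x mod h)) m else 0)
          - (if x div h = l then mono_value (R (x mod h)) (var j + m - var l) else 0)" for x
        unfolding standard_lift_def mon_mult by (auto simp: lift_def mon_def l_def)
      have "?d (mon m) \<in> S"
      proof (cases "l = j")
        case True
        then have "?d (mon m) = (\<lambda>_. 0)" using e by (simp add: var_add_diff fun_eq_iff)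
        then show ?thesis using S0 by simp
      next
        case False
        then have lm: "l \<in> Poly_Mapping.keys m" using l by simp
        then obtain k' where k': "k = Suc (Suc k')"
        proof (cases "k - 1")
          case 0
          then show ?thesis using m lm by (simp add: monomials_0)
        next
          case (Suc k')
          then show ?thesis using that[of k'] by simp
        qed
        have q: "m - var l \<in> monomials n k'" "l \<le> n" "var l + (m - var l) = m"
          using m lm monomials_diff[of m n k' l] var_diff[OF lm] k' by auto
        have "mon (m - var l) \<in> homog n k'" using q(1) by (auto simp: homog_def intro: mon_in_kspan)
        then have "lift (koszul j l (mon (m - var l))) \<in> S" using rel'[of j l] j q(2) k' by simp
        moreover have "var j + m - var l = var j + (m - var l)"
          using q(3) by (metis add.left_commute var_add_diff)
        then have "lift (koszul j l (mon (m - var l))) = ?d (mon m)"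
          using q(3) False unfolding fun_eq_iff e by (auto simp: lift_def koszul_def mon_mult eval_diff)
        ultimately show ?thesis by simp
      qed
      then show "mon m \<in> {f. ?d f \<in> S}" by simp
    qed
    then show ?thesis by simp
  qed
  show ?thesis
  proof
    fix v assume "v \<in> lifts k (J_times k)"
    then obtain g a where g: "\<forall>j\<le>n. g j \<in> homog n (k - 1)" "\<forall>x<lift_dim. v x = lift g x"
      and a: "\<forall>j\<le>n. a j \<in> J_deg (k - 1)" "unlift g = (\<Sum>j\<le>n. X j * a j)" unfolding lifts_def J_times_def by blast
    define f where "f j = g j - a j" for j
    have f: "f j \<in> homog n (k - 1)" if "j \<le> n" for j
      using that g(1) a(1) sc.subspace_diff[OF subspace_homog, of "g j" n "k - 1" "a j"] by (simp add: f_def J_deg_def)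
    have "unlift f = 0" using a(2) by (simp add: f_def unlift_def right_diff_distrib sum_subtractf)
    then have z: "standard_lift (\<Sum>j\<le>n. X j * f j) x = 0" for x by (simp add: standard_lift_def unlift_def)
    have part: "(\<lambda>x. \<Sum>j<m. lift (at_block j (f j)) x - standard_lift (X j * f j) x) \<in> S" if "m \<le> Suc n" for m
      using that
    proof (induction m)
      case 0
      then show ?case using S0 by simp
    next
      case (Suc m)
      then have "f m \<in> homog n (k - 1)" "m \<le> n" using f by auto
      from S1[OF Suc.IH blk[OF this(2,1)], of _ 1] show ?case using Suc.prems by simp
    qed
    have "v x = (\<Sum>j<Suc n. lift (at_block j (f j)) x - standard_lift (X j * f j) x)" if x: "x < lift_dim" for x
    proof -
      have "(\<Sum>j<Suc n. standard_lift (X j * f j) x) = 0"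
        using z[of x] by (simp add: standard_lift_def lin_ext_sum lessThan_Suc_atMost)
      moreover have "(\<Sum>j<Suc n. lift (at_block j (f j)) x) = lift f x"
        using block_bounds[OF x] by (simp add: lift_def if_distrib[of "eval_poly _"] lessThan_Suc_atMost cong: if_cong)
      moreover have "lift f x = lift g x"
        using a(1) block_bounds[OF x] by (simp add: lift_def f_def eval_diff J_deg_def vanish_def)
      ultimately show ?thesis using g(2) x by (simp only: sum_subtractf) simp
    qed
    then show "v \<in> S" using Scong[OF part[of "Suc n"]] by blast
  qed
qed

end

section \<open>A weakest precondition calculus with costs\<close>
notation Seq (infixr ";;" 60)

text \<open>The postcondition also takes the cost, so that straight-line programs are evaluated by rewriting.\<close>
definition wp :: "com \<Rightarrow> nat mem \<Rightarrow> 'k::field mem \<Rightarrow> (nat \<Rightarrow> nat mem \<Rightarrow> 'k mem \<Rightarrow> bool) \<Rightarrow> bool" where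
  "wp c N F Q \<longleftrightarrow> (\<exists>t N' F'. exec c (N, F) t (N', F') \<and> Q t N' F')"

lemma wp_mono: "wp c N F Q \<Longrightarrow> (\<And>t N' F'. Q t N' F' \<Longrightarrow> Q' t N' F') \<Longrightarrow> wp c N F Q'"
  unfolding wp_def by blast

inductive_cases SkipE: "exec Skip \<sigma> t \<tau>"
inductive_cases NSetE: "exec (NSet l e) \<sigma> t \<tau>"
inductive_cases FZeroE: "exec (FZero l) \<sigma> t \<tau>"
inductive_cases FOneE: "exec (FOne l) \<sigma> t \<tau>"
inductive_cases FCopyE: "exec (FCopy l l1) \<sigma> t \<tau>"
inductive_cases FOpE: "exec (FOp f l l1 l2) \<sigma> t \<tau>"
inductive_cases SeqE: "exec (Seq c d) \<sigma> t \<tau>"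
inductive_cases CondE: "exec (Cond e c d) \<sigma> t \<tau>"
inductive_cases IfZeroE: "exec (IfZero l c d) \<sigma> t \<tau>"

lemma wp_Skip [simp]: "wp Skip N F Q \<longleftrightarrow> Q 0 N F"
  unfolding wp_def by (auto intro: exec.Skip elim: SkipE)

lemma wp_NSet [simp]: "wp (NSet l e) N F Q \<longleftrightarrow> Q 0 (wr N N l (nval N e)) F"
  unfolding wp_def by (auto intro: exec.NSet elim: NSetE)

lemma wp_FZero [simp]: "wp (FZero l) N F Q \<longleftrightarrow> Q 0 N (wr N F l 0)"
  unfolding wp_def by (auto intro: exec.FZero elim: FZeroE)

lemma wp_FOne [simp]: "wp (FOne l) N F Q \<longleftrightarrow> Q 0 N (wr N F l 1)"
  unfolding wp_def by (auto intro: exec.FOne elim: FOneE)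

lemma wp_FCopy [simp]: "wp (FCopy l l1) N F Q \<longleftrightarrow> Q 0 N (wr N F l (rd N F l1))"
  unfolding wp_def by (auto intro: exec.FCopy elim: FCopyE)

lemma wpI: "exec c (N, F) t (N', F') \<Longrightarrow> Q t N' F' \<Longrightarrow> wp c N F Q"
  unfolding wp_def by blast

lemma wpE: "wp c N F Q \<Longrightarrow> (\<And>t N' F'. exec c (N, F) t (N', F') \<Longrightarrow> Q t N' F' \<Longrightarrow> P) \<Longrightarrow> P"
  unfolding wp_def by blast

lemma wp_FOp [simp]:
  "wp (FOp f l l1 l2) N F Q \<longleftrightarrow>
     (f = FDiv \<longrightarrow> rd N F l2 \<noteq> 0) \<and> Q 1 N (wr N F l (aop_val f (rd N F l1) (rd N F l2)))"
proof
  assume "wp (FOp f l l1 l2) N F Q"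
  then show "(f = FDiv \<longrightarrow> rd N F l2 \<noteq> 0) \<and> Q 1 N (wr N F l (aop_val f (rd N F l1) (rd N F l2)))"
    by (elim wpE FOpE) simp
next
  assume "(f = FDiv \<longrightarrow> rd N F l2 \<noteq> 0) \<and> Q 1 N (wr N F l (aop_val f (rd N F l1) (rd N F l2)))"
  then show "wp (FOp f l l1 l2) N F Q" by (intro wpI[OF exec.FOp]) auto
qed

lemma wp_Seq [simp]:
  "wp (c ;; d) N F Q \<longleftrightarrow> wp c N F (\<lambda>t N' F'. wp d N' F' (\<lambda>u N'' F''. Q (t + u) N'' F''))"
proof
  assume "wp (c ;; d) N F Q"
  then show "wp c N F (\<lambda>t N' F'. wp d N' F' (\<lambda>u N'' F''. Q (t + u) N'' F''))"
  proof (elim wpE SeqE)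
    fix t N' F' t1 \<sigma>' u
    assume "Q t N' F'" "t = t1 + u" "exec c (N, F) t1 \<sigma>'" "exec d \<sigma>' u (N', F')"
    then show ?thesis by (cases \<sigma>') (auto intro!: wpI[of c N F t1] wpI[of d _ _ u])
  qed
next
  assume "wp c N F (\<lambda>t N' F'. wp d N' F' (\<lambda>u N'' F''. Q (t + u) N'' F''))"
  then show "wp (c ;; d) N F Q" by (elim wpE) (rule wpI[OF exec.Seq])
qed

lemma wp_Cond [simp]: "wp (Cond e c d) N F Q \<longleftrightarrow> (if nval N e \<noteq> 0 then wp c N F Q else wp d N F Q)"
proof
  assume "wp (Cond e c d) N F Q"
  then show "if nval N e \<noteq> 0 then wp c N F Q else wp d N F Q"
    by (elim wpE CondE) (auto intro: wpI)
next
  assume "if nval N e \<noteq> 0 then wp c N F Q else wp d N F Q"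
  then show "wp (Cond e c d) N F Q"
    by (auto elim!: wpE intro: wpI[OF exec.CondTrue] wpI[OF exec.CondFalse] split: if_splits)
qed

lemma wp_IfZero [simp]:
  "wp (IfZero l c d) N F Q \<longleftrightarrow>
     (if rd N F l = 0 then wp c N F (\<lambda>t. Q (Suc t)) else wp d N F (\<lambda>t. Q (Suc t)))"
proof
  assume "wp (IfZero l c d) N F Q"
  then show "if rd N F l = 0 then wp c N F (\<lambda>t. Q (Suc t)) else wp d N F (\<lambda>t. Q (Suc t))"
    by (elim wpE IfZeroE) (auto intro: wpI)
next
  assume "if rd N F l = 0 then wp c N F (\<lambda>t. Q (Suc t)) else wp d N F (\<lambda>t. Q (Suc t))"
  then show "wp (IfZero l c d) N F Q"
    by (auto elim!: wpE intro: wpI[OF exec.IfZeroTrue] wpI[OF exec.IfZeroFalse] split: if_splits)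
qed

declare rd_def [simp] wr_def [simp]

definition For :: "nat \<Rightarrow> nexp \<Rightarrow> com \<Rightarrow> com" where
  "For x e c = NSet (x, []) (Num 0) ;;
     While (Less (Rd x []) e) (c ;; NSet (x, []) (Plus (Rd x []) (Num 1)))"

lemma wp_While:
  assumes step: "\<And>i N F. i < D \<Longrightarrow> N x [] = i \<Longrightarrow> I i N F \<Longrightarrow>
      wp c N F (\<lambda>t N' F'. t \<le> b \<and> N' x [] = i \<and> I (Suc i) (N'(x := (N' x)([] := Suc i))) F')"
    and bound: "\<And>i N F. I i N F \<Longrightarrow> nval N e = D"
  shows "i + m = D \<Longrightarrow> N x [] = i \<Longrightarrow> I i N F \<Longrightarrow>
      wp (While (Less (Rd x []) e) (c ;; NSet (x, []) (Plus (Rd x []) (Num 1)))) N F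
        (\<lambda>t N' F'. t \<le> m * b \<and> N' x [] = D \<and> I D N' F')"
proof (induction m arbitrary: i N F)
  case 0
  have "exec (While (Less (Rd x []) e) (c ;; NSet (x, []) (Plus (Rd x []) (Num 1)))) (N, F) 0 (N, F)"
    using 0 bound by (intro exec.WhileFalse) simp
  then show ?case unfolding wp_def using 0 by auto
next
  case (Suc m)
  let ?b = "c ;; NSet (x, []) (Plus (Rd x []) (Num 1))"
  have "wp ?b N F (\<lambda>t N' F'. t \<le> b \<and> N' x [] = Suc i \<and> I (Suc i) N' F')"
    using step[of i N F] Suc.prems by (auto elim!: wp_mono)
  then obtain t N' F' where 1: "exec ?b (N, F) t (N', F')" "t \<le> b" "N' x [] = Suc i" "I (Suc i) N' F'"
    unfolding wp_def by blast
  obtain u N'' F'' where 2: "exec (While (Less (Rd x []) e) ?b) (N', F') u (N'', F'')"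
    "u \<le> m * b" "N'' x [] = D" "I D N'' F''"
    using Suc.IH[of "Suc i" N' F'] Suc.prems 1 unfolding wp_def by auto
  have "exec (While (Less (Rd x []) e) ?b) (N, F) (t + u) (N'', F'')"
    using 1 2 Suc.prems bound[OF Suc.prems(3)] by (intro exec.WhileTrue) auto
  then show ?case unfolding wp_def using 1 2 by (intro exI[of _ "t + u"] exI conjI) auto
qed

text \<open>The invariant \<open>I i\<close> is stated for the memory in which the counter already equals \<open>i\<close>. A cost bound per
  round is enough, as every bound here is a product.\<close>
lemma wp_For:
  assumes init: "I 0 (N(x := (N x)([] := 0))) F"
    and step: "\<And>i N F. i < D \<Longrightarrow> N x [] = i \<Longrightarrow> I i N F \<Longrightarrow>
      wp c N F (\<lambda>t N' F'. t \<le> b \<and> N' x [] = i \<and> I (Suc i) (N'(x := (N' x)([] := Suc i))) F')"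
    and bound: "\<And>i N F. I i N F \<Longrightarrow> nval N e = D"
    and post: "\<And>t N' F'. t \<le> D * b \<Longrightarrow> N' x [] = D \<Longrightarrow> I D N' F' \<Longrightarrow> Q t N' F'"
  shows "wp (For x e c) N F Q"
proof -
  have "wp (While (Less (Rd x []) e) (c ;; NSet (x, []) (Plus (Rd x []) (Num 1)))) (N(x := (N x)([] := 0))) F Q"
    by (rule wp_mono[OF wp_While[of D x I c b e 0 D, OF step bound]]) (use init post in auto)
  then show ?thesis by (simp add: For_def)
qed

text \<open>Frame conditions are stated for whole arrays; every scalar variable is an array of its own, used at the
  empty index list.\<close>
definition same :: "nat set \<Rightarrow> 'v mem \<Rightarrow> 'v mem \<Rightarrow> bool" where
  "same A M M' \<longleftrightarrow> (\<forall>a. a \<notin> A \<longrightarrow> M' a = M a)"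

lemma sameD: "same A M M' \<Longrightarrow> a \<notin> A \<Longrightarrow> M' a = M a"
  by (simp add: same_def)

lemma same_refl [simp]: "same A M M"
  by (simp add: same_def)

lemma same_upd [simp]: "a \<in> A \<Longrightarrow> same A M (M'(a := f)) \<longleftrightarrow> same A M M'"
  by (auto simp: same_def)

section \<open>The elimination program\<close>

text \<open>
  The storage used below, with index lists in brackets. Arrays of natural numbers: 6, \<open>[k, i, l]\<close>, exponents of
  the monomial that is attached to row \<open>i\<close> in degree \<open>k\<close>; 7, \<open>[k, i]\<close>, whether this row is used; 8, the
  last finished degree; 9, the degree under construction; 10 and 11, the variable and the row that
  form the current product; 12, 13 and 18, the numbers \<open>h\<close>, \<open>(n + 1) h\<close> and \<open>n + 1\<close>; 14 and 15, \<open>[k, i]\<close>,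
  the variable and the row from which the monomial of row \<open>i\<close> arose; 16, the pivot row plus 1, or 0
  if there is none; 17, the verdict of the test; 20, the used rows of the second elimination; 21 to 27, local
  counters. Arrays of field elements: 2, \<open>[k, i, c]\<close>, values of the monomials at the points; 3 to 6 and 7 to
  10, vector, matrix, image and auxiliary cell of the two eliminations.

  The elimination program takes as parameters the array \<open>dv\<close> that holds the dimension, the array \<open>u\<close> of used
  rows and the first of its four field arrays, \<open>b\<close>.
\<close>
definition matvec :: "nat \<Rightarrow> nat \<Rightarrow> com" where
  "matvec dv b = For 21 (Rd dv []) (FZero (b + 2, [Rd 21 []]) ;;
     For 22 (Rd dv []) (FOp FMul (b + 3, []) (b + 1, [Rd 21 [], Rd 22 []]) (b, [Rd 22 []]) ;;
       FOp FAdd (b + 2, [Rd 21 []]) (b + 2, [Rd 21 []]) (b + 3, [])))"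

lemma matvec_wp:
  fixes F :: "'k::field mem"
  assumes dv: "dv \<notin> {21, 22}" "N dv [] = D"
  shows "wp (matvec dv b) N F (\<lambda>t N' F'. t \<le> D * (D * 2) \<and> same {21, 22} N N' \<and> same {b + 2, b + 3} F F' \<and>
           (\<forall>i<D. F' (b + 2) [i] = mat_vec D (\<lambda>i c. F (b + 1) [i, c]) (\<lambda>c. F b [c]) i))"
  unfolding matvec_def
proof (rule wp_For[where D = D and b = "D * 2" and
    I = "\<lambda>m N' F'. same {21, 22} N N' \<and> same {b + 2, b + 3} F F' \<and>
           (\<forall>i<m. F' (b + 2) [i] = mat_vec D (\<lambda>i c. F (b + 1) [i, c]) (\<lambda>c. F b [c]) i)"], goal_cases)
  case 1
  then show ?case by simp
next
  case (2 i N1 F1)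
  note I = 2(3) note [simp] = sameD[OF conjunct1[OF I]] sameD[OF conjunct1[OF conjunct2[OF I]]] dv 2(2)
  show ?case
    apply simp
    apply (rule wp_For[where D = D and b = 2 and
        I = "\<lambda>m N' F'. same {22} N1 N' \<and> same {b + 2, b + 3} F F' \<and>
           F' (b + 2) = (F1 (b + 2))([i] := (\<Sum>c<m. F (b + 1) [i, c] * F b [c]))"])
    subgoal using I by simp
    subgoal for m N2 F2
      apply (elim conjE)
      subgoal premises p
        supply [simp] = p(2) sameD[OF p(3)] sameD[OF p(4)]
        using p by simp
      done
    subgoal for m N2 F2 using sameD[of "{22}" N1 N2 dv] dv by simp
    subgoal for t N2 F2 using I sameD[of "{22}" N1 N2 21] by (auto simp: less_Suc_eq mat_vec_def same_def)
    done
next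
  case (3 i N F)
  then show ?case using dv by (simp add: same_def)
next
  case (4 t N' F')
  then show ?case by simp
qed

definition search :: "nat \<Rightarrow> nat \<Rightarrow> nat \<Rightarrow> com" where
  "search dv u b = NSet (16, []) (Num 0) ;;
     For 21 (Rd dv []) (Cond (Rd u [Rd 9 [], Rd 21 []]) Skip
       (IfZero (b + 2, [Rd 21 []]) Skip (NSet (16, []) (Plus (Rd 21 []) (Num 1)))))"

lemma search_wp:
  fixes F :: "'k::field mem"
  assumes dv: "dv \<notin> {16, 21}" "N dv [] = D" and u: "u \<notin> {16, 21}"
  shows "wp (search dv u b) N F (\<lambda>t N' F'. t \<le> D \<and> same {16, 21} N N' \<and> F' = F \<and>
           (N' 16 [] = 0 \<and> (\<forall>i<D. N u [N 9 [], i] = 0 \<longrightarrow> F (b + 2) [i] = 0) \<or>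
            (\<exists>p<D. N' 16 [] = Suc p \<and> N u [N 9 [], p] = 0 \<and> F (b + 2) [p] \<noteq> 0)))"
  unfolding search_def
  apply (simp del: One_nat_def)
  apply (rule wp_For[where D = D and b = 1 and
    I = "\<lambda>m N' F'. same {16, 21} N N' \<and> F' = F \<and>
           (N' 16 [] = 0 \<and> (\<forall>i<m. N u [N 9 [], i] = 0 \<longrightarrow> F (b + 2) [i] = 0) \<or>
            (\<exists>p<D. N' 16 [] = Suc p \<and> N u [N 9 [], p] = 0 \<and> F (b + 2) [p] \<noteq> 0))"])
  subgoal by simp
  subgoal premises p for i N1 F1
  proof -
    note [simp] = sameD[OF conjunct1[OF p(3)]] p(2) conjunct1[OF conjunct2[OF p(3)]]
    show ?thesis using p u by (auto simp: less_Suc_eq)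
  qed
  subgoal using dv by (simp add: same_def)
  subgoal by simp
  done

definition scale_row :: "nat \<Rightarrow> nat \<Rightarrow> com" where
  "scale_row dv b = For 22 (Rd dv [])
     (FOp FDiv (b + 1, [Minus (Rd 16 []) (Num 1), Rd 22 []])
       (b + 1, [Minus (Rd 16 []) (Num 1), Rd 22 []]) (b + 2, [Minus (Rd 16 []) (Num 1)]))"

lemma scale_row_wp:
  fixes F :: "'k::field mem"
  assumes dv: "dv \<noteq> 22" "N dv [] = D" and p: "N 16 [] = Suc p" "F (b + 2) [p] \<noteq> 0"
  shows "wp (scale_row dv b) N F (\<lambda>t N' F'. t \<le> D \<and> same {22} N N' \<and> same {b + 1} F F' \<and>
           (\<forall>i c. F' (b + 1) [i, c] = (if i = p \<and> c < D then F (b + 1) [i, c] / F (b + 2) [p] else F (b + 1) [i, c])))"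
  unfolding scale_row_def
  apply (rule wp_For[where D = D and b = 1 and
    I = "\<lambda>m N' F'. same {22} N N' \<and> same {b + 1} F F' \<and>
           (\<forall>i c. F' (b + 1) [i, c] = (if i = p \<and> c < m then F (b + 1) [i, c] / F (b + 2) [p] else F (b + 1) [i, c]))"])
  subgoal by simp
  subgoal premises q for i N1 F1
  proof -
    note [simp] = sameD[OF conjunct1[OF q(3)]] q(2) sameD[OF conjunct1[OF conjunct2[OF q(3)]]] p(1)
    show ?thesis using q p(2) by (auto simp: less_Suc_eq)
  qed
  subgoal using dv by (simp add: same_def)
  subgoal by simp
  done

definition Neq :: "nexp \<Rightarrow> nexp \<Rightarrow> nexp" where
  "Neq a b = Plus (Less a b) (Less b a)"

lemma nval_Neq [simp]: "nval N (Neq a b) = (if nval N a = nval N b then 0 else 1)"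
  by (simp add: Neq_def)

definition clear_rows :: "nat \<Rightarrow> nat \<Rightarrow> com" where
  "clear_rows dv b = For 21 (Rd dv []) (Cond (Neq (Rd 21 []) (Minus (Rd 16 []) (Num 1)))
     (For 22 (Rd dv [])
       (FOp FMul (b + 3, []) (b + 2, [Rd 21 []]) (b + 1, [Minus (Rd 16 []) (Num 1), Rd 22 []]) ;;
        FOp FSub (b + 1, [Rd 21 [], Rd 22 []]) (b + 1, [Rd 21 [], Rd 22 []]) (b + 3, []))) Skip)"

lemma clear_rows_wp:
  fixes F :: "'k::field mem"
  assumes dv: "dv \<notin> {21, 22}" "N dv [] = D" and p: "N 16 [] = Suc p" "p < D"
  shows "wp (clear_rows dv b) N F (\<lambda>t N' F'. t \<le> D * (D * 2) \<and> same {21, 22} N N' \<and> same {b + 1, b + 3} F F' \<and>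
           (\<forall>i<D. \<forall>c<D. F' (b + 1) [i, c] = (if i = p then F (b + 1) [i, c]
              else F (b + 1) [i, c] - F (b + 2) [i] * F (b + 1) [p, c])))"
  unfolding clear_rows_def
  apply (rule wp_For[where D = D and b = "D * 2" and
    I = "\<lambda>m N' F'. same {21, 22} N N' \<and> same {b + 1, b + 3} F F' \<and>
           (\<forall>i<D. \<forall>c<D. F' (b + 1) [i, c] = (if i = p \<or> i \<ge> m then F (b + 1) [i, c]
              else F (b + 1) [i, c] - F (b + 2) [i] * F (b + 1) [p, c]))"])
  subgoal by simp
  subgoal premises q for i N1 F1
  proof (cases "i = p")
    case True
    note [simp] = sameD[OF conjunct1[OF q(3)]] q(2) sameD[OF conjunct1[OF conjunct2[OF q(3)]]] p
    show ?thesis using q True by auto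
  next
    case False
    note [simp] = sameD[OF conjunct1[OF q(3)]] q(2) sameD[OF conjunct1[OF conjunct2[OF q(3)]]] p
    have pivot_index: "\<forall>c<D. F1 (b + 1) [i, c] = F (b + 1) [i, c]" "\<forall>c<D. F1 (b + 1) [p, c] = F (b + 1) [p, c]"
      using q by auto
    show ?thesis
      apply (simp add: False)
      apply (rule wp_For[where D = D and b = 2 and
        I = "\<lambda>m N' F'. same {22} N1 N' \<and> same {b + 1, b + 3} F1 F' \<and>
           (\<forall>i' c. F' (b + 1) [i', c] = (if i' = i \<and> c < m then
              F (b + 1) [i', c] - F (b + 2) [i] * F (b + 1) [p, c] else F1 (b + 1) [i', c]))"])
      subgoal by simp
      subgoal premises r for m N2 F2
      proof -
        note [simp] = sameD[OF conjunct1[OF r(3)]] r(2) sameD[OF conjunct1[OF conjunct2[OF r(3)]]]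
        have v: "F2 (b + 1) [p, m] = F (b + 1) [p, m]" "F2 (b + 1) [i, m] = F (b + 1) [i, m]"
          using r(1,3) pivot_index False by auto
        show ?thesis using r(1,3) v by (auto simp: less_Suc_eq)
      qed
      subgoal for m N2 F2 using sameD[of "{22}" N1 N2 dv] dv by simp
      subgoal premises r for t N2 F2
      proof -
        note [simp] = sameD[OF conjunct1[OF r(3)]]
        have "same {21, 22} N N2" using q(3) r(3) by (auto simp: same_def)
        moreover have "same {b + 1, b + 3} F F2" using q(3) r(3) by (auto simp: same_def)
        ultimately show ?thesis using r q False by auto
      qed
      done
  qed
  subgoal using dv by (simp add: same_def)
  subgoal by auto
  done

definition insertion :: "nat \<Rightarrow> nat \<Rightarrow> nat \<Rightarrow> com" where
  "insertion dv u b = matvec dv b ;; search dv u b ;;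
     Cond (Rd 16 []) (scale_row dv b ;; clear_rows dv b ;;
       NSet (u, [Rd 9 [], Minus (Rd 16 []) (Num 1)]) (Num 1)) Skip"

lemma insertion_wp:
  fixes F :: "'k::field mem" and b :: nat
  assumes dv: "dv \<notin> {16, 21, 22, u}" "N dv [] = D" and u: "u \<notin> {9, 16, 21, 22}"
  defines "L \<equiv> \<lambda>i c. F (b + 1) [i, c]" and "w \<equiv> mat_vec D (\<lambda>i c. F (b + 1) [i, c]) (\<lambda>c. F b [c])"
  shows "wp (insertion dv u b) N F (\<lambda>t N' F'. t \<le> D * (D * 4) + 2 * D \<and>
           same {16, 21, 22, u} N N' \<and> same {b + 1, b + 2, b + 3} F F' \<and> (\<forall>i<D. F' (b + 2) [i] = w i) \<and>
           (N' 16 [] = 0 \<and> N' u = N u \<and> F' (b + 1) = F (b + 1) \<and> (\<forall>i<D. N u [N 9 [], i] = 0 \<longrightarrow> w i = 0) \<or>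
            (\<exists>p<D. N' 16 [] = Suc p \<and> N u [N 9 [], p] = 0 \<and> w p \<noteq> 0 \<and> N' u = (N u)([N 9 [], p] := 1) \<and>
              (\<forall>i<D. \<forall>c<D. F' (b + 1) [i, c] = pivot L p w i c))))"
  unfolding insertion_def
  apply (simp only: wp_Seq)
  apply (rule wp_mono[OF matvec_wp[where D = D]])
  subgoal using dv by simp
  subgoal using dv by simp
  subgoal premises p1 for t1 N1 F1
  proof -
    note s1 = sameD[OF conjunct1[OF conjunct2[OF p1]]]
    note s1F = sameD[OF conjunct1[OF conjunct2[OF conjunct2[OF p1]]]]
    have w1: "F1 (b + 2) [i] = w i" if "i < D" for i using p1 that by (simp add: w_def)
    show ?thesis
      apply (rule wp_mono[OF search_wp[where D = D]])
      subgoal using dv by simp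
      subgoal using dv s1 by simp
      subgoal using u by simp
      subgoal premises p2 for t2 N2 F2
      proof -
        note s2 = sameD[OF conjunct1[OF conjunct2[OF p2]]]
        have e: "F2 = F1" using p2 by simp
        have sN: "same {16, 21, 22} N N2" using p1 p2 by (auto simp: same_def)
        have u1: "N1 u = N u" "N1 9 = N 9" "N2 9 = N 9" "N2 u = N u" using u s1 s2 by auto
        show ?thesis
        proof (cases "N2 16 []")
          case 0
          then show ?thesis using p1 p2 sN w1 u1 by (auto simp: same_def)
        next
          case (Suc p)
          then have p: "p < D" "N u [N 9 [], p] = 0" "w p \<noteq> 0" using p2 u1 w1 by auto
          show ?thesis
            apply (simp add: Suc del: One_nat_def)
            apply (rule wp_mono[OF scale_row_wp[where D = D and p = p]])
            subgoal using dv by simp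
            subgoal using dv sameD[OF sN] by simp
            subgoal by (rule Suc)
            subgoal using p w1 e by simp
            subgoal premises p3 for t3 N3 F3
            proof -
              note s3 = sameD[OF conjunct1[OF conjunct2[OF p3]]]
              show ?thesis
                apply (rule wp_mono[OF clear_rows_wp[where D = D and p = p]])
                subgoal using dv by simp
                subgoal using dv sameD[OF sN] s3 by simp
                subgoal using Suc s3 by simp
                subgoal by (rule p)
                subgoal premises p4 for t4 N4 F4
                proof -
                  note s4 = sameD[OF conjunct1[OF conjunct2[OF p4]]]
                  have sN4: "same {16, 21, 22} N N4" using sN p3 p4 by (auto simp: same_def)
                  have sF4: "same {b + 1, b + 2, b + 3} F F4" using p1 e p3 p4 by (auto simp: same_def)
                  have u4: "N4 u = N u" "N4 9 = N 9" "N4 16 [] = Suc p" using sameD[OF sN4] u Suc s3 s4 by auto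
                  have w4: "F4 (b + 2) = F1 (b + 2)" "F3 (b + 2) = F1 (b + 2)" using p3 p4 e by (auto simp: same_def)
                  have L: "F4 (b + 1) [i, c] = pivot L p w i c" if "i < D" "c < D" for i c
                    using that p3 p4 w1 w4 p(1) e s1F[of "b + 1"] by (auto simp: pivot_def L_def)
                  have "t1 + (t2 + (t3 + t4)) \<le> D * (D * 4) + 2 * D" using p1 p2 p3 p4 by simp
                  then show ?thesis using sN4 sF4 u4 w4 w1 L p by (auto simp: same_def)
                qed
                done
            qed
            done
        qed
      qed
      done
  qed
  done

lemma insertion_dual_inv_wp:
  fixes F :: "'k::field mem" and b :: nat
  assumes dv: "dv \<notin> {16, 21, 22, u}" "N dv [] = D" and u: "u \<notin> {9, 16, 21, 22}"
    and inv: "dual_inv D (\<lambda>i c. F (b + 1) [i, c]) (\<lambda>i. N u [N 9 [], i] \<noteq> 0) B"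
  defines "v \<equiv> \<lambda>c. F b [c]" and "w \<equiv> mat_vec D (\<lambda>i c. F (b + 1) [i, c]) (\<lambda>c. F b [c])"
  shows "wp (insertion dv u b) N F (\<lambda>t N' F'. t \<le> D * (D * 4) + 2 * D \<and>
           same {16, 21, 22, u} N N' \<and> same {b + 1, b + 2, b + 3} F F' \<and> (\<forall>i<D. F' (b + 2) [i] = w i) \<and>
           (N' 16 [] = 0 \<and> N' u = N u \<and> F' (b + 1) = F (b + 1) \<and>
              dual_inv D (\<lambda>i c. F' (b + 1) [i, c]) (\<lambda>i. N' u [N 9 [], i] \<noteq> 0) B \<and>
              v \<in> used_span D (\<lambda>i. N u [N 9 [], i] \<noteq> 0) B \<and>
              (\<forall>i<D. N u [N 9 [], i] = 0 \<longrightarrow> w i = 0) \<or>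
            (\<exists>p<D. N' 16 [] = Suc p \<and> N u [N 9 [], p] = 0 \<and> N' u = (N u)([N 9 [], p] := 1) \<and>
              dual_inv D (\<lambda>i c. F' (b + 1) [i, c]) (\<lambda>i. N' u [N 9 [], i] \<noteq> 0) (B(p := v)) \<and>
              v \<notin> used_span D (\<lambda>i. N u [N 9 [], i] \<noteq> 0) B \<and>
              used_span D (\<lambda>i. N' u [N 9 [], i] \<noteq> 0) (B(p := v))
                = {y. \<exists>x\<in>used_span D (\<lambda>i. N u [N 9 [], i] \<noteq> 0) B. \<exists>a. \<forall>c<D. y c = x c + a * v c})))"
proof (rule wp_mono[OF insertion_wp[where D = D]], goal_cases)
  case (4 t N' F')
  let ?K = "N 9 []" and ?U = "\<lambda>i. N u [N 9 [], i] \<noteq> 0"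
  note iff = used_span_iff[OF inv, of v, folded w_def v_def]
  show ?case using 4(1)[folded w_def]
  proof (elim conjE disjE exE, goal_cases)
    case 1
    then show ?thesis using inv iff by (simp add: v_def w_def)
  next
    case (2 p)
    have U: "(\<lambda>i. N' u [?K, i] \<noteq> 0) = (\<lambda>i. ?U i \<or> i = p)" using 2(9) by auto
    have "dual_inv D (\<lambda>i c. F' (b + 1) [i, c]) (\<lambda>i. ?U i \<or> i = p) (B(p := v)) \<longleftrightarrow>
        dual_inv D (pivot (\<lambda>i c. F (b + 1) [i, c]) p w) (\<lambda>i. ?U i \<or> i = p) (B(p := v))"
      using 2(10) by (intro dual_inv_cong) auto
    moreover have "dual_inv D (pivot (\<lambda>i c. F (b + 1) [i, c]) p w) (\<lambda>i. ?U i \<or> i = p) (B(p := v))"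
      using 2 unfolding w_def v_def by (intro dual_inv_pivot[OF inv]) auto
    moreover have "v \<notin> used_span D ?U B" using iff 2(5,7,8) by (auto simp: w_def v_def)
    moreover have "used_span D (\<lambda>i. ?U i \<or> i = p) (B(p := v)) = {y. \<exists>x\<in>used_span D ?U B. \<exists>a. \<forall>c<D. y c = x c + a * v c}"
      using 2 by (intro used_span_pivot) auto
    ultimately show ?thesis using 2 unfolding U by blast
  qed
qed (use dv u in auto)

definition init_rows :: "nat \<Rightarrow> nat \<Rightarrow> nat \<Rightarrow> com" where
  "init_rows dv u b = For 21 (Rd dv []) (NSet (u, [Rd 9 [], Rd 21 []]) (Num 0) ;;
     For 22 (Rd dv []) (FZero (b + 1, [Rd 21 [], Rd 22 []])) ;; FOne (b + 1, [Rd 21 [], Rd 21 []]))"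

lemma init_rows_wp:
  fixes F :: "'k::field mem"
  assumes dv: "dv \<notin> {21, 22, u}" "N dv [] = D" and u: "u \<notin> {9, 21, 22}"
  shows "wp (init_rows dv u b) N F (\<lambda>t N' F'. t = 0 \<and> same {21, 22, u} N N' \<and> same {b + 1} F F' \<and>
    (\<forall>i<D. N' u [N 9 [], i] = 0) \<and> (\<forall>k i. k \<noteq> N 9 [] \<longrightarrow> N' u [k, i] = N u [k, i]) \<and>
    (\<forall>i<D. \<forall>c<D. F' (b + 1) [i, c] = (if i = c then 1 else 0)))"
  unfolding init_rows_def
  apply (rule wp_For[where D = D and b = 0 and I = "\<lambda>m N' F'. same {21, 22, u} N N' \<and> same {b + 1} F F' \<and>
    (\<forall>i<m. N' u [N 9 [], i] = 0) \<and> (\<forall>k i. k \<noteq> N 9 [] \<longrightarrow> N' u [k, i] = N u [k, i]) \<and>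
    (\<forall>i<m. \<forall>c<D. F' (b + 1) [i, c] = (if i = c then 1 else 0))"])
  subgoal using u by auto
  subgoal premises q for i N1 F1
  proof -
    note [simp] = sameD[OF conjunct1[OF q(3)]] q(2) sameD[OF conjunct1[OF conjunct2[OF q(3)]]]
    show ?thesis
      apply simp
      apply (rule wp_For[where D = D and b = 0 and
        I = "\<lambda>m N' F'. same {22} (N1(u := (N1 u)([N1 9 [], N1 21 []] := 0))) N' \<and> same {b + 1} F F' \<and>
           (\<forall>i'<i. \<forall>c<D. F' (b + 1) [i', c] = (if i' = c then 1 else 0)) \<and>
           (\<forall>c<m. F' (b + 1) [i, c] = 0)"])
      subgoal using q(3) u by simp
      subgoal premises r for m N2 F2
      proof -
        have "N2 21 [] = i" "N2 22 [] = m" using r u sameD[OF conjunct1[OF r(3)], of 21] by auto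
        then show ?thesis using r by (auto simp: less_Suc_eq)
      qed
      subgoal for m N2 F2 using dv sameD[of "{22}" "N1(u := (N1 u)([N1 9 [], N1 21 []] := 0))" N2 dv] by simp
      subgoal premises r for t N2 F2
      proof -
        have "N2 21 [] = i" "N2 u = (N1 u)([N 9 [], i] := 0)"
          using r u sameD[OF conjunct1[OF r(3)], of 21] sameD[OF conjunct1[OF r(3)], of u] by auto
        moreover have "same {21, 22, u} N N2" using q(3) r(3) by (auto simp: same_def)
        ultimately show ?thesis using r q u by (auto simp: less_Suc_eq)
      qed
      done
  qed
  subgoal using dv by (simp add: same_def)
  subgoal by simp
  done

section \<open>Processing one product\<close>

definition product_exponent :: "nexp \<Rightarrow> nexp" where
  "product_exponent l = Plus (Rd 6 [Rd 8 [], Rd 11 [], l]) (Minus (Num 1) (Neq l (Rd 10 [])))"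

lemma nval_product_exponent [simp]:
  "nval N (product_exponent l) = N 6 [N 8 [], N 11 [], nval N l] + (if nval N l = N 10 [] then 1 else 0)"
  by (simp add: product_exponent_def)

definition pivot_index :: nexp where
  "pivot_index = Minus (Rd 16 []) (Num 1)"

lemma nval_pivot_index [simp]: "nval N pivot_index = N 16 [] - 1"
  by (simp add: pivot_index_def)

definition load_vec :: com where
  "load_vec = For 21 (Rd 12 []) (FOp FMul (3, [Rd 21 []]) (0, [Rd 21 [], Rd 10 []]) (2, [Rd 8 [], Rd 11 [], Rd 21 []]))"

lemma load_vec_wp:
  fixes F :: "'k::field mem"
  assumes "N 12 [] = h"
  shows "wp load_vec N F (\<lambda>t N' F'. t \<le> h \<and> same {21} N N' \<and> same {3} F F' \<and>
     (\<forall>c<h. F' 3 [c] = F 0 [c, N 10 []] * F 2 [N 8 [], N 11 [], c]))"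
  unfolding load_vec_def
  apply (rule wp_For[where D = h and b = 1 and I = "\<lambda>m N' F'. same {21} N N' \<and> same {3} F F' \<and>
     (\<forall>c<m. F' 3 [c] = F 0 [c, N 10 []] * F 2 [N 8 [], N 11 [], c])"])
  subgoal by simp
  subgoal premises q for i N1 F1
  proof -
    note [simp] = sameD[OF conjunct1[OF q(3)]] q(2) sameD[OF conjunct1[OF conjunct2[OF q(3)]]]
    show ?thesis using q by (auto simp: less_Suc_eq)
  qed
  subgoal using assms by (simp add: same_def)
  subgoal by simp
  done

definition add_row :: com where
  "add_row = For 21 (Rd 18 []) (NSet (6, [Rd 9 [], pivot_index, Rd 21 []]) (product_exponent (Rd 21 [])) ;;
       NSet (2, [Rd 9 [], Rd 1 [Rd 9 []], Rd 21 []]) (product_exponent (Rd 21 []))) ;;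
     For 21 (Rd 12 []) (FCopy (2, [Rd 9 [], pivot_index, Rd 21 []]) (3, [Rd 21 []])) ;;
     NSet (14, [Rd 9 [], pivot_index]) (Rd 10 []) ;; NSet (15, [Rd 9 [], pivot_index]) (Rd 11 []) ;;
     NSet (1, [Rd 9 []]) (Plus (Rd 1 [Rd 9 []]) (Num 1))"

lemma add_row_wp:
  fixes F :: "'k::field mem"
  assumes n: "N 18 [] = Suc n" and h: "N 12 [] = h" and K: "N 9 [] = K" "N 8 [] \<noteq> K" and p: "N 16 [] = Suc p"
    and cnt: "N 1 [K] = cnt"
  defines "e \<equiv> \<lambda>l. N 6 [N 8 [], N 11 [], l] + (if l = N 10 [] then 1 else 0)"
  shows "wp add_row N F (\<lambda>t N' F'. t = 0 \<and> same {1, 2, 6, 14, 15, 21} N N' \<and> same {2} F F' \<and>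
     N' 1 = (N 1)([K] := Suc cnt) \<and> N' 14 = (N 14)([K, p] := N 10 []) \<and> N' 15 = (N 15)([K, p] := N 11 []) \<and>
     (\<forall>k i l. l \<le> n \<longrightarrow> N' 6 [k, i, l] = (if k = K \<and> i = p then e l else N 6 [k, i, l])) \<and>
     (\<forall>k i l. l \<le> n \<longrightarrow> N' 2 [k, i, l] = (if k = K \<and> i = cnt then e l else N 2 [k, i, l])) \<and>
     (\<forall>k i c. c < h \<longrightarrow> F' 2 [k, i, c] = (if k = K \<and> i = p then F 3 [c] else F 2 [k, i, c])))"
  unfolding add_row_def
  apply (simp only: wp_Seq)
  apply (rule wp_For[where D = "Suc n" and b = 0 and I = "\<lambda>m N' F'. same {2, 6, 21} N N' \<and> F' = F \<and>
     (\<forall>k i l. N' 6 [k, i, l] = (if k = K \<and> i = p \<and> l < m then e l else N 6 [k, i, l])) \<and>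
     (\<forall>k i l. N' 2 [k, i, l] = (if k = K \<and> i = cnt \<and> l < m then e l else N 2 [k, i, l]))"])
  subgoal by simp
  subgoal premises q for i N1 F1
  proof -
    note [simp] = sameD[OF conjunct1[OF q(3)]] q(2) assms(1-5) cnt[simplified]
    show ?thesis using q by (auto simp: less_Suc_eq e_def)
  qed
  subgoal using n by (simp add: same_def)
  subgoal premises r for t N1 F1
    apply (rule wp_For[where D = h and b = 0 and I = "\<lambda>m N' F'. same {21} N1 N' \<and> same {2} F F' \<and>
     (\<forall>k i c. F' 2 [k, i, c] = (if k = K \<and> i = p \<and> c < m then F 3 [c] else F 2 [k, i, c]))"])
    subgoal using r by simp
    subgoal premises q for i N2 F2
    proof -
      note [simp] = sameD[OF conjunct1[OF q(3)]] q(2) assms(1-5) cnt[simplified] sameD[OF conjunct1[OF r(3)]]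
        sameD[OF conjunct1[OF conjunct2[OF q(3)]]]
      show ?thesis using q r by (auto simp: less_Suc_eq)
    qed
    subgoal for i N2 F2 using r h by (auto simp: same_def)
    subgoal premises q for u N2 F2
    proof -
      note [simp] = sameD[OF conjunct1[OF q(3)]] q(2) assms(1-5) cnt[simplified] sameD[OF conjunct1[OF r(3)]]
        sameD[OF conjunct1[OF conjunct2[OF q(3)]]]
      have "same {1, 2, 6, 14, 15, 21} N N2" using q(3) r(3) by (auto simp: same_def)
      then show ?thesis using q r by auto
    qed
    done
  done

lemma store_exps_wp:
  fixes F :: "'k::field mem"
  assumes n: "N 18 [] = Suc n" and q: "N 3 [] = q"
    and t: "\<And>N'. same {5, 22} N N' \<Longrightarrow> nval N' tt = t0"
    and e: "\<And>N'. same {5, 22} N N' \<Longrightarrow> nval N' ee = f (N' 22 [])"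
  shows "wp (For 22 (Rd 18 []) (NSet (5, [Rd 3 [], tt, Rd 22 []]) ee)) N F (\<lambda>t N' F'. t = 0 \<and> same {5, 22} N N' \<and> F' = F \<and>
     (\<forall>q' t l. l \<le> n \<longrightarrow> N' 5 [q', t, l] = (if q' = q \<and> t = t0 then f l else N 5 [q', t, l])))"
  apply (rule wp_For[where D = "Suc n" and b = 0 and I = "\<lambda>m N' F'. same {5, 22} N N' \<and> F' = F \<and>
     (\<forall>q' t l. N' 5 [q', t, l] = (if q' = q \<and> t = t0 \<and> l < m then f l else N 5 [q', t, l]))"])
  subgoal by simp
  subgoal premises r for i N1 F1
  proof -
    note [simp] = sameD[OF conjunct1[OF r(3)]] r(2) q
    show ?thesis using r t[of N1] e[of N1] by (auto simp: less_Suc_eq)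
  qed
  subgoal using n by (simp add: same_def)
  subgoal by simp
  done

text \<open>One term is written for every row of the elimination, used or not: the image of a dependent vector
  vanishes on the unused rows, so that their terms have coefficient 0.\<close>
definition emit :: com where
  "emit = For 21 (Rd 12 []) (FZero (6, []) ;; FOp FSub (1, [Rd 3 [], Rd 21 []]) (6, []) (5, [Rd 21 []]) ;;
       For 22 (Rd 18 []) (NSet (5, [Rd 3 [], Rd 21 [], Rd 22 []]) (Rd 6 [Rd 9 [], Rd 21 [], Rd 22 []]))) ;;
     FOne (1, [Rd 3 [], Rd 12 []]) ;;
     For 22 (Rd 18 []) (NSet (5, [Rd 3 [], Rd 12 [], Rd 22 []]) (product_exponent (Rd 22 []))) ;;
     NSet (4, [Rd 3 []]) (Plus (Rd 12 []) (Num 1)) ;; NSet (3, []) (Plus (Rd 3 []) (Num 1))"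

lemma emit_wp:
  fixes F :: "'k::field mem"
  assumes n: "N 18 [] = Suc n" and h: "N 12 [] = h" and q: "N 3 [] = q"
  defines "e \<equiv> \<lambda>l. N 6 [N 8 [], N 11 [], l] + (if l = N 10 [] then 1 else 0)"
  shows "wp emit N F (\<lambda>t N' F'. t \<le> h \<and> same {3, 4, 5, 21, 22} N N' \<and> same {1, 6} F F' \<and>
     N' 3 [] = Suc q \<and> N' 4 = (N 4)([q] := Suc h) \<and>
     (\<forall>q' t l. q' \<noteq> q \<longrightarrow> l \<le> n \<longrightarrow> N' 5 [q', t, l] = N 5 [q', t, l]) \<and>
     (\<forall>q' t. q' \<noteq> q \<longrightarrow> F' 1 [q', t] = F 1 [q', t]) \<and>
     (\<forall>t<h. F' 1 [q, t] = - F 5 [t] \<and> (\<forall>l\<le>n. N' 5 [q, t, l] = N 6 [N 9 [], t, l])) \<and>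
     F' 1 [q, h] = 1 \<and> (\<forall>l\<le>n. N' 5 [q, h, l] = e l))"
  unfolding emit_def
  apply (simp only: wp_Seq)
  apply (rule wp_For[where D = h and b = 1 and I = "\<lambda>m N' F'. same {5, 21, 22} N N' \<and> same {1, 6} F F' \<and>
     (\<forall>q' t l. q' \<noteq> q \<longrightarrow> l \<le> n \<longrightarrow> N' 5 [q', t, l] = N 5 [q', t, l]) \<and>
     (\<forall>q' t. q' \<noteq> q \<longrightarrow> F' 1 [q', t] = F 1 [q', t]) \<and>
     (\<forall>t<m. F' 1 [q, t] = - F 5 [t] \<and> (\<forall>l\<le>n. N' 5 [q, t, l] = N 6 [N 9 [], t, l]))"])
  subgoal by simp
  subgoal premises r for i N1 F1
  proof -
    note [simp] = sameD[OF conjunct1[OF r(3)]] r(2) sameD[OF conjunct1[OF conjunct2[OF r(3)]]] n h q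
    show ?thesis
      apply simp
      apply (rule wp_mono[OF store_exps_wp[where n = n and q = q and ?t0.0 = i and f = "\<lambda>l. N 6 [N 9 [], i, l]"]])
      subgoal by simp
      subgoal by simp
      subgoal for N2 using sameD[of "{5, 22}" N1 N2] by simp
      subgoal for N2 using sameD[of "{5, 22}" N1 N2] by simp
      subgoal premises p for t N2 F2
      proof -
        note [simp] = sameD[OF conjunct1[OF conjunct2[OF p]]]
        have "same {5, 21, 22} N N2" using p r(3) by (auto simp: same_def)
        then show ?thesis using p r(3) by (auto simp: less_Suc_eq)
      qed
      done
  qed
  subgoal using h by (simp add: same_def)
  subgoal premises r for t N1 F1
  proof -
    note [simp] = sameD[OF conjunct1[OF r(3)]] sameD[OF conjunct1[OF conjunct2[OF r(3)]]] n h q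
    show ?thesis
      apply simp
      apply (rule wp_mono[OF store_exps_wp[where n = n and q = q and ?t0.0 = h and f = e]])
      subgoal by simp
      subgoal by simp
      subgoal for N2 using sameD[of "{5, 22}" N1 N2] by simp
      subgoal for N2 using sameD[of "{5, 22}" N1 N2] by (auto simp: e_def)
      subgoal premises p for t' N2 F2
      proof -
        note [simp] = sameD[OF conjunct1[OF conjunct2[OF p]]]
        have "same {3, 4, 5, 21, 22} N N2" using p r(3) by (auto simp: same_def)
        then show ?thesis using p r by auto
      qed
      done
  qed
  done

section \<open>Invariants of the main program\<close>

lemma lookup_exponents: "Poly_Mapping.lookup (exponents n e) l = (if l \<le> n then e l else 0)"
  by (auto simp: exponents_def lookup_sum lookup_single when_def)

lemma exponents_cong: "(\<And>l. l \<le> n \<Longrightarrow> e l = e' l) \<Longrightarrow> exponents n e = exponents n e'"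
  by (rule poly_mapping_eqI) (simp add: lookup_exponents)

lemma exponents_var: "j \<le> n \<Longrightarrow> exponents n (\<lambda>l. e l + (if l = j then 1 else 0)) = var j + exponents n e"
  by (rule poly_mapping_eqI) (auto simp: lookup_exponents lookup_add lookup_var)

context points
begin

definition row_mono :: "nat mem \<Rightarrow> nat \<Rightarrow> nat \<Rightarrow> monomial" where
  "row_mono N k i = exponents n (\<lambda>l. N 6 [k, i, l])"

definition row_monos :: "nat mem \<Rightarrow> nat \<Rightarrow> monomial set" where
  "row_monos N k = {row_mono N k i | i. i < h \<and> N 7 [k, i] \<noteq> 0}"

definition listed_monos :: "nat mem \<Rightarrow> nat \<Rightarrow> monomial set" where
  "listed_monos N k = (\<lambda>i. exponents n (\<lambda>j. N 2 [k, i, j])) ` {..<N 1 [k]}"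

definition output_polys :: "nat mem \<Rightarrow> 'k mem \<Rightarrow> 'k mpoly set" where
  "output_polys N F = out_polys n (N, F)"

lemma out_family_listed_monos: "out_family n (N, F :: 'k mem) = listed_monos N"
  by (simp add: fun_eq_iff out_family_def listed_monos_def)

definition registers_ok :: "nat \<Rightarrow> nat mem \<Rightarrow> 'k mem \<Rightarrow> bool" where
  "registers_ok s N F \<longleftrightarrow> N 0 [2] = s \<and> N 12 [] = h \<and> N 13 [] = lift_dim \<and> N 18 [] = Suc n \<and>
     (\<forall>c<h. \<forall>j\<le>n. F 0 [c, j] = R c j)"

definition level :: "nat mem \<Rightarrow> 'k mem \<Rightarrow> nat \<Rightarrow> bool" where
  "level N F k \<longleftrightarrow> (\<forall>i<h. N 7 [k, i] \<noteq> 0 \<longrightarrow> (\<forall>c<h. F 2 [k, i, c] = mono_value (R c) (row_mono N k i))) \<and> listed_monos N k = row_monos N k"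

text \<open>Every monomial of the new degree remembers a product from which it arose; lifting needs it.\<close>
definition sources :: "nat mem \<Rightarrow> nat \<Rightarrow> bool" where
  "sources N k \<longleftrightarrow> (\<forall>i<h. N 7 [Suc k, i] \<noteq> 0 \<longrightarrow> N 14 [Suc k, i] \<le> n \<and> N 15 [Suc k, i] < h \<and>
     N 7 [k, N 15 [Suc k, i]] \<noteq> 0 \<and> row_mono N (Suc k) i = var (N 14 [Suc k, i]) + row_mono N k (N 15 [Suc k, i]))"

text \<open>Degree \<open>k + 1\<close> already satisfies \<open>level\<close> for the monomials found so far, and the first elimination is dual to
  their value vectors; the degrees up to \<open>k\<close> form a staircase.\<close>
definition building :: "nat \<Rightarrow> nat \<Rightarrow> nat mem \<Rightarrow> 'k mem \<Rightarrow> bool" where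
  "building s k N F \<longleftrightarrow> registers_ok s N F \<and> N 8 [] = k \<and> N 9 [] = Suc k \<and> (\<forall>k'\<le>Suc k. level N F k') \<and>
     staircase k (row_monos N) \<and> sources N k \<and>
     dual_inv h (\<lambda>i c. F 4 [i, c]) (\<lambda>i. N 7 [Suc k, i] \<noteq> 0) (\<lambda>i c. mono_value (R c) (row_mono N (Suc k) i))"

definition same_below :: "nat \<Rightarrow> nat mem \<Rightarrow> 'k mem \<Rightarrow> nat mem \<Rightarrow> 'k mem \<Rightarrow> bool" where
  "same_below k N F N' F' \<longleftrightarrow> (\<forall>k'\<le>k. (\<forall>i. N' 7 [k', i] = N 7 [k', i]) \<and> (\<forall>i l. l \<le> n \<longrightarrow> N' 6 [k', i, l] = N 6 [k', i, l]) \<and>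
     (\<forall>i c. c < h \<longrightarrow> F' 2 [k', i, c] = F 2 [k', i, c]) \<and> N' 1 [k'] = N 1 [k'] \<and>
     (\<forall>i l. l \<le> n \<longrightarrow> N' 2 [k', i, l] = N 2 [k', i, l]))"

lemma same_below_refl: "same_below k N F N F"
  by (simp add: same_below_def)

lemma same_below_trans: "same_below k N F N' F' \<Longrightarrow> same_below k N' F' N'' F'' \<Longrightarrow> same_below k N F N'' F''"
  by (simp add: same_below_def)

lemma same_below_same: "N' 7 = N 7 \<Longrightarrow> N' 6 = N 6 \<Longrightarrow> N' 1 = N 1 \<Longrightarrow> N' 2 = N 2 \<Longrightarrow> F' 2 = F 2 \<Longrightarrow> same_below k N F N' F'"
  by (simp add: same_below_def)

lemma same_below_row_mono: "same_below k N F N' F' \<Longrightarrow> k' \<le> k \<Longrightarrow> row_mono N' k' i = row_mono N k' i"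
  unfolding row_mono_def same_below_def by (intro exponents_cong) auto

lemma same_below_row_monos: "same_below k N F N' F' \<Longrightarrow> k' \<le> k \<Longrightarrow> row_monos N' k' = row_monos N k'"
  unfolding row_monos_def by (auto simp: same_below_row_mono) (auto simp: same_below_def)

lemma same_below_listed_monos: "same_below k N F N' F' \<Longrightarrow> k' \<le> k \<Longrightarrow> listed_monos N' k' = listed_monos N k'"
  unfolding listed_monos_def same_below_def by (auto intro!: image_cong exponents_cong)

lemma same_below_level: "same_below k N F N' F' \<Longrightarrow> k' \<le> k \<Longrightarrow> level N F k' \<Longrightarrow> level N' F' k'"
  unfolding level_def by (auto simp: same_below_row_mono same_below_row_monos same_below_listed_monos) (auto simp: same_below_def)

lemma staircase_cong:
  assumes "staircase k \<N>" "\<And>k'. k' \<le> k \<Longrightarrow> \<N>' k' = \<N> k'"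
  shows "staircase k \<N>'"
  using assms unfolding staircase_def by (simp add: Suc_le_eq less_imp_le)

lemma row_mono_cong: "N' 6 = N 6 \<Longrightarrow> row_mono N' = row_mono N"
  by (simp add: fun_eq_iff row_mono_def)

lemma row_monos_cong: "N' 6 = N 6 \<Longrightarrow> N' 7 = N 7 \<Longrightarrow> row_monos N' = row_monos N"
  using row_mono_cong[of N' N] by (simp add: fun_eq_iff[of "row_monos N'"] row_monos_def)

lemma listed_monos_cong: "N' 1 = N 1 \<Longrightarrow> N' 2 = N 2 \<Longrightarrow> listed_monos N' = listed_monos N"
  by (simp add: fun_eq_iff listed_monos_def)

lemma building_same:
  assumes "building s k N F" "same A N N'" "same B F F'"
    and "A \<inter> {0, 1, 2, 6, 7, 8, 9, 12, 13, 14, 15, 18} = {}" "B \<inter> {0, 2, 4} = {}"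
  shows "building s k N' F'"
proof -
  have e: "N' 0 = N 0" "N' 1 = N 1" "N' 2 = N 2" "N' 6 = N 6" "N' 7 = N 7" "N' 8 = N 8" "N' 9 = N 9"
    "N' 12 = N 12" "N' 13 = N 13" "N' 14 = N 14" "N' 15 = N 15" "N' 18 = N 18" "F' 0 = F 0" "F' 2 = F 2" "F' 4 = F 4"
    using assms(2-5) by (auto simp: same_def)
  show ?thesis
    using assms(1) unfolding building_def registers_ok_def level_def sources_def
      row_mono_cong[of N' N, OF e(4)] row_monos_cong[of N' N, OF e(4,5)] listed_monos_cong[of N' N, OF e(2,3)] e .
qed

lemma vanish_combination:
  assumes "\<And>c. c < h \<Longrightarrow> mono_value (R c) m = (\<Sum>i\<in>{i. i < h \<and> U i}. w i * mono_value (R c) (M i))"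
    and "\<And>i. i < h \<Longrightarrow> \<not> U i \<Longrightarrow> w i = 0"
  shows "vanish (mon m + (\<Sum>t<h. Poly_Mapping.single (M t) (- w t)))"
  unfolding vanish_def
proof (intro allI impI)
  fix c assume "c < h"
  have "(\<Sum>i\<in>{i. i < h \<and> U i}. w i * mono_value (R c) (M i)) = (\<Sum>i<h. w i * mono_value (R c) (M i))"
    using assms(2) by (intro sum.mono_neutral_left) auto
  then show "eval_poly (R c) (mon m + (\<Sum>t<h. Poly_Mapping.single (M t) (- w t))) = 0"
    using assms(1)[OF \<open>c < h\<close>] by (simp add: eval_add eval_sum sum_negf)
qed

lemma combination_kspan:
  assumes "\<And>i. i < h \<Longrightarrow> \<not> U i \<Longrightarrow> w i = 0"
  shows "(\<Sum>t<h. Poly_Mapping.single (M t) (- w t)) \<in> kspan (mon ` {M i | i. i < h \<and> U i})"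
proof (intro sc.subspace_sum[OF subspace_kspan])
  fix t assume t: "t \<in> {..<h}"
  show "Poly_Mapping.single (M t) (- w t) \<in> kspan (mon ` {M i | i. i < h \<and> U i})"
    using t assms[of t] by (cases "U t") (auto simp: kspan_mon)
qed

abbreviation "pair_nats \<equiv> {1, 2, 3, 4, 5, 6, 7, 14, 15, 16, 17, 20, 21, 22, 23, 24, 25, 26, 27} :: nat set"
abbreviation "pair_fields \<equiv> {1, 2, 3, 4, 5, 6, 7, 8, 9, 10} :: nat set"
abbreviation "select_nats \<equiv> {16, 17, 20, 21, 22, 23, 24, 25, 26, 27} :: nat set"
abbreviation "select_fields \<equiv> {6, 7, 8, 9, 10} :: nat set"

end

definition pair_step :: "com \<Rightarrow> com" where
  "pair_step filt = load_vec ;; insertion 12 7 3 ;;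
     Cond (Rd 16 []) add_row (filt ;; Cond (Rd 17 []) emit Skip)"

definition degree_step :: "com \<Rightarrow> com \<Rightarrow> com" where
  "degree_step prep filt = NSet (9, []) (Plus (Rd 8 []) (Num 1)) ;; NSet (1, [Rd 9 []]) (Num 0) ;;
     init_rows 12 7 3 ;; prep ;;
     For 10 (Rd 18 []) (For 11 (Rd 12 []) (Cond (Rd 7 [Rd 8 [], Rd 11 []]) (pair_step filt) Skip))"

definition main_prog :: "com \<Rightarrow> com \<Rightarrow> com" where
  "main_prog prep filt = NSet (12, []) (Rd 0 [Num 1]) ;; NSet (18, []) (Plus (Rd 0 [Num 0]) (Num 1)) ;;
     NSet (13, []) (Times (Rd 18 []) (Rd 12 [])) ;;
     NSet (1, [Num 0]) (Num 1) ;; NSet (7, [Num 0, Num 0]) (Num 1) ;;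
     For 21 (Rd 12 []) (FOne (2, [Num 0, Num 0, Rd 21 []])) ;;
     For 8 (Rd 0 [Num 2]) (degree_step prep filt)"

text \<open>
  The interface of the test. \<open>filt\<close> is called for a product of the previous monomials with dependent value
  vector and receives the corresponding polynomial \<open>b\<close> through its coefficients in field array 5. It must accept
  \<open>b\<close> only if \<open>b\<close> is not zero, and reject it only if \<open>b\<close> belongs to \<open>Z K G\<close>, where \<open>G\<close> is the set accepted before
  in this degree. \<open>Inv\<close> is its private invariant, resting on one array of each memory, and \<open>Post\<close> is what
  the caller may conclude from it at the end of the degree.
\<close>
locale selection = points n h R for n h :: nat and R :: "nat \<Rightarrow> nat \<Rightarrow> 'k::field" +
  fixes s :: nat and prep filt :: com
    and Z :: "nat \<Rightarrow> 'k mpoly set \<Rightarrow> 'k mpoly set"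
    and Inv :: "nat \<Rightarrow> 'k mpoly set \<Rightarrow> nat mem \<Rightarrow> 'k mem \<Rightarrow> bool"
    and Post :: "nat \<Rightarrow> 'k mpoly set \<Rightarrow> bool"
    and prep_cost filt_cost :: nat
  assumes Z0: "0 \<in> Z K G"
    and Zmono: "G \<subseteq> G' \<Longrightarrow> Z K G \<subseteq> Z K G'"
    and Inv_Post: "Inv K G N F \<Longrightarrow> Post K G"
    and Inv_frame: "N' 20 = N 20 \<Longrightarrow> F' 8 = F 8 \<Longrightarrow> Inv K G N F \<Longrightarrow> Inv K G N' F'"
    and prep: "building s k N F \<Longrightarrow>
      wp prep N F (\<lambda>t N' F'. t \<le> prep_cost \<and> same select_nats N N' \<and> same select_fields F F' \<and> Inv (Suc k) {} N' F')"
    and filt: "building s k N F \<Longrightarrow> Inv (Suc k) G N F \<Longrightarrow> N 10 [] \<le> n \<Longrightarrow> N 11 [] < h \<Longrightarrow> N 7 [k, N 11 []] \<noteq> 0 \<Longrightarrow>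
      (\<And>t. t < h \<Longrightarrow> N 7 [Suc k, t] = 0 \<Longrightarrow> F 5 [t] = 0) \<Longrightarrow>
      b = mon (var (N 10 []) + row_mono N k (N 11 [])) + (\<Sum>t<h. Poly_Mapping.single (row_mono N (Suc k) t) (- F 5 [t])) \<Longrightarrow>
      vanish b \<Longrightarrow>
      wp filt N F (\<lambda>t N' F'. t \<le> filt_cost \<and> same select_nats N N' \<and> same select_fields F F' \<and>
        (N' 17 [] \<noteq> 0 \<and> b \<noteq> 0 \<and> Inv (Suc k) (insert b G) N' F' \<or>
         N' 17 [] = 0 \<and> b \<in> Z (Suc k) G \<and> Inv (Suc k) G N' F'))"
begin

definition "pair_cost = h + (h * (h * 4) + 2 * h) + filt_cost + h"

definition pair_post :: "nat \<Rightarrow> 'k mpoly set \<Rightarrow> nat mem \<Rightarrow> 'k mem \<Rightarrow> monomial \<Rightarrow> nat mem \<Rightarrow> 'k mem \<Rightarrow> bool" where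
  "pair_post k G N F m N' F' \<longleftrightarrow> building s k N' F' \<and> same_below k N F N' F' \<and> row_monos N (Suc k) \<subseteq> row_monos N' (Suc k) \<and>
     (\<exists>r\<in>kspan (mon ` row_monos N' (Suc k)). vanish (mon m + r) \<and>
        (mon m + r \<noteq> 0 \<and> output_polys N' F' = insert (mon m + r) (output_polys N F) \<and> Inv (Suc k) (insert (mon m + r) G) N' F' \<or>
         mon m + r \<in> Z (Suc k) G \<and> output_polys N' F' = output_polys N F \<and> Inv (Suc k) G N' F'))"

lemma output_polys_cong: "N' 3 = N 3 \<Longrightarrow> N' 4 = N 4 \<Longrightarrow> N' 5 = N 5 \<Longrightarrow> F' 1 = F 1 \<Longrightarrow> output_polys N' F' = output_polys N F"
  by (simp add: output_polys_def out_polys_def out_poly_def)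

lemma emit_out:
  assumes bd: "building s k N F" and j: "N 10 [] \<le> n"
  shows "wp emit N F (\<lambda>t N' F'. t \<le> h \<and> same {3, 4, 5, 21, 22} N N' \<and> same {1, 6} F F' \<and>
    output_polys N' F' = insert (mon (var (N 10 []) + row_mono N k (N 11 []))
      + (\<Sum>t<h. Poly_Mapping.single (row_mono N (Suc k) t) (- F 5 [t]))) (output_polys N F))"
proof (rule wp_mono[OF emit_wp[of N n h "N 3 []"]], goal_cases)
  case (4 t N' F')
  define q where "q = N 3 []"
  have o: "N' 3 [] = Suc q" "N' 4 = (N 4)([q] := Suc h)"
     "\<forall>q' t l. q' \<noteq> q \<longrightarrow> l \<le> n \<longrightarrow> N' 5 [q', t, l] = N 5 [q', t, l]"
     "\<forall>q' t. q' \<noteq> q \<longrightarrow> F' 1 [q', t] = F 1 [q', t]"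
     "\<forall>t<h. F' 1 [q, t] = - F 5 [t] \<and> (\<forall>l\<le>n. N' 5 [q, t, l] = N 6 [N 9 [], t, l])"
     "F' 1 [q, h] = 1"
     "\<forall>l\<le>n. N' 5 [q, h, l] = N 6 [N 8 [], N 11 [], l] + (if l = N 10 [] then 1 else 0)"
    using 4 unfolding q_def by blast+
  have K: "N 8 [] = k" "N 9 [] = Suc k" using bd by (auto simp: building_def)
  have old: "out_poly n (N', F') q' = out_poly n (N, F) q'" if "q' < q" for q'
  proof -
    have "exponents n (\<lambda>j. N' 5 [q', t, j]) = exponents n (\<lambda>j. N 5 [q', t, j])" for t
      using that o(3) by (intro exponents_cong) auto
    then show ?thesis using that o(2,4) by (simp add: out_poly_def)
  qed
  have e1: "exponents n (\<lambda>j. N' 5 [q, t, j]) = row_mono N (Suc k) t" if "t < h" for t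
    unfolding row_mono_def using that o(5) K by (intro exponents_cong) auto
  have e2: "exponents n (\<lambda>j. N' 5 [q, h, j]) = var (N 10 []) + row_mono N k (N 11 [])"
    unfolding row_mono_def exponents_var[OF j, symmetric] using o(7) K by (intro exponents_cong) auto
  have "out_poly n (N', F') q = mon (var (N 10 []) + row_mono N k (N 11 []))
      + (\<Sum>t<h. Poly_Mapping.single (row_mono N (Suc k) t) (- F 5 [t]))"
    using o(2,5,6) e1 e2 by (simp add: out_poly_def mon_def add.commute)
  then have "output_polys N' F' = insert (mon (var (N 10 []) + row_mono N k (N 11 []))
      + (\<Sum>t<h. Poly_Mapping.single (row_mono N (Suc k) t) (- F 5 [t]))) (output_polys N F)"
    unfolding output_polys_def out_polys_def using old o(1) by (simp add: lessThan_Suc q_def cong: image_cong_simp)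
  then show ?case using 4 by blast
qed (use bd in \<open>simp_all add: building_def registers_ok_def\<close>)

text \<open>Running \<open>add_row\<close> after a successful insertion, seen from the state before the insertion.\<close>
lemma add_building:
  assumes bd: "building s k N F" and j: "N 10 [] \<le> n" and i: "N 11 [] < h" and used: "N 7 [k, N 11 []] \<noteq> 0"
    and v: "\<And>c. c < h \<Longrightarrow> F 3 [c] = mono_value (R c) (var (N 10 []) + row_mono N k (N 11 []))"
    and N1: "same {16, 21, 22, 7} N N1" "N1 7 = (N 7)([Suc k, p] := 1)" "N1 16 [] = Suc p" "p < h" "N 7 [Suc k, p] = 0"
    and F1: "same {4, 5, 6} F F1"
    and dual_inv: "dual_inv h (\<lambda>i c. F1 4 [i, c]) (\<lambda>i. N1 7 [Suc k, i] \<noteq> 0)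
                 ((\<lambda>i c. mono_value (R c) (row_mono N (Suc k) i))(p := \<lambda>c. F 3 [c]))"
  shows "wp add_row N1 F1 (\<lambda>t N' F'. t = 0 \<and> same {1, 2, 6, 7, 14, 15, 16, 21, 22} N N' \<and> same {2, 4, 5, 6} F F' \<and>
    building s k N' F' \<and> same_below k N F N' F' \<and>
    row_monos N' (Suc k) = insert (var (N 10 []) + row_mono N k (N 11 [])) (row_monos N (Suc k)))"
proof -
  define cnt where "cnt = N 1 [Suc k]"
  note s1 = sameD[OF N1(1)] and f1 = sameD[OF F1]
  have K: "N 8 [] = k" "N 9 [] = Suc k" "N 18 [] = Suc n" "N 12 [] = h" using bd by (auto simp: building_def registers_ok_def)
  show ?thesis
  proof (rule wp_mono[OF add_row_wp[of N1 n h "Suc k" p cnt]], goal_cases)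
    case (7 t N' F')
    define m where "m = var (N 10 []) + row_mono N k (N 11 [])"
    have o: "same {1, 2, 6, 14, 15, 21} N1 N'" "same {2} F1 F'"
      "N' 1 = (N 1)([Suc k] := Suc cnt)" "N' 14 = (N 14)([Suc k, p] := N 10 [])" "N' 15 = (N 15)([Suc k, p] := N 11 [])"
      "\<And>k' i l. l \<le> n \<Longrightarrow> N' 6 [k', i, l] = (if k' = Suc k \<and> i = p
           then N 6 [k, N 11 [], l] + (if l = N 10 [] then 1 else 0) else N 6 [k', i, l])"
      "\<And>k' i l. l \<le> n \<Longrightarrow> N' 2 [k', i, l] = (if k' = Suc k \<and> i = cnt
           then N 6 [k, N 11 [], l] + (if l = N 10 [] then 1 else 0) else N 2 [k', i, l])"
      "\<And>k' i c. c < h \<Longrightarrow> F' 2 [k', i, c] = (if k' = Suc k \<and> i = p then F 3 [c] else F 2 [k', i, c])"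
      using 7 K s1 f1 by auto
    have sN: "same {1, 2, 6, 7, 14, 15, 16, 21, 22} N N'" and sF: "same {2, 4, 5, 6} F F'"
      using N1(1) F1 o(1,2) by (auto simp: same_def)
    note s = sameD[OF sN] and f = sameD[OF sF]
    have u: "N' 7 = (N 7)([Suc k, p] := 1)" using o(1) N1(2) by (auto simp: same_def)
    have same_below: "same_below k N F N' F'" unfolding same_below_def using o(3,6,7,8) u by simp
    have moK: "row_mono N' (Suc k) i = (if i = p then m else row_mono N (Suc k) i)" for i
    proof (cases "i = p")
      case True
      have "row_mono N' (Suc k) p = exponents n (\<lambda>l. N 6 [k, N 11 [], l] + (if l = N 10 [] then 1 else 0))"
        unfolding row_mono_def using o(6) by (intro exponents_cong) simp
      then show ?thesis using True exponents_var[OF j] by (simp add: m_def row_mono_def)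
    next
      case False
      then show ?thesis unfolding row_mono_def using o(6) by (auto intro!: exponents_cong)
    qed
    have famK: "row_monos N' (Suc k) = insert m (row_monos N (Suc k))"
    proof (intro equalityI subsetI)
      fix x assume "x \<in> row_monos N' (Suc k)"
      then obtain i where "i < h" "N' 7 [Suc k, i] \<noteq> 0" "x = row_mono N' (Suc k) i" by (auto simp: row_monos_def)
      then show "x \<in> insert m (row_monos N (Suc k))" using moK u by (cases "i = p") (auto simp: row_monos_def)
    next
      fix x assume x: "x \<in> insert m (row_monos N (Suc k))"
      have "m \<in> row_monos N' (Suc k)" unfolding row_monos_def mem_Collect_eq using moK u N1(4) by (intro exI[of _ p]) simp
      moreover have "x \<in> row_monos N' (Suc k)" if xf: "x \<in> row_monos N (Suc k)"
      proof -
        obtain i where i: "i < h" "N 7 [Suc k, i] \<noteq> 0" "x = row_mono N (Suc k) i" using xf by (auto simp: row_monos_def)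
        then have "i \<noteq> p" using N1(5) by auto
        then show ?thesis unfolding row_monos_def mem_Collect_eq using i moK u by (intro exI[of _ i]) simp
      qed
      ultimately show "x \<in> row_monos N' (Suc k)" using x by blast
    qed
    have ofK: "listed_monos N' (Suc k) = insert m (listed_monos N (Suc k))"
    proof -
      have a: "exponents n (\<lambda>l. N' 2 [Suc k, i, l]) = (if i = cnt then m else exponents n (\<lambda>l. N 2 [Suc k, i, l]))" for i
      proof (cases "i = cnt")
        case True
        have "exponents n (\<lambda>l. N' 2 [Suc k, cnt, l]) = exponents n (\<lambda>l. N 6 [k, N 11 [], l] + (if l = N 10 [] then 1 else 0))"
          using o(7) by (intro exponents_cong) simp
        then show ?thesis using True exponents_var[OF j] by (simp add: m_def row_mono_def)
      next
        case False
        then show ?thesis using o(7) by (auto intro!: exponents_cong)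
      qed
      show ?thesis unfolding listed_monos_def a using o(3) by (auto simp: lessThan_Suc cnt_def)
    qed
    have "building s k N' F'"
      unfolding building_def
    proof (intro conjI allI impI)
      show "registers_ok s N' F'" using bd s f by (simp add: building_def registers_ok_def)
      show "N' 8 [] = k" "N' 9 [] = Suc k" using K s by auto
      have "staircase k (row_monos N)" using bd unfolding building_def by (elim conjE)
      then show "staircase k (row_monos N')" by (rule staircase_cong) (rule same_below_row_monos[OF same_below])
      show "level N' F' k'" if "k' \<le> Suc k" for k'
      proof (cases "k' \<le> k")
        case True
        then show ?thesis using bd same_below_level[OF same_below True] by (simp add: building_def)
      next
        case False
        then have k': "k' = Suc k" using that by simp
        have l: "level N F (Suc k)" using bd by (simp add: building_def)
        show ?thesis unfolding level_def k'
          using l moK u o(8) v famK ofK by (auto simp: level_def m_def)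
      qed
      have src: "sources N k" using bd by (simp add: building_def)
      have low7: "N' 7 [k, i] = N 7 [k, i]" "row_mono N' k i = row_mono N k i" for i using same_below same_below_row_mono[OF same_below] by (auto simp: same_below_def)
      show "sources N' k"
        unfolding sources_def low7 moK
        using src u j i used o(4,5) by (auto simp: sources_def m_def)
      have "dual_inv h (\<lambda>i c. F' 4 [i, c]) (\<lambda>i. N' 7 [Suc k, i] \<noteq> 0) (\<lambda>i c. mono_value (R c) (row_mono N' (Suc k) i)) \<longleftrightarrow>
          dual_inv h (\<lambda>i c. F1 4 [i, c]) (\<lambda>i. N1 7 [Suc k, i] \<noteq> 0)
                 ((\<lambda>i c. mono_value (R c) (row_mono N (Suc k) i))(p := \<lambda>c. F 3 [c]))"
        using o(1,2) moK v by (intro dual_inv_cong) (auto simp: same_def m_def)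
      then show "dual_inv h (\<lambda>i c. F' 4 [i, c]) (\<lambda>i. N' 7 [Suc k, i] \<noteq> 0) (\<lambda>i c. mono_value (R c) (row_mono N' (Suc k) i))"
        using dual_inv by simp
    qed
    then show ?case using 7 sN sF same_below famK by (simp add: m_def)
  qed (use K s1 N1(3) in \<open>auto simp: cnt_def\<close>)
qed

end

context selection
begin

lemma pair_wp:
  assumes bd: "building s k N F" and Inv: "Inv (Suc k) G N F"
    and j: "N 10 [] \<le> n" and i: "N 11 [] < h" and used: "N 7 [k, N 11 []] \<noteq> 0"
  shows "wp (pair_step filt) N F (\<lambda>t N' F'. t \<le> pair_cost \<and> same pair_nats N N' \<and> same pair_fields F F' \<and>
    pair_post k G N F (var (N 10 []) + row_mono N k (N 11 [])) N' F')"
proof -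
  define m where "m = var (N 10 []) + row_mono N k (N 11 [])"
  let ?B = "\<lambda>i c. mono_value (R c) (row_mono N (Suc k) i)"
  have K: "N 8 [] = k" "N 9 [] = Suc k" "N 12 [] = h" using bd by (auto simp: building_def registers_ok_def)
  have ein: "dual_inv h (\<lambda>i c. F 4 [i, c]) (\<lambda>i. N 7 [Suc k, i] \<noteq> 0) ?B" using bd by (simp add: building_def)
  have vm: "F 0 [c, N 10 []] * F 2 [k, N 11 [], c] = mono_value (R c) m" if "c < h" for c
  proof -
    have "level N F k" "registers_ok s N F" using bd unfolding building_def by auto
    then show ?thesis using that i j used by (simp add: level_def registers_ok_def m_def mono_value_add)
  qed
  show ?thesis
    unfolding pair_step_def m_def[symmetric]
    apply (simp only: wp_Seq)
    apply (rule wp_mono[OF load_vec_wp[where h = h]])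
    subgoal by (rule K)
    subgoal premises p1 for t1 N1 F1
    proof -
      have s1: "same {21} N N1" "same {3} F F1" and t1: "t1 \<le> h" using p1 by auto
      have v1: "F1 3 [c] = mono_value (R c) m" if "c < h" for c using p1 that vm K by simp
      note e1 = sameD[OF s1(1)] sameD[OF s1(2)]
      have bd1: "building s k N1 F1" by (rule building_same[OF bd s1]) auto
      have mo1: "row_mono N1 = row_mono N" and fam1: "row_monos N1 = row_monos N" using e1 by (intro row_mono_cong row_monos_cong; simp)+
      show ?thesis
        apply (rule wp_mono[OF insertion_dual_inv_wp[where D = h and B = ?B]])
        subgoal by simp
        subgoal using K e1 by simp
        subgoal by simp
        subgoal using ein e1 K by simp
        subgoal premises p2 for t2 N2 F2
        proof -
          have t2: "t2 \<le> h * (h * 4) + 2 * h" using p2 by blast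
          have s2: "same {16, 21, 22, 7} N1 N2" and s2F: "same {4, 5, 6} F1 F2" using p2 by simp_all
          have w2: "F2 5 [i] = mat_vec h (\<lambda>i c. F 4 [i, c]) (\<lambda>c. F1 3 [c]) i" if "i < h" for i
            using p2 that e1 by simp
          have n9: "N1 9 [] = Suc k" "N1 7 = N 7" using K e1 by simp_all
          from p2[unfolded n9] consider
            (dep) "N2 16 [] = 0" "N2 7 = N 7" "F2 4 = F1 4"
              "\<forall>i<h. N 7 [Suc k, i] = 0 \<longrightarrow> F2 5 [i] = 0"
            | (new) p where "p < h" "N2 16 [] = Suc p" "N 7 [Suc k, p] = 0" "N2 7 = (N 7)([Suc k, p] := 1)"
              "dual_inv h (\<lambda>i c. F2 4 [i, c]) (\<lambda>i. N2 7 [Suc k, i] \<noteq> 0) (?B(p := \<lambda>c. F1 3 [c]))"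
            using w2 e1 by (elim conjE disjE exE) simp_all
          then show ?thesis
          proof cases
            case new
            show ?thesis
              apply (simp add: new(2))
              apply (rule wp_mono[OF add_building[OF bd1, where p = p]])
              subgoal using j e1 by simp
              subgoal using i e1 by simp
              subgoal using used e1 by simp
              subgoal for c using v1[of c] e1 by (simp add: mo1 m_def)
              subgoal using s2 .
              subgoal using new n9 by simp
              subgoal using new by simp
              subgoal using new by simp
              subgoal using new n9 by simp
              subgoal using s2F .
              subgoal using new mo1 by simp
              subgoal premises p3 for t3 N3 F3
              proof -
                have s3: "same {1, 2, 6, 7, 14, 15, 16, 21, 22} N1 N3" "same {2, 4, 5, 6} F1 F3"
                  and bd3: "building s k N3 F3" and low3: "same_below k N1 F1 N3 F3"
                  and fam3: "row_monos N3 (Suc k) = insert m (row_monos N (Suc k))"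
                  using p3 e1 by (simp_all add: fam1 mo1 m_def)
                note e3 = sameD[OF s3(1)] sameD[OF s3(2)]
                have same_below: "same_below k N F N3 F3"
                  by (rule same_below_trans[OF same_below_same low3]) (use e1 in simp_all)
                have output_polys: "output_polys N3 F3 = output_polys N F" using e1 e3 by (intro output_polys_cong) simp_all
                have X3: "Inv (Suc k) G N3 F3" by (rule Inv_frame[OF _ _ Inv]) (use e1 e3 in simp_all)
                have "- mon m \<in> kspan (mon ` row_monos N3 (Suc k))"
                  using sc.subspace_neg[OF subspace_kspan mon_in_kspan] fam3 by blast
                moreover have "mon m + - mon m = (0 :: 'k mpoly)" by simp
                ultimately have "\<exists>r\<in>kspan (mon ` row_monos N3 (Suc k)). vanish (mon m + r) \<and>
                    mon m + r \<in> Z (Suc k) G \<and> output_polys N3 F3 = output_polys N F \<and> Inv (Suc k) G N3 F3"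
                  using Z0 output_polys X3 by (intro bexI[of _ "- mon m"]) simp_all
                then have "pair_post k G N F m N3 F3"
                  unfolding pair_post_def using bd3 same_below fam3 by blast
                moreover have "same pair_nats N N3" "same pair_fields F F3" using s1 s3 by (auto simp: same_def)
                ultimately show ?thesis using t1 t2 p3 by (simp add: pair_cost_def)
              qed
              done
          next
            case dep
            have "N2 a = N a" if "a \<notin> {16, 21, 22}" for a
              using that s1 s2 dep(2) by (cases "a = 7") (auto simp: same_def)
            moreover have "F2 a = F a" if "a \<notin> {3, 5, 6}" for a
              using that s1 s2F dep(3) by (cases "a = 4") (auto simp: same_def)
            ultimately have s2': "same {16, 21, 22} N N2" "same {3, 5, 6} F F2"
              by (auto simp: same_def)
            note e2 = sameD[OF s2'(1)] sameD[OF s2'(2)]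
            have bd2: "building s k N2 F2"
              by (rule building_same[OF bd s2']) auto
            have mo2: "row_mono N2 = row_mono N" using e2 by (intro row_mono_cong) simp
            define r where "r = (\<Sum>t<h. Poly_Mapping.single (row_mono N (Suc k) t) (- F2 5 [t]))"
            have w0: "F2 5 [t] = 0" if "t < h" "\<not> N 7 [Suc k, t] \<noteq> 0" for t using dep(4) that by simp
            have van: "vanish (mon m + r)" unfolding r_def
            proof (rule vanish_combination[where U = "\<lambda>i. N 7 [Suc k, i] \<noteq> 0"])
              fix c assume c: "c < h"
              have "F1 3 [c] = (\<Sum>i\<in>{i. i < h \<and> N 7 [Suc k, i] \<noteq> 0}. mat_vec h (\<lambda>i c. F 4 [i, c]) (\<lambda>c. F1 3 [c]) i * ?B i c)"
                by (rule dual_inv_dep[OF ein _ c]) (use w0 w2 in auto)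
              then show "mono_value (R c) m = (\<Sum>i\<in>{i. i < h \<and> N 7 [Suc k, i] \<noteq> 0}. F2 5 [i] * ?B i c)"
                using v1[OF c] w2 by simp
            qed (rule w0)
            have rk: "r \<in> kspan (mon ` row_monos N (Suc k))"
              unfolding r_def row_monos_def by (rule combination_kspan[where U = "\<lambda>i. N 7 [Suc k, i] \<noteq> 0"]) (rule w0)
            show ?thesis
              apply (simp add: dep(1))
              apply (rule wp_mono[OF filt[OF bd2, where G = G and b = "mon m + r"]])
              subgoal by (rule Inv_frame[OF _ _ Inv]) (use e2 in simp_all)
              subgoal using j e2 by simp
              subgoal using i e2 by simp
              subgoal using used e2 by simp
              subgoal for t using w0[of t] e2 by simp
              subgoal using e2 by (simp add: m_def r_def mo2)
              subgoal by (rule van)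
              subgoal premises p3 for t3 N3 F3
              proof -
                have t3: "t3 \<le> filt_cost" and s3: "same select_nats N2 N3" "same select_fields F2 F3" using p3 by blast+
                have s3': "same select_nats N N3" "same {3, 5, 6, 7, 8, 9, 10} F F3" using s2' s3 by (auto simp: same_def)
                note e3 = sameD[OF s3'(1)] sameD[OF s3'(2)]
                have bd3: "building s k N3 F3" by (rule building_same[OF bd s3']) auto
                have o3: "output_polys N3 F3 = output_polys N F" using e3 by (intro output_polys_cong) simp_all
                have f3: "row_mono N3 = row_mono N" "row_monos N3 = row_monos N" using e3 by (intro row_mono_cong row_monos_cong; simp)+
                have l3: "same_below k N F N3 F3" using e3 by (intro same_below_same) simp_all
                show ?thesis
                proof (cases "N3 17 [] = 0")
                  case True
                  then have "mon m + r \<in> Z (Suc k) G" "Inv (Suc k) G N3 F3" using p3 by auto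
                  then have "pair_post k G N F m N3 F3"
                    unfolding pair_post_def using bd3 l3 f3 o3 rk van by auto
                  moreover have "same pair_nats N N3" "same pair_fields F F3" using s3' by (auto simp: same_def)
                  ultimately show ?thesis using True t1 t2 t3 by (simp add: pair_cost_def)
                next
                  case False
                  then have b: "mon m + r \<noteq> 0" "Inv (Suc k) (insert (mon m + r) G) N3 F3" using p3 by auto
                  have pos: "0 < N3 17 []" using False by simp
                  show ?thesis
                    apply (simp add: pos False)
                    apply (rule wp_mono[OF emit_out[OF bd3]])
                    subgoal using j e3 by simp
                    subgoal premises p4 for t4 N4 F4
                    proof -
                      have t4: "t4 \<le> h" and s4: "same {3, 4, 5, 21, 22} N3 N4" "same {1, 6} F3 F4" using p4 by blast+
                      note e4 = sameD[OF s4(1)] sameD[OF s4(2)]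
                      have bd4: "building s k N4 F4" by (rule building_same[OF bd3 s4]) auto
                      have f4: "row_monos N4 = row_monos N" using e4 f3(2) row_monos_cong[of N4 N3] by simp
                      have l4: "same_below k N F N4 F4" by (rule same_below_trans[OF l3 same_below_same]) (use e4 in simp_all)
                      have X4: "Inv (Suc k) (insert (mon m + r) G) N4 F4"
                        by (rule Inv_frame[OF _ _ b(2)]) (use e4 in simp_all)
                      have "F3 5 = F2 5" using sameD[OF s3(2)] by simp
                      then have "output_polys N4 F4 = insert (mon m + r) (output_polys N F)"
                        using p4 o3 e3 by (simp add: f3 m_def r_def)
                      then have "pair_post k G N F m N4 F4"
                        unfolding pair_post_def using bd4 l4 f4 rk van b X4 by auto
                      moreover have "same pair_nats N N4" "same pair_fields F F4" using s3' s4 by (auto simp: same_def)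
                      ultimately show ?thesis using t1 t2 t3 t4 by (simp add: pair_cost_def)
                    qed
                    done
                qed
              qed
              done
          qed
        qed
        done
    qed
    done
qed

end

text \<open>Used rows carry different monomials, since their value vectors are mapped to different unit vectors. So the
  coefficients of \<open>p\<close> are the coefficients of a combination of these value vectors, which is zero.\<close>
lemma (in points) dual_inv_independent:
  assumes inv: "dual_inv h L U (\<lambda>i c. mono_value (R c) (M i))"
    and p: "p \<in> kspan (mon ` {M i | i. i < h \<and> U i})" and van: "vanish p"
  shows "p = 0"
proof -
  let ?S = "{i. i < h \<and> U i}"
  have inj: "inj_on M ?S"
  proof (rule inj_onI)
    fix i i' assume i: "i \<in> ?S" "i' \<in> ?S" "M i = M i'"
    have "mat_vec h L (\<lambda>c. mono_value (R c) (M i)) i = 1" "mat_vec h L (\<lambda>c. mono_value (R c) (M i')) i = (if i = i' then 1 else 0)"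
      using inv i(1,2) by (auto simp: dual_inv_def)
    then show "i = i'" using i(3) by (auto split: if_splits)
  qed
  have img: "{M i | i. i < h \<and> U i} = M ` ?S" by auto
  have keys: "Poly_Mapping.keys p \<subseteq> M ` ?S" using p by (simp add: kspan_mon img)
  have "0 = (\<Sum>i\<in>?S. Poly_Mapping.lookup p (M i) * mono_value (R c) (M i))" if "c < h" for c
  proof -
    have "eval_poly (R c) p = (\<Sum>m\<in>M ` ?S. Poly_Mapping.lookup p m * mono_value (R c) m)"
      unfolding eval_lin_ext by (rule lin_ext_superset[OF _ keys]) simp
    also have "\<dots> = (\<Sum>i\<in>?S. Poly_Mapping.lookup p (M i) * mono_value (R c) (M i))"
      by (simp add: sum.reindex[OF inj])
    finally show ?thesis using van that by (simp add: vanish_def)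
  qed
  then have "Poly_Mapping.lookup p (M i) = 0" if "i \<in> ?S" for i
    using dual_inv_coeffs[OF inv, of "\<lambda>_. 0" "\<lambda>i. Poly_Mapping.lookup p (M i)" i] that by (simp add: mat_vec_def)
  then have "Poly_Mapping.lookup p m = 0" for m using keys by (cases "m \<in> Poly_Mapping.keys p") (auto simp: in_keys_iff)
  then have "Poly_Mapping.keys p = {}" by (simp add: in_keys_iff set_eq_iff del: keys_eq_empty)
  then show ?thesis by simp
qed

context selection
begin

text \<open>What the products considered so far contribute. For a product that enters the new family, \<open>r\<close> is its
  negative and the polynomial is zero.\<close>
definition handled :: "nat \<Rightarrow> monomial set \<Rightarrow> 'k mpoly set \<Rightarrow> monomial set \<Rightarrow> bool" where
  "handled K B G P \<longleftrightarrow> (\<forall>m\<in>P. \<exists>r\<in>kspan (mon ` B). vanish (mon m + r) \<and> mon m + r \<in> G \<union> Z K G)"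

definition emitted :: "monomial set \<Rightarrow> monomial set \<Rightarrow> 'k mpoly set \<Rightarrow> bool" where
  "emitted A B G \<longleftrightarrow> (\<forall>g\<in>G. g \<noteq> 0 \<and> vanish g \<and> (\<exists>m\<in>mono_plus n A. \<exists>r\<in>kspan (mon ` B). g = mon m + r))"

definition good :: "nat \<Rightarrow> (nat \<Rightarrow> monomial set) \<Rightarrow> 'k mpoly set \<Rightarrow> bool" where
  "good K f G \<longleftrightarrow> handled K (f K) G (mono_plus n (f (K - 1))) \<and> emitted (f (K - 1)) (f K) G \<and> Post K G"

lemma handled_mono:
  assumes "handled K B G P" "B \<subseteq> B'" "G \<subseteq> G'"
  shows "handled K B' G' P"
  unfolding handled_def
proof
  fix m assume "m \<in> P"
  then obtain r where "r \<in> kspan (mon ` B)" "vanish (mon m + r)" "mon m + r \<in> G \<union> Z K G"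
    using assms(1) unfolding handled_def by blast
  then show "\<exists>r\<in>kspan (mon ` B'). vanish (mon m + r) \<and> mon m + r \<in> G' \<union> Z K G'"
    using kspan_mono[OF image_mono[OF assms(2)]] Zmono[OF assms(3)] assms(3) by blast
qed

lemma emitted_mono:
  assumes "emitted A B G" "B \<subseteq> B'"
  shows "emitted A B' G"
  using assms(1) kspan_mono[OF image_mono[OF assms(2)], of mon] unfolding emitted_def by blast

definition degree_inv :: "nat \<Rightarrow> nat mem \<Rightarrow> 'k mem \<Rightarrow> monomial set \<Rightarrow> nat mem \<Rightarrow> 'k mem \<Rightarrow> bool" where
  "degree_inv k N0 F0 P N F \<longleftrightarrow> building s k N F \<and> same_below k N0 F0 N F \<and>
     (\<exists>G. Inv (Suc k) G N F \<and> output_polys N F = output_polys N0 F0 \<union> G \<and>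
        handled (Suc k) (row_monos N (Suc k)) G P \<and> emitted (row_monos N0 k) (row_monos N (Suc k)) G)"

lemma degree_inv_upd:
  assumes "degree_inv k N0 F0 P N F" "a \<in> {10, 11}"
  shows "degree_inv k N0 F0 P (N(a := f)) F"
proof -
  let ?N = "N(a := f)"
  have e: "?N b = N b" if "b \<notin> {10, 11}" for b using that assms(2) by auto
  have "building s k N F" using assms(1) by (simp add: degree_inv_def)
  then have "building s k ?N F" by (rule building_same[of s k N F "{10, 11}" ?N "{}" F]) (use assms(2) in auto)
  moreover have "same_below k N F ?N F" by (rule same_below_same) (use assms(2) in auto)
  then have "same_below k N0 F0 ?N F" using assms(1) same_below_trans unfolding degree_inv_def by blast
  moreover have "output_polys ?N F = output_polys N F" by (rule output_polys_cong) (use assms(2) in auto)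
  moreover have "row_monos ?N = row_monos N" by (rule row_monos_cong) (use assms(2) in auto)
  moreover have "Inv K G ?N F" if "Inv K G N F" for K G by (rule Inv_frame[OF _ _ that]) (use assms(2) in auto)
  ultimately show ?thesis using assms(1) unfolding degree_inv_def by auto
qed

lemma degree_inv_pair:
  assumes same_below: "same_below k N0 F0 N F" and out: "output_polys N F = output_polys N0 F0 \<union> G"
    and hd: "handled (Suc k) (row_monos N (Suc k)) G P" and em: "emitted (row_monos N0 k) (row_monos N (Suc k)) G"
    and post: "pair_post k G N F m N' F'" and m: "m \<in> mono_plus n (row_monos N0 k)"
  shows "degree_inv k N0 F0 (insert m P) N' F'"
proof -
  let ?B = "row_monos N' (Suc k)"
  have bd: "building s k N' F'" and l: "same_below k N F N' F'" and B: "row_monos N (Suc k) \<subseteq> ?B"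
    using post by (auto simp: pair_post_def)
  obtain r where r: "r\<in>kspan (mon ` ?B)" "vanish (mon m + r)" and
    c: "mon m + r \<noteq> 0 \<and> output_polys N' F' = insert (mon m + r) (output_polys N F) \<and> Inv (Suc k) (insert (mon m + r) G) N' F' \<or>
         mon m + r \<in> Z (Suc k) G \<and> output_polys N' F' = output_polys N F \<and> Inv (Suc k) G N' F'"
    using post unfolding pair_post_def by blast
  define G' where "G' = (if output_polys N' F' = insert (mon m + r) (output_polys N F) \<and> mon m + r \<noteq> 0 \<and>
      Inv (Suc k) (insert (mon m + r) G) N' F' then insert (mon m + r) G else G)"
  have sub: "G \<subseteq> G'" by (auto simp: G'_def)
  have X': "Inv (Suc k) G' N' F'" and out': "output_polys N' F' = output_polys N0 F0 \<union> G'"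
    using c out by (auto simp: G'_def)
  have "handled (Suc k) ?B G' P" by (rule handled_mono[OF hd B sub])
  moreover have "mon m + r \<in> G' \<union> Z (Suc k) G'" using c Zmono[OF sub] by (auto simp: G'_def)
  ultimately have hd': "handled (Suc k) ?B G' (insert m P)" using r unfolding handled_def by blast
  have "emitted (row_monos N0 k) ?B G" by (rule emitted_mono[OF em B])
  then have em': "emitted (row_monos N0 k) ?B G'" using r m unfolding G'_def emitted_def by auto
  show ?thesis unfolding degree_inv_def using bd same_below_trans[OF same_below l] X' out' hd' em' by blast
qed

definition done_set :: "nat mem \<Rightarrow> nat \<Rightarrow> nat \<Rightarrow> nat \<Rightarrow> monomial set" where
  "done_set N0 k j i = {var j' + row_mono N0 k i' | j' i'. i' < h \<and> N0 7 [k, i'] \<noteq> 0 \<and> (j' < j \<or> j' = j \<and> i' < i)}"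

lemma done_set_simps:
  "done_set N0 k 0 0 = {}"
  "done_set N0 k j h = done_set N0 k (Suc j) 0"
  "i < h \<Longrightarrow> N0 7 [k, i] \<noteq> 0 \<Longrightarrow> done_set N0 k j (Suc i) = insert (var j + row_mono N0 k i) (done_set N0 k j i)"
  "N0 7 [k, i] = 0 \<Longrightarrow> done_set N0 k j (Suc i) = done_set N0 k j i"
  "done_set N0 k (Suc n) 0 = mono_plus n (row_monos N0 k)"
proof -
  show "done_set N0 k 0 0 = {}" by (auto simp: done_set_def)
  show "done_set N0 k j h = done_set N0 k (Suc j) 0" by (auto simp: done_set_def less_Suc_eq)
  show "done_set N0 k j (Suc i) = insert (var j + row_mono N0 k i) (done_set N0 k j i)"
    if "i < h" "N0 7 [k, i] \<noteq> 0"
    using that by (auto simp: done_set_def less_Suc_eq)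
  show "done_set N0 k j (Suc i) = done_set N0 k j i" if "N0 7 [k, i] = 0"
    using that by (auto simp: done_set_def less_Suc_eq)
  show "done_set N0 k (Suc n) 0 = mono_plus n (row_monos N0 k)"
    by (auto simp: done_set_def mono_plus_var row_monos_def less_Suc_eq_le)
qed

definition pairs_prog :: com where
  "pairs_prog = For 10 (Rd 18 []) (For 11 (Rd 12 []) (Cond (Rd 7 [Rd 8 [], Rd 11 []]) (pair_step filt) Skip))"

lemma pairs_wp:
  assumes d0: "degree_inv k N0 F0 {} N0 F0"
  shows "wp pairs_prog N0 F0 (\<lambda>t N F. t \<le> Suc n * (h * pair_cost) \<and> degree_inv k N0 F0 (mono_plus n (row_monos N0 k)) N F)"
  unfolding pairs_prog_def
proof (rule wp_For[where D = "Suc n" and b = "h * pair_cost" and I = "\<lambda>j N F. degree_inv k N0 F0 (done_set N0 k j 0) N F"], goal_cases)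
  case 1
  show ?case using d0 by (simp add: done_set_simps degree_inv_upd)
next
  case (2 j N1 F1)
  show ?case
  proof (rule wp_For[where D = h and b = pair_cost and I = "\<lambda>i N F. degree_inv k N0 F0 (done_set N0 k j i) N F \<and> N 10 [] = j"], goal_cases)
    case 1
    then show ?case using 2 by (simp add: degree_inv_upd)
  next
    case i: (2 i N F)
    have d: "degree_inv k N0 F0 (done_set N0 k j i) N F" and j: "N 10 [] = j" using i by simp_all
    from d obtain G where bd: "building s k N F" and same_below: "same_below k N0 F0 N F" and Inv: "Inv (Suc k) G N F"
      and out: "output_polys N F = output_polys N0 F0 \<union> G" and hd: "handled (Suc k) (row_monos N (Suc k)) G (done_set N0 k j i)"
      and em: "emitted (row_monos N0 k) (row_monos N (Suc k)) G" unfolding degree_inv_def by blast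
    have k: "N 8 [] = k" using bd by (simp add: building_def)
    have u: "N 7 [k, i] = N0 7 [k, i]" using same_below by (simp add: same_below_def)
    show ?case
    proof (cases "N0 7 [k, i] = 0")
      case True
      then show ?thesis using d j k u i by (simp add: done_set_simps degree_inv_upd)
    next
      case False
      have "row_mono N k i = row_mono N0 k i" by (rule same_below_row_mono[OF same_below]) simp
      moreover have m: "var j + row_mono N0 k i \<in> mono_plus n (row_monos N0 k)"
        unfolding mono_plus_var by (rule UN_I[of j]) (use 2 i False in \<open>auto simp: row_monos_def\<close>)
      moreover have "N' 10 [] = j" "N' 11 [] = i" if "same pair_nats N N'" for N'
        using sameD[OF that, of 10] sameD[OF that, of 11] j i by simp_all
      moreover have "wp (pair_step filt) N F (\<lambda>t N' F'. t \<le> pair_cost \<and> same pair_nats N N' \<and> same pair_fields F F' \<and>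
          pair_post k G N F (var (N 10 []) + row_mono N k (N 11 [])) N' F')"
        using bd Inv by (rule pair_wp) (use i 2 j u False in auto)
      ultimately have "wp (pair_step filt) N F (\<lambda>t N' F'. t \<le> pair_cost \<and> N' 11 [] = i \<and>
          degree_inv k N0 F0 (done_set N0 k j (Suc i)) (N'(11 := (N' 11)([] := Suc i))) F' \<and> N' 10 [] = j)"
        using degree_inv_pair[OF same_below out hd em _ m] i(1) False j i(2)
        by (elim wp_mono) (simp only: done_set_simps degree_inv_upd[of _ _ _ _ _ _ 11, simplified] simp_thms)
      then show ?thesis using i k u False by simp
    qed
  next
    case (3 i N F)
    then show ?case by (simp add: degree_inv_def building_def registers_ok_def)
  next
    case (4 t N' F')
    then show ?case by (simp add: degree_inv_upd done_set_simps)
  qed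
next
  case (3 i N F)
  then show ?case by (simp add: degree_inv_def building_def registers_ok_def)
next
  case (4 t N' F')
  then show ?case by (simp add: done_set_simps)
qed

lemma degree_wp:
  assumes b: "registers_ok s N F" and k: "N 8 [] = k" and lev: "\<forall>k'\<le>k. level N F k'" and st: "staircase k (row_monos N)"
  shows "wp (degree_step prep filt) N F (\<lambda>t N' F'. t \<le> prep_cost + Suc n * (h * pair_cost) \<and> registers_ok s N' F' \<and> N' 8 [] = k \<and>
     (\<forall>k'\<le>Suc k. level N' F' k') \<and> staircase (Suc k) (row_monos N') \<and> same_below k N F N' F' \<and>
     (\<exists>G. output_polys N' F' = output_polys N F \<union> G \<and> good (Suc k) (row_monos N') G))"
proof -
  define N1 where "N1 = N(9 := (N 9)([] := Suc k), 1 := (N 1)([Suc k] := 0))"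
  have h: "N 12 [] = h" using b by (simp add: registers_ok_def)
  have "wp (init_rows 12 7 3 ;; prep ;; pairs_prog) N1 F (\<lambda>t N' F'. t \<le> prep_cost + Suc n * (h * pair_cost) \<and> registers_ok s N' F' \<and> N' 8 [] = k \<and>
     (\<forall>k'\<le>Suc k. level N' F' k') \<and> staircase (Suc k) (row_monos N') \<and> same_below k N F N' F' \<and>
     (\<exists>G. output_polys N' F' = output_polys N F \<union> G \<and> good (Suc k) (row_monos N') G))"
    apply (simp only: wp_Seq)
    apply (rule wp_mono[OF init_rows_wp[where D = h]])
    subgoal by simp
    subgoal using h by (simp add: N1_def)
    subgoal by simp
    subgoal premises p1 for t2 N2 F2
    proof -
      have t2: "t2 = 0" and s2: "same {21, 22, 7} N1 N2" "same {4} F F2" using p1 by simp_all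
      note e2 = sameD[OF s2(1)] sameD[OF s2(2)]
      have u2: "\<forall>i<h. N2 7 [Suc k, i] = 0" "\<forall>k' i. k' \<noteq> Suc k \<longrightarrow> N2 7 [k', i] = N 7 [k', i]"
        "\<forall>i<h. \<forall>c<h. F2 4 [i, c] = (if i = c then 1 else 0)" using p1 by (simp_all add: N1_def)
      have low2: "same_below k N F N2 F2" using u2 e2 by (simp add: same_below_def N1_def)
      have bd2: "building s k N2 F2"
        unfolding building_def
      proof (intro conjI allI impI)
        show "registers_ok s N2 F2" using b e2 by (simp add: registers_ok_def N1_def)
        show "N2 8 [] = k" "N2 9 [] = Suc k" using e2 k by (simp_all add: N1_def)
        show "level N2 F2 k'" if "k' \<le> Suc k" for k'
        proof (cases "k' \<le> k")
          case True
          then show ?thesis using same_below_level[OF low2 True] lev by blast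
        next
          case False
          then have k': "k' = Suc k" using that by simp
          show ?thesis unfolding k' level_def row_monos_def listed_monos_def using u2 e2 by (auto simp: N1_def)
        qed
        show "staircase k (row_monos N2)" by (rule staircase_cong[OF st]) (rule same_below_row_monos[OF low2])
        show "sources N2 k" using u2 by (simp add: sources_def)
        show "dual_inv h (\<lambda>i c. F2 4 [i, c]) (\<lambda>i. N2 7 [Suc k, i] \<noteq> 0) (\<lambda>i c. mono_value (R c) (row_mono N2 (Suc k) i))"
          using u2 by (intro dual_inv_init) auto
      qed
      have o2: "output_polys N2 F2 = output_polys N F" using e2 by (intro output_polys_cong) (simp_all add: N1_def)
      show ?thesis
        apply (rule wp_mono[OF prep[OF bd2]])
        subgoal premises p3 for t3 N3 F3
        proof -
          have t3: "t3 \<le> prep_cost" and s3: "same select_nats N2 N3" "same select_fields F2 F3" and X3: "Inv (Suc k) {} N3 F3" using p3 by blast+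
          note e3 = sameD[OF s3(1)] sameD[OF s3(2)]
          have bd3: "building s k N3 F3" by (rule building_same[OF bd2 s3]) auto
          have l3: "same_below k N F N3 F3" by (rule same_below_trans[OF low2 same_below_same]) (use e3 in simp_all)
          have o3: "output_polys N3 F3 = output_polys N2 F2" using e3 by (intro output_polys_cong) simp_all
          have d3: "degree_inv k N3 F3 {} N3 F3"
            unfolding degree_inv_def using bd3 X3 by (auto simp: same_below_refl handled_def emitted_def)
          show ?thesis
            apply (rule wp_mono[OF pairs_wp[OF d3]])
            subgoal premises p4 for t4 N4 F4
            proof -
              have t4: "t4 \<le> Suc n * (h * pair_cost)" and d4: "degree_inv k N3 F3 (mono_plus n (row_monos N3 k)) N4 F4" using p4 by auto
              from d4 obtain G where bd: "building s k N4 F4" and same_below: "same_below k N3 F3 N4 F4" and Inv: "Inv (Suc k) G N4 F4"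
                and out: "output_polys N4 F4 = output_polys N3 F3 \<union> G"
                and hd: "handled (Suc k) (row_monos N4 (Suc k)) G (mono_plus n (row_monos N3 k))"
                and em: "emitted (row_monos N3 k) (row_monos N4 (Suc k)) G" unfolding degree_inv_def by blast
              have f: "row_monos N3 k = row_monos N4 k" using same_below_row_monos[OF same_below, of k] by simp
              have bd': "registers_ok s N4 F4" "N4 8 [] = k" "\<forall>k'\<le>Suc k. level N4 F4 k'" "staircase k (row_monos N4)" "sources N4 k"
                "dual_inv h (\<lambda>i c. F4 4 [i, c]) (\<lambda>i. N4 7 [Suc k, i] \<noteq> 0) (\<lambda>i c. mono_value (R c) (row_mono N4 (Suc k) i))"
                using bd unfolding building_def by simp_all
              have "row_monos N4 (Suc k) \<subseteq> mono_plus n (row_monos N4 k)"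
              proof
                fix x assume "x \<in> row_monos N4 (Suc k)"
                then obtain i where "i < h" "N4 7 [Suc k, i] \<noteq> 0" "x = row_mono N4 (Suc k) i" by (auto simp: row_monos_def)
                then show "x \<in> mono_plus n (row_monos N4 k)"
                  using bd'(5) unfolding sources_def mono_plus_var row_monos_def by auto
              qed
              moreover have "p = 0" if "p \<in> kspan (mon ` row_monos N4 (Suc k))" "vanish p" for p
                using dual_inv_independent[OF bd'(6) _ that(2)] that(1) unfolding row_monos_def by blast
              moreover have "\<exists>r\<in>kspan (mon ` row_monos N4 (Suc k)). vanish (mon m + r)" if "m \<in> mono_plus n (row_monos N4 k)" for m
                using hd that unfolding handled_def f by blast
              ultimately have "staircase (Suc k) (row_monos N4)"
                using bd'(4) unfolding staircase_def by (auto simp: less_Suc_eq)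
              moreover have "good (Suc k) (row_monos N4) G" unfolding good_def using hd em f Inv_Post[OF Inv] by simp
              ultimately show ?thesis using t2 t3 t4 bd' same_below_trans[OF l3 same_below] out o3 o2 by auto
            qed
            done
        qed
        done
    qed
    done
  then show ?thesis unfolding degree_step_def pairs_prog_def N1_def using k by simp
qed

definition main_inv :: "nat \<Rightarrow> nat mem \<Rightarrow> 'k mem \<Rightarrow> bool" where
  "main_inv k N F \<longleftrightarrow> registers_ok s N F \<and> (\<forall>k'\<le>k. level N F k') \<and> staircase k (row_monos N) \<and>
     (\<exists>G. output_polys N F = (\<Union>k'\<in>{1..k}. G k') \<and> (\<forall>k'\<in>{1..k}. good k' (row_monos N) (G k')))"

lemma main_inv_upd: "main_inv k N F \<Longrightarrow> main_inv k (N(8 := f)) F"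
  unfolding main_inv_def registers_ok_def level_def
    row_monos_cong[of "N(8 := f)" N, simplified] listed_monos_cong[of "N(8 := f)" N, simplified]
    row_mono_cong[of "N(8 := f)" N, simplified] output_polys_cong[of "N(8 := f)" N F F, simplified]
  by simp

lemma main_inv_step:
  assumes m: "main_inv k N F" and b: "registers_ok s N' F'" "\<forall>k'\<le>Suc k. level N' F' k'" "staircase (Suc k) (row_monos N')"
    and same_below: "same_below k N F N' F'" and out: "output_polys N' F' = output_polys N F \<union> G'" and good: "good (Suc k) (row_monos N') G'"
  shows "main_inv (Suc k) N' F'"
proof -
  have "\<exists>G. output_polys N F = (\<Union>k'\<in>{1..k}. G k') \<and> (\<forall>k'\<in>{1..k}. good k' (row_monos N) (G k'))"
    using m unfolding main_inv_def by (elim conjE)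
  then obtain G where G: "output_polys N F = (\<Union>k'\<in>{1..k}. G k')" "\<forall>k'\<in>{1..k}. good k' (row_monos N) (G k')"
    by (elim exE conjE)
  let ?G = "G(Suc k := G')"
  have "good k' (row_monos N') (?G k')" if "k' \<in> {1..Suc k}" for k'
  proof (cases "k' = Suc k")
    case True
    then show ?thesis using good by simp
  next
    case False
    then have k': "k' \<in> {1..k}" using that by auto
    have "row_monos N' k' = row_monos N k'" "row_monos N' (k' - 1) = row_monos N (k' - 1)" using same_below_row_monos[OF same_below] k' by auto
    then show ?thesis using bspec[OF G(2) k'] False unfolding good_def by simp
  qed
  moreover have "output_polys N' F' = (\<Union>k'\<in>{1..Suc k}. ?G k')"
    unfolding out G(1) by (auto simp: atLeastAtMostSuc_conv)
  ultimately show ?thesis unfolding main_inv_def using b by (intro conjI exI[of _ ?G] ballI) auto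
qed

lemma main_wp:
  "wp (main_prog prep filt) (fst (input n h s R)) (snd (input n h s R))
     (\<lambda>t N F. t \<le> s * (prep_cost + Suc n * (h * pair_cost)) \<and> main_inv s N F)"
proof -
  define N where "N = (fst (input n h s R))(12 := (\<lambda>is. 0)([] := h), 18 := (\<lambda>is. 0)([] := Suc n), 13 := (\<lambda>is. 0)([] := lift_dim),
     1 := (\<lambda>is. 0)([0] := 1), 7 := (\<lambda>is. 0)([0, 0] := 1))"
  define F where "F = snd (input n h s R)"
  have N0: "N 0 [2] = s" "N 12 [] = h" "N 18 [] = Suc n" "N 13 [] = lift_dim" "N 1 = (\<lambda>is. 0)([0] := 1)"
    "N 7 = (\<lambda>is. 0)([0, 0] := 1)" "N 6 = (\<lambda>is. 0)" "N 2 = (\<lambda>is. 0)" "N 3 [] = 0" and F0: "\<forall>c<h. \<forall>j\<le>n. F 0 [c, j] = R c j"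
    by (simp_all add: N_def F_def input_def fun_eq_iff)
  have "wp (For 21 (Rd 12 []) (FOne (2, [Num 0, Num 0, Rd 21 []])) ;; For 8 (Rd 0 [Num 2]) (degree_step prep filt)) N F
     (\<lambda>t N F. t \<le> s * (prep_cost + Suc n * (h * pair_cost)) \<and> main_inv s N F)"
    apply (simp only: wp_Seq)
    apply (rule wp_For[where D = h and b = 0 and I = "\<lambda>m N' F'. same {21} N N' \<and> same {2} F F' \<and> (\<forall>c<m. F' 2 [0, 0, c] = 1)"])
    subgoal by simp
    subgoal by (auto simp: less_Suc_eq)
    subgoal using N0 by (simp add: same_def)
    subgoal premises p for t1 N1 F1
    proof -
      note e = sameD[OF conjunct1[OF p(3)]] sameD[OF conjunct1[OF conjunct2[OF p(3)]]]
      have mo0: "row_mono N1 0 i = 0" for i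
        unfolding row_mono_def using e N0 by (intro poly_mapping_eqI) (simp add: lookup_exponents)
      have of0: "exponents n (\<lambda>j. N1 2 [0, i, j]) = 0" for i
        using e N0 by (intro poly_mapping_eqI) (simp add: lookup_exponents)
      have fam0: "row_monos N1 0 = {0}" unfolding row_monos_def mo0 using e N0 h_pos by auto
      have ofam0: "listed_monos N1 0 = {0}" unfolding listed_monos_def of0 using e N0 by auto
      have "registers_ok s N1 F1" using e N0 F0 by (simp add: registers_ok_def)
      moreover have "level N1 F1 0" unfolding level_def mo0 fam0 ofam0 using e N0 p(3) by simp
      moreover have "staircase 0 (row_monos N1)" using fam0 by (simp add: staircase_def)
      moreover have "output_polys N1 F1 = {}" using e N0 by (simp add: output_polys_def out_polys_def)
      ultimately have m0: "main_inv 0 N1 F1" by (simp add: main_inv_def)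
      have t1: "t1 = 0" using p by simp
      show ?thesis
      proof (rule wp_For[where D = s and b = "prep_cost + Suc n * (h * pair_cost)" and I = "\<lambda>k N F. main_inv k N F"], goal_cases)
        case 1
        show ?case by (rule main_inv_upd[OF m0])
      next
        case (2 k N2 F2)
        have "registers_ok s N2 F2" "\<forall>k'\<le>k. level N2 F2 k'" "staircase k (row_monos N2)"
          using 2(3) unfolding main_inv_def by simp_all
        from degree_wp[OF this(1) 2(2) this(2,3)] show ?case
          by (rule wp_mono) (use main_inv_step[OF 2(3)] main_inv_upd in blast)
      next
        case (3 k N F)
        then show ?case by (simp add: main_inv_def registers_ok_def)
      next
        case (4 t N' F')
        then show ?case using t1 by simp
      qed
    qed
    done
  then show ?thesis
    unfolding main_prog_def F_def N_def by (simp add: input_def fun_upd_def[of "\<lambda>is. 0"] cong: if_cong)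
qed

end

section \<open>The border basis\<close>

text \<open>A product can coincide with a monomial that already belongs to the new family. This is the only case in
  which its polynomial is zero, and comparing exponents detects it without operations in the field.\<close>
definition new_monomial :: com where
  "new_monomial = NSet (17, []) (Num 1) ;;
     For 21 (Rd 12 []) (Cond (Rd 7 [Rd 9 [], Rd 21 []])
       (NSet (24, []) (Num 0) ;;
        For 22 (Rd 18 []) (NSet (24, []) (Plus (Rd 24 []) (Neq (Rd 6 [Rd 9 [], Rd 21 [], Rd 22 []]) (product_exponent (Rd 22 []))))) ;;
        Cond (Rd 24 []) Skip (NSet (17, []) (Num 0))) Skip)"

lemma new_monomial_wp:
  fixes F :: "'k::field mem"
  assumes n: "N 18 [] = Suc n" and h: "N 12 [] = h"
  defines "e \<equiv> \<lambda>l. N 6 [N 8 [], N 11 [], l] + (if l = N 10 [] then 1 else 0)"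
  shows "wp new_monomial N F (\<lambda>t N' F'. t = 0 \<and> same {17, 21, 22, 24} N N' \<and> F' = F \<and>
     (N' 17 [] = 0 \<longleftrightarrow> (\<exists>t<h. N 7 [N 9 [], t] \<noteq> 0 \<and> (\<forall>l\<le>n. N 6 [N 9 [], t, l] = e l))))"
  unfolding new_monomial_def
  apply (simp only: wp_Seq wp_NSet)
  apply (rule wp_For[where D = h and b = 0 and I = "\<lambda>m N' F'. same {17, 21, 22, 24} N N' \<and> F' = F \<and>
     (N' 17 [] = 0 \<longleftrightarrow> (\<exists>t<m. N 7 [N 9 [], t] \<noteq> 0 \<and> (\<forall>l\<le>n. N 6 [N 9 [], t, l] = e l)))"])
  subgoal by simp
  subgoal premises q for i N1 F1
  proof (cases "N 7 [N 9 [], i] = 0")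
    case True
    note [simp] = sameD[OF conjunct1[OF q(3)]] q(2)
    show ?thesis using q True by (auto simp: less_Suc_eq)
  next
    case False
    note [simp] = sameD[OF conjunct1[OF q(3)]] q(2)
    have pos: "0 < N 7 [N 9 [], i]" using False by simp
    show ?thesis
      apply (simp add: pos False)
      apply (rule wp_For[where D = "Suc n" and b = 0 and I = "\<lambda>m N' F'. same {17, 22, 24} N1 N' \<and> F' = F1 \<and>
        N' 17 = N1 17 \<and> (N' 24 [] = 0 \<longleftrightarrow> (\<forall>l<m. N 6 [N 9 [], i, l] = e l))"])
      subgoal by simp
      subgoal premises r for m N2 F2
      proof -
        note [simp] = sameD[OF conjunct1[OF r(3)]] r(2)
        show ?thesis using r by (auto simp: less_Suc_eq e_def)
      qed
      subgoal for m N2 F2 using n sameD[of "{17, 22, 24}" N1 N2] by simp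
      subgoal premises r for t N2 F2
      proof -
        note [simp] = sameD[OF conjunct1[OF r(3)]]
        have s: "same {17, 21, 22, 24} N N2" using q(3) r(3) by (auto simp: same_def)
        show ?thesis
        proof (cases "N2 24 [] = 0")
          case True
          then have "\<forall>l\<le>n. N 6 [N 9 [], i, l] = e l" using r by (simp add: less_Suc_eq_le)
          then show ?thesis using True s q r pos by (auto simp: less_Suc_eq)
        next
          case F: False
          then have "\<not> (\<forall>l\<le>n. N 6 [N 9 [], i, l] = e l)" using r by (simp add: less_Suc_eq_le)
          then show ?thesis using F s q r pos by (auto simp: less_Suc_eq)
        qed
      qed
      done
  qed
  subgoal using h by (simp add: same_def)
  subgoal by simp
  done

lemma (in points) border_selection:
  "selection n h R s Skip new_monomial (\<lambda>_ _. {0}) (\<lambda>_ _ _ _. True) (\<lambda>_ _. True) 0 0"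
proof (unfold_locales, goal_cases)
  case (5 k N F)
  show ?case by simp
next
  case (6 k N F G b)
  let ?m = "var (N 10 []) + row_mono N k (N 11 [])"
  have bd: "N 18 [] = Suc n" "N 12 [] = h" "N 8 [] = k" "N 9 [] = Suc k"
    "dual_inv h (\<lambda>i c. F 4 [i, c]) (\<lambda>i. N 7 [Suc k, i] \<noteq> 0) (\<lambda>i c. mono_value (R c) (row_mono N (Suc k) i))"
    using 6(1) by (simp_all add: building_def registers_ok_def)
  define e where "e = (\<lambda>l. N 6 [k, N 11 [], l] + (if l = N 10 [] then 1 else 0))"
  have m: "?m = exponents n e" unfolding e_def exponents_var[OF 6(3)] row_mono_def ..
  have eq: "row_mono N (Suc k) t = ?m \<longleftrightarrow> (\<forall>l\<le>n. N 6 [Suc k, t, l] = e l)" for t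
    unfolding m unfolding row_mono_def by (auto simp: poly_mapping_eq_iff fun_eq_iff lookup_exponents)
  have r: "(\<Sum>t<h. Poly_Mapping.single (row_mono N (Suc k) t) (- F 5 [t])) \<in> kspan (mon ` row_monos N (Suc k))"
    unfolding row_monos_def by (rule combination_kspan) (use 6(6) in auto)
  show ?case
  proof (rule wp_mono[OF new_monomial_wp[of N n h, OF bd(1,2)]], goal_cases)
    case (1 t N' F')
    have s: "same select_nats N N'" "same select_fields F F'" using 1 by (auto simp: same_def)
    have c: "N' 17 [] = 0 \<longleftrightarrow> (\<exists>t<h. N 7 [Suc k, t] \<noteq> 0 \<and> row_mono N (Suc k) t = ?m)"
      using 1 unfolding eq bd(3,4) e_def by blast
    show ?case
    proof (cases "N' 17 [] = 0")
      case True
      then obtain t0 where "t0 < h" "N 7 [Suc k, t0] \<noteq> 0" "row_mono N (Suc k) t0 = ?m" using c by blast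
      then have "?m \<in> row_monos N (Suc k)" unfolding row_monos_def mem_Collect_eq by (intro exI[of _ t0]) simp
      then have "b \<in> kspan (mon ` row_monos N (Suc k))"
        unfolding 6(7) by (intro sc.subspace_add[OF subspace_kspan] mon_in_kspan r)
      then have "b = 0" unfolding row_monos_def by (rule dual_inv_independent[OF bd(5) _ 6(8)])
      then show ?thesis using True 1 s by simp
    next
      case False
      have "Poly_Mapping.lookup (Poly_Mapping.single (row_mono N (Suc k) t) (- F 5 [t])) ?m = 0" if "t < h" for t
        using False c 6(6)[OF that] that by (cases "N 7 [Suc k, t] = 0") (auto simp: lookup_single when_def)
      then have "Poly_Mapping.lookup b ?m = 1" unfolding 6(7) by (simp add: lookup_add mon_def lookup_sum)
      then have "b \<noteq> 0" by auto
      then show ?thesis using False 1 s by simp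
    qed
  qed
qed auto

lemma (in selection) selected_J_deg:
  assumes st: "staircase s \<N>" and k: "k \<in> {1..s}" and good: "good k \<N> G"
  shows "G \<subseteq> J_deg k"
proof
  fix g assume "g \<in> G"
  then obtain m r where m: "m \<in> mono_plus n (\<N> (k - 1))" and r: "r \<in> kspan (mon ` \<N> k)" "g = mon m + r" "vanish g"
    using good unfolding good_def emitted_def by blast
  obtain k' where k': "k = Suc k'" using k by (cases k) auto
  have "m \<in> monomials n k"
    using m k mono_plus_monomials[OF staircase_monomials[OF st, of k']] unfolding k' by auto
  then have "mon m \<in> homog n k" by (auto simp: homog_def intro!: mon_in_kspan)
  moreover have "r \<in> homog n k" using r(1) k staircase_homog[OF st] by auto
  ultimately show "g \<in> J_deg k" unfolding J_deg_def r(2)[symmetric] using r(2,3) sc.subspace_add[OF subspace_homog] by auto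
qed

lemma (in selection) selected_J_times_span:
  assumes st: "staircase s \<N>" and k: "k \<in> {1..s}" and good: "good k \<N> G" and Z: "Z k G \<subseteq> J_times_span k G"
  shows "J_deg k = J_times_span k G"
proof (rule J_deg_eq_J_times_span[OF st k selected_J_deg[OF st k good]])
  fix m assume "m \<in> mono_plus n (\<N> (k - 1))"
  then show "\<exists>r\<in>kspan (mon ` \<N> k). mon m + r \<in> J_times_span k G"
    using good Z subset_J_times_span[of G k] unfolding good_def handled_def by blast
qed

lemma (in selection) main_inv_output:
  assumes "main_inv s N F"
  obtains G where "staircase s (listed_monos N)" "output_polys N F = (\<Union>k\<in>{1..s}. G k)" "\<And>k. k \<in> {1..s} \<Longrightarrow> good k (listed_monos N) (G k)"
proof -
  have lev: "\<forall>k\<le>s. level N F k" and st: "staircase s (row_monos N)"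
    and product_exponent: "\<exists>G. output_polys N F = (\<Union>k\<in>{1..s}. G k) \<and> (\<forall>k\<in>{1..s}. good k (row_monos N) (G k))"
    using assms unfolding main_inv_def by simp_all
  have eq: "listed_monos N k = row_monos N k" if "k \<le> s" for k using lev that by (simp add: level_def)
  have "staircase s (listed_monos N)" by (rule staircase_cong[OF st]) (rule eq)
  moreover have "good k (listed_monos N) G \<longleftrightarrow> good k (row_monos N) G" if "k \<in> {1..s}" for k G
    using that eq[of k] eq[of "k - 1"] unfolding good_def by auto
  ultimately show ?thesis using that product_exponent by metis
qed

text \<open>With \<open>Z = {0}\<close> exactly the polynomials of the border monomials are output: those
  monomials are outside the new family, so their polynomials are not zero, and the remainder \<open>r\<close> is
  \<open>psi\<close> by uniqueness.\<close>
lemma (in selection) border_basis_eq: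
  assumes st: "staircase s \<N>" and good: "\<And>k. k \<in> {1..s} \<Longrightarrow> good k \<N> (G k)" and Z: "\<And>k G. Z k G = {0}"
  shows "(\<Union>k\<in>{1..s}. G k) = border_basis n J s \<N>"
proof -
  have "G k = (\<lambda>m. mon m + psi n J \<N> k m) ` border n \<N> k" if k: "k \<in> {1..s}" for k
  proof (intro equalityI subsetI)
    fix g assume "g \<in> G k"
    then obtain m r where m: "m \<in> mono_plus n (\<N> (k - 1))" and r: "r \<in> kspan (mon ` \<N> k)" "g = mon m + r" "vanish g"
      and g0: "g \<noteq> 0"
      using good[OF k] unfolding good_def emitted_def by blast
    have "m \<notin> \<N> k"
    proof
      assume "m \<in> \<N> k"
      then have "g \<in> kspan (mon ` \<N> k)"
        unfolding r(2) by (intro sc.subspace_add[OF subspace_kspan] mon_in_kspan r(1))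
      then show False using staircase_independent[OF st k _ r(3)] g0 by simp
    qed
    then have "m \<in> border n \<N> k" using m by (simp add: border_def)
    moreover have "psi n J \<N> k m = r" using psi_eq[OF st k m r(1)] r(2,3) by simp
    ultimately show "g \<in> (\<lambda>m. mon m + psi n J \<N> k m) ` border n \<N> k" using r(2) by blast
  next
    fix g assume "g \<in> (\<lambda>m. mon m + psi n J \<N> k m) ` border n \<N> k"
    then obtain m where m: "m \<in> mono_plus n (\<N> (k - 1))" "m \<notin> \<N> k" "g = mon m + psi n J \<N> k m"
      by (auto simp: border_def)
    obtain r where r: "r \<in> kspan (mon ` \<N> k)" "vanish (mon m + r)" "mon m + r \<in> G k \<union> {0}"
      using good[OF k] m(1) unfolding good_def handled_def Z by blast
    have "Poly_Mapping.lookup r m = 0" using r(1) m(2) by (auto simp: kspan_mon in_keys_iff)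
    then have "Poly_Mapping.lookup (mon m + r) m = 1" by (simp add: lookup_add mon_def)
    then have "mon m + r \<noteq> 0" by (metis lookup_zero zero_neq_one)
    then show "g \<in> G k" using r(3) m(3) psi_eq[OF st k m(1) r(1,2)] by simp
  qed
  then show ?thesis by (simp add: border_basis_def)
qed

text \<open>Each of the \<open>(n + 1) h\<close> products per degree costs at most \<open>8 h\<^sup>2\<close>.\<close>
theorem border_algorithm:
  fixes R :: "nat \<Rightarrow> nat \<Rightarrow> 'k::field"
  assumes n: "n \<ge> 1" and h: "h \<ge> 1"
  shows "\<exists>t \<sigma>. exec (main_prog Skip new_monomial) (input n h s R) t \<sigma> \<and>
     t \<le> implied_constant * (s * n * h ^ 3) \<and>
     complement n (vanishing_ideal n h R) s (out_family n \<sigma>) \<and>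
     out_polys n \<sigma> = border_basis n (vanishing_ideal n h R) s (out_family n \<sigma>) \<and>
     ideal_gen n (out_polys n \<sigma>) = truncated_ideal n (vanishing_ideal n h R) s"
proof -
  interpret points n h R by unfold_locales (rule h)
  interpret selection n h R s Skip new_monomial "\<lambda>_ _. {0}" "\<lambda>_ _ _ _. True" "\<lambda>_ _. True" 0 0
    by (rule border_selection)
  obtain t N F where e: "exec (main_prog Skip new_monomial) (input n h s R) t (N, F)"
    and t: "t \<le> s * (0 + Suc n * (h * pair_cost))" and inv: "main_inv s N F"
    using main_wp unfolding wp_def by auto
  obtain G where st: "staircase s (listed_monos N)" and G: "output_polys N F = (\<Union>k\<in>{1..s}. G k)"
    and good: "\<And>k. k \<in> {1..s} \<Longrightarrow> good k (listed_monos N) (G k)" using main_inv_output[OF inv] by blast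
  have J: "J_deg k = J_times_span k (G k)" if "k \<in> {1..s}" for k
    by (rule selected_J_times_span[OF st that good[OF that]]) (simp add: sc.subspace_0[OF subspace_J_times_span])
  have "h * 1 \<le> h * h" using h by (intro mult_le_mono) auto
  then have "pair_cost \<le> 8 * (h * h)" by (simp add: pair_cost_def)
  moreover have "Suc n \<le> 2 * n" using n by simp
  ultimately have "s * (0 + Suc n * (h * pair_cost)) \<le> s * ((2 * n) * (h * (8 * (h * h))))"
    unfolding add_0 by (intro mult_le_mono le_refl)
  also have "\<dots> = 16 * (s * n * h ^ 3)" by (simp add: power3_eq_cube)
  also have "\<dots> \<le> implied_constant * (s * n * h ^ 3)" by (intro mult_le_mono1) (simp add: implied_constant_def)
  finally have "t \<le> implied_constant * (s * n * h ^ 3)" using t by (rule order_trans[rotated])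
  moreover have "out_polys n (N, F) = border_basis n J s (listed_monos N)"
    using border_basis_eq[OF st good] G by (simp add: output_polys_def)
  moreover have "ideal_gen n (out_polys n (N, F)) = truncated_ideal n J s"
    using ideal_gen_truncated[of s G] J G by (simp add: output_polys_def)
  ultimately show ?thesis using e staircase_complement[OF st] out_family_listed_monos[of N F] by metis
qed

section \<open>Preparation with Koszul relations\<close>

definition clear_vec :: com where
  "clear_vec = For 21 (Rd 13 []) (FZero (7, [Rd 21 []]))"

lemma clear_vec_wp:
  fixes F :: "'k::field mem"
  assumes "N 13 [] = D"
  shows "wp clear_vec N F (\<lambda>t N' F'. t = 0 \<and> same {21} N N' \<and> same {7} F F' \<and> (\<forall>x<D. F' 7 [x] = 0))"
  unfolding clear_vec_def
  by (rule wp_For[where D = D and b = 0 and I = "\<lambda>m N' F'. same {21} N N' \<and> same {7} F F' \<and> (\<forall>x<m. F' 7 [x] = 0)"])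
     (use assms in \<open>auto simp: less_Suc_eq same_def\<close>)

abbreviation block_index :: "nexp \<Rightarrow> nexp" where
  "block_index l \<equiv> Plus (Times l (Rd 12 [])) (Rd 21 [])"

definition koszul_vec :: com where
  "koszul_vec = clear_vec ;;
     For 21 (Rd 12 [])
      (FOp FMul (10, []) (0, [Rd 21 [], Rd 26 []]) (2, [Minus (Rd 8 []) (Num 1), Rd 27 [], Rd 21 []]) ;;
       FOp FAdd (7, [block_index (Rd 25 [])]) (7, [block_index (Rd 25 [])]) (10, []) ;;
       FOp FMul (10, []) (0, [Rd 21 [], Rd 25 []]) (2, [Minus (Rd 8 []) (Num 1), Rd 27 [], Rd 21 []]) ;;
       FOp FSub (7, [block_index (Rd 26 [])]) (7, [block_index (Rd 26 [])]) (10, []))"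

lemma block_eq: "c < (h::nat) \<Longrightarrow> x = j * h + c \<longleftrightarrow> x div h = j \<and> x mod h = c"
  by (metis add.commute div_mult_mod_eq div_mult_self3 mod_mult_self3 mod_less div_less add_0_right less_nat_zero_code mult.commute)

text \<open>For \<open>i = j\<close> the two updates cancel, as does the Koszul relation.\<close>
lemma koszul_vec_wp:
  fixes F :: "'k::field mem"
  assumes "N 13 [] = D" "N 12 [] = h" "N 25 [] = i" "N 26 [] = j" "N 27 [] = q" "N 8 [] = Suc k"
  shows "wp koszul_vec N F (\<lambda>t N' F'. t \<le> h * 4 \<and> same {21} N N' \<and> same {7, 10} F F' \<and>
    (\<forall>x<D. x mod h < h \<longrightarrow> F' 7 [x] = (if x div h = i then F 0 [x mod h, j] * F 2 [k, q, x mod h] else 0)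
       - (if x div h = j then F 0 [x mod h, i] * F 2 [k, q, x mod h] else 0)))"
  unfolding koszul_vec_def
  apply (simp only: wp_Seq)
  apply (rule wp_mono[OF clear_vec_wp[of N D, OF assms(1)]])
  subgoal premises p for t1 N1 F1
    apply (rule wp_For[where D = h and b = 4 and I = "\<lambda>m N' F'. same {21} N1 N' \<and> same {7, 10} F1 F' \<and>
      (\<forall>x<D. F' 7 [x] = (if x mod h < m then (if x div h = i then F 0 [x mod h, j] * F 2 [k, q, x mod h] else 0)
       - (if x div h = j then F 0 [x mod h, i] * F 2 [k, q, x mod h] else 0) else 0))"])
    subgoal using p by simp
    subgoal premises r for c N2 F2
    proof -
      note e = sameD[OF conjunct1[OF r(3)]] r(2) sameD[OF conjunct1[OF conjunct2[OF r(3)]]]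
        sameD[OF conjunct1[OF conjunct2[OF p]]] sameD[OF conjunct1[OF conjunct2[OF conjunct2[OF p]]]]
      note b = block_eq[OF r(1)]
      have z: "F2 7 [l * h + c] = 0" if "x < D" "x div h = l" "x mod h = c" for x l
      proof -
        have "x = l * h + c" using that b by simp
        then show ?thesis using r(3) that by simp
      qed
      have "(l * h + c) div h = l" "(l * h + c) mod h = c" for l using b[of "l * h + c" l] by simp_all
      then show ?thesis using r(3) by (auto simp: e assms b less_Suc_eq intro: z)
    qed
    subgoal using p assms by (auto simp: same_def)
    subgoal using p by (auto simp: same_def)
    done
  done

definition koszul_prep :: com where
  "koszul_prep = init_rows 13 20 7 ;;
     Cond (Rd 8 []) (For 25 (Rd 18 []) (For 26 (Rd 18 []) (For 27 (Rd 12 [])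
       (Cond (Rd 7 [Minus (Rd 8 []) (Num 1), Rd 27 []]) (koszul_vec ;; insertion 13 20 7) Skip)))) Skip"

context points
begin

lemma J_times_span_empty: "J_times_span k {} = J_times k"
  by (auto simp: J_times_span_def kspan_def)

definition "insertion_cost = lift_dim * (lift_dim * 4) + 2 * lift_dim"

text \<open>The Koszul relations treated so far, \<open>P\<close>, lie in the span of the second elimination. The opposite bound
  on the span is kept as well, so that at the end both agree with \<open>lifts\<close>.\<close>
definition relations_inv :: "nat \<Rightarrow> nat mem \<Rightarrow> 'k mem \<Rightarrow> (nat \<times> nat \<times> nat) set \<Rightarrow> nat mem \<Rightarrow> 'k mem \<Rightarrow> bool" where
  "relations_inv k N0 F0 P N F \<longleftrightarrow> same {16, 20, 21, 22, 25, 26, 27} N0 N \<and> same {7, 8, 9, 10} F0 F \<and>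
     (\<exists>B. dual_inv lift_dim (\<lambda>i c. F 8 [i, c]) (\<lambda>i. N 20 [Suc k, i] \<noteq> 0) B \<and>
        used_span lift_dim (\<lambda>i. N 20 [Suc k, i] \<noteq> 0) B \<subseteq> lifts (Suc k) (J_times (Suc k)) \<and>
        (\<forall>(i, j, q)\<in>P. N0 7 [k - 1, q] \<noteq> 0 \<longrightarrow>
           lift (koszul i j (mon (row_mono N0 (k - 1) q))) \<in> used_span lift_dim (\<lambda>i. N 20 [Suc k, i] \<noteq> 0) B))"

lemma relations_inv_upd: "relations_inv k N0 F0 P N F \<Longrightarrow> a \<in> {25, 26, 27} \<Longrightarrow> relations_inv k N0 F0 P (N(a := f)) F"
  unfolding relations_inv_def by auto

lemma relations_inv_mono: "relations_inv k N0 F0 P N F \<Longrightarrow> Q \<subseteq> P \<Longrightarrow> relations_inv k N0 F0 Q N F"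
  unfolding relations_inv_def by (elim conjE exE, intro conjI exI, assumption+) blast

lemma relations_inv_step:
  assumes bd: "building s k N0 F0" and r: "relations_inv k N0 F0 P N F" and k: "k = Suc k'"
    and ij: "N 25 [] = i" "i \<le> n" "N 26 [] = j" "j \<le> n" and q: "N 27 [] = q" "q < h" and used: "N0 7 [k', q] \<noteq> 0"
  shows "wp (koszul_vec ;; insertion 13 20 7) N F (\<lambda>t N' F'. t \<le> h * 4 + insertion_cost \<and>
     N' 25 [] = i \<and> N' 26 [] = j \<and> N' 27 [] = q \<and> relations_inv k N0 F0 (insert (i, j, q) P) N' F')"
proof -
  have s: "same {16, 20, 21, 22, 25, 26, 27} N0 N" "same {7, 8, 9, 10} F0 F" using r by (simp_all add: relations_inv_def)
  note e = sameD[OF s(1)] sameD[OF s(2)]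
  obtain B where dual_inv: "dual_inv lift_dim (\<lambda>i c. F 8 [i, c]) (\<lambda>i. N 20 [Suc k, i] \<noteq> 0) B"
    and sub: "used_span lift_dim (\<lambda>i. N 20 [Suc k, i] \<noteq> 0) B \<subseteq> lifts (Suc k) (J_times (Suc k))"
    and P: "\<forall>(i, j, q)\<in>P. N0 7 [k - 1, q] \<noteq> 0 \<longrightarrow>
           lift (koszul i j (mon (row_mono N0 (k - 1) q))) \<in> used_span lift_dim (\<lambda>i. N 20 [Suc k, i] \<noteq> 0) B"
    using r unfolding relations_inv_def by (elim conjE exE)
  have K: "N 13 [] = lift_dim" "N 12 [] = h" "N 8 [] = Suc k'" "N 9 [] = Suc k"
    and R: "\<forall>c<h. \<forall>j\<le>n. F 0 [c, j] = R c j" and lev: "level N0 F0 k'"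
    and st: "staircase k (row_monos N0)"
    using bd e k by (simp_all add: building_def registers_ok_def)
  have E: "F 2 [k', q, c] = mono_value (R c) (row_mono N0 k' q)" if "c < h" for c
    using lev used q that e by (simp add: level_def)
  have "row_mono N0 k' q \<in> row_monos N0 k'" using used q by (auto simp: row_monos_def)
  then have hom: "mon (row_mono N0 k' q) \<in> homog n k'"
    using staircase_monomials[OF st, of k'] k by (auto simp: homog_def intro!: mon_in_kspan)
  let ?p = "lift (koszul i j (mon (row_mono N0 k' q)))"
  have pLS: "v \<in> lifts (Suc k) (J_times (Suc k))" if "\<forall>x<lift_dim. v x = ?p x" for v
    using koszul_in_lifts[OF ij(2,4) hom that] k by simp
  show ?thesis
    apply (simp only: wp_Seq)
    apply (rule wp_mono[OF koszul_vec_wp[of N lift_dim h i j q k', OF K(1,2) ij(1,3) q(1) K(3)]])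
    subgoal premises p1 for t1 N1 F1
    proof -
      have t1: "t1 \<le> h * 4" and s1: "same {21} N N1" "same {7, 10} F F1" using p1 by simp_all
      note e1 = sameD[OF s1(1)] sameD[OF s1(2)]
      have v: "F1 7 [x] = ?p x" if x: "x < lift_dim" for x
      proof -
        have "F1 7 [x] = (if x div h = i then F 0 [x mod h, j] * F 2 [k', q, x mod h] else 0)
          - (if x div h = j then F 0 [x mod h, i] * F 2 [k', q, x mod h] else 0)"
          using p1 x block_bounds[OF x] by blast
        then show ?thesis using block_bounds[OF x] R E ij by (simp add: lift_def koszul_def eval_diff eval_mult)
      qed
      show ?thesis
        apply (rule wp_mono[OF insertion_dual_inv_wp[where D = lift_dim and B = B]])
        subgoal by simp
        subgoal using K e1 by simp
        subgoal by simp
        subgoal using dual_inv e1 K by simp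
        subgoal premises p2 for t2 N2 F2
        proof -
          have t2: "t2 \<le> insertion_cost" using p2 by (simp add: insertion_cost_def)
          have s2: "same {16, 21, 22, 20} N1 N2" "same {8, 9, 10} F1 F2" using p2 by simp_all
          have n1: "N1 9 [] = Suc k" "N1 20 = N 20" using K e1 by simp_all
          have s': "same {16, 20, 21, 22, 25, 26, 27} N0 N2" "same {7, 8, 9, 10} F0 F2"
            using s s1 s2 by (auto simp: same_def)
          have ijq: "N2 25 [] = i" "N2 26 [] = j" "N2 27 [] = q"
            using sameD[OF s2(1)] e1 ij q by simp_all
          let ?U = "\<lambda>i. N 20 [Suc k, i] \<noteq> 0" and ?v = "\<lambda>c. F1 7 [c]"
          from p2[unfolded n1] consider
            (dep) "N2 20 = N 20" "dual_inv lift_dim (\<lambda>i c. F2 8 [i, c]) (\<lambda>i. N2 20 [Suc k, i] \<noteq> 0) B" "?v \<in> used_span lift_dim ?U B"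
            | (new) p where "dual_inv lift_dim (\<lambda>i c. F2 8 [i, c]) (\<lambda>i. N2 20 [Suc k, i] \<noteq> 0) (B(p := ?v))"
              "used_span lift_dim (\<lambda>i. N2 20 [Suc k, i] \<noteq> 0) (B(p := ?v))
                = {y. \<exists>x\<in>used_span lift_dim ?U B. \<exists>a. \<forall>c<lift_dim. y c = x c + a * ?v c}"
            by (elim conjE disjE exE) simp_all
          then have "relations_inv k N0 F0 (insert (i, j, q) P) N2 F2"
          proof cases
            case dep
            have "?p \<in> used_span lift_dim ?U B" using used_span_cong[OF dep(3), of ?p] v by simp
            then show ?thesis unfolding relations_inv_def
              using s' dep(2) sub P k dep(1) by (intro conjI exI[of _ B]) auto
          next
            case new
            let ?S = "used_span lift_dim (\<lambda>i. N2 20 [Suc k, i] \<noteq> 0) (B(p := ?v))"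
            have S: "y \<in> ?S" if "y \<in> used_span lift_dim ?U B" for y
              unfolding new(2) mem_Collect_eq by (intro bexI[OF _ that] exI[of _ 0]) simp
            have pS: "?p \<in> ?S"
              unfolding new(2) mem_Collect_eq by (intro bexI[OF _ used_span_0] exI[of _ 1]) (use v in simp)
            have "?S \<subseteq> lifts (Suc k) (J_times (Suc k))"
            proof
              fix y assume "y \<in> ?S"
              then obtain x a where x: "x \<in> used_span lift_dim ?U B" "\<forall>c<lift_dim. y c = x c + a * ?v c"
                unfolding new(2) by blast
              show "y \<in> lifts (Suc k) (J_times (Suc k))"
                by (rule lifts_J_times_subspace(2)[OF _ _ x(2)]) (use x(1) sub pLS v in auto)
            qed
            then show ?thesis unfolding relations_inv_def
              using s' new(1) P S pS k by (intro conjI exI[of _ "B(p := ?v)"]) auto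
          qed
          then show ?thesis using t1 t2 ijq by simp
        qed
        done
    qed
    done
qed

definition "relation_cost = h * 4 + insertion_cost"

text \<open>The second elimination represents what the lower degrees and the kept polynomials generate.\<close>
definition lift_elim :: "nat \<Rightarrow> 'k mpoly set \<Rightarrow> nat mem \<Rightarrow> 'k mem \<Rightarrow> bool" where
  "lift_elim K G N F \<longleftrightarrow> irredundant K G \<and> (\<exists>B. dual_inv lift_dim (\<lambda>i c. F 8 [i, c]) (\<lambda>i. N 20 [K, i] \<noteq> 0) B \<and>
     used_span lift_dim (\<lambda>i. N 20 [K, i] \<noteq> 0) B = lifts K (J_times_span K G))"

lemma relations_inv_lift_elim:
  assumes bd: "building s k N0 F0" and r: "relations_inv k N0 F0 P N F"
    and P: "\<And>i j q. k \<ge> 1 \<Longrightarrow> i \<le> n \<Longrightarrow> j \<le> n \<Longrightarrow> q < h \<Longrightarrow> (i, j, q) \<in> P"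
  shows "lift_elim (Suc k) {} N F"
proof -
  obtain B where dual_inv: "dual_inv lift_dim (\<lambda>i c. F 8 [i, c]) (\<lambda>i. N 20 [Suc k, i] \<noteq> 0) B"
    and sub: "used_span lift_dim (\<lambda>i. N 20 [Suc k, i] \<noteq> 0) B \<subseteq> lifts (Suc k) (J_times (Suc k))"
    and rel: "\<forall>(i, j, q)\<in>P. N0 7 [k - 1, q] \<noteq> 0 \<longrightarrow>
           lift (koszul i j (mon (row_mono N0 (k - 1) q))) \<in> used_span lift_dim (\<lambda>i. N 20 [Suc k, i] \<noteq> 0) B"
    using r unfolding relations_inv_def by (elim conjE exE)
  let ?S = "used_span lift_dim (\<lambda>i. N 20 [Suc k, i] \<noteq> 0) B"
  have st: "staircase k (row_monos N0)" using bd by (simp add: building_def)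
  have "lifts (Suc k) (J_times (Suc k)) \<subseteq> ?S"
  proof (rule koszul_span[OF st])
    show "Suc k \<ge> 1" "Suc k - 2 \<le> k" by auto
    show "(\<lambda>_. 0) \<in> ?S" by (rule used_span_0)
    show "w \<in> ?S" if "u \<in> ?S" "v \<in> ?S" "\<forall>c<lift_dim. w c = u c + a * v c" for u v w a
      by (rule used_span_cong[OF used_span_linear[OF that(1,2), of a]]) (use that(3) in simp)
    fix i j q assume a: "i \<le> n" "j \<le> n" "Suc k \<ge> 2" "q \<in> row_monos N0 (Suc k - 2)"
    then obtain t where "t < h" "N0 7 [k - 1, t] \<noteq> 0" "q = row_mono N0 (k - 1) t" by (auto simp: row_monos_def)
    then show "lift (koszul i j (mon q)) \<in> ?S" using rel P[of i j t] a by auto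
  qed
  then show ?thesis unfolding lift_elim_def J_times_span_empty using dual_inv sub by (auto simp: irredundant_def)
qed

lemma koszul_prep_wp:
  assumes bd: "building s k N F"
  shows "wp koszul_prep N F (\<lambda>t N' F'. t \<le> Suc n * (Suc n * (h * relation_cost)) \<and> same select_nats N N' \<and> same select_fields F F' \<and> lift_elim (Suc k) {} N' F')"
  unfolding koszul_prep_def
  apply (simp only: wp_Seq)
  apply (rule wp_mono[OF init_rows_wp[where D = lift_dim]])
  subgoal by simp
  subgoal using bd by (simp add: building_def registers_ok_def)
  subgoal by simp
  subgoal premises p1 for t1 N1 F1
  proof -
    have K: "N 8 [] = k" "N 9 [] = Suc k" "N 18 [] = Suc n" "N 12 [] = h" using bd by (simp_all add: building_def registers_ok_def)
    have s1: "same {21, 22, 20} N N1" "same {8} F F1" and t1: "t1 = 0" using p1 by simp_all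
    note e1 = sameD[OF s1(1)] sameD[OF s1(2)]
    have ein: "dual_inv lift_dim (\<lambda>i c. F1 8 [i, c]) (\<lambda>i. N1 20 [Suc k, i] \<noteq> 0) (\<lambda>_ _. 0)"
      using p1 K by (intro dual_inv_init) auto
    have "u \<in> lifts (Suc k) (J_times (Suc k))" if "u \<in> used_span lift_dim (\<lambda>i. N1 20 [Suc k, i] \<noteq> 0) (\<lambda>_ _. 0)" for u
      by (rule lifts_J_times_subspace(2)[OF lifts_J_times_subspace(1) lifts_J_times_subspace(1), of _ 0]) (use that in \<open>auto simp: used_span_def\<close>)
    then have r0: "relations_inv k N F {} N1 F1"
      unfolding relations_inv_def using s1 ein by (auto simp: same_def)
    have post: "same select_nats N N' \<and> same select_fields F F'" if "relations_inv k N F P N' F'" for P N' F'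
      using that unfolding relations_inv_def by (auto simp: same_def)
    show ?thesis
    proof (cases k)
      case 0
      then show ?thesis using relations_inv_lift_elim[OF bd r0] post[OF r0] t1 e1 K by simp
    next
      case (Suc k')
      \<comment> \<open>The triples treated before the current positions of the three nested loops.\<close>
      define A where "A i = {(i', j, q). i' < i \<and> j \<le> n \<and> q < h}" for i :: nat
      define A2 where "A2 i j = A i \<union> {(i', j', q). i' = i \<and> j' < j \<and> q < h}" for i j :: nat
      define A3 where "A3 i j q = A2 i j \<union> {(i', j', q'). i' = i \<and> j' = j \<and> q' < q}" for i j q :: nat
      have inv: "N' 18 [] = Suc n" "N' 12 [] = h" "N' 8 [] = Suc k'" "N' 7 = N 7" if "relations_inv k N F P N' F'" for P N' F'
      proof -
        have "same {16, 20, 21, 22, 25, 26, 27} N N'" using that by (simp add: relations_inv_def)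
        note sameD[OF this]
        then show "N' 18 [] = Suc n" "N' 12 [] = h" "N' 8 [] = Suc k'" "N' 7 = N 7" using K Suc by simp_all
      qed
      have c8: "nval N1 (Rd 8 []) \<noteq> 0" using e1 K Suc by simp
      show ?thesis
        apply (simp only: wp_Cond c8 if_True not_False_eq_True)
      proof (rule wp_For[where D = "Suc n" and b = "Suc n * (h * relation_cost)" and I = "\<lambda>i N' F'. relations_inv k N F (A i) N' F'"], goal_cases)
        case 1
        have "A 0 = {}" by (auto simp: A_def)
        then show ?case using relations_inv_upd[OF r0, of 25] by simp
      next
        case i: (2 i N2 F2)
        show ?case
        proof (rule wp_For[where D = "Suc n" and b = "h * relation_cost" and
            I = "\<lambda>j N' F'. relations_inv k N F (A2 i j) N' F' \<and> N' 25 [] = i"], goal_cases)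
          case 1
          have "A2 i 0 = A i" by (auto simp: A2_def)
          then show ?case using relations_inv_upd[OF i(3), of 26] i by simp
        next
          case j: (2 j N3 F3)
          show ?case
          proof (rule wp_For[where D = h and b = relation_cost and
              I = "\<lambda>q N' F'. relations_inv k N F (A3 i j q) N' F' \<and> N' 25 [] = i \<and> N' 26 [] = j"], goal_cases)
            case 1
            have "A3 i j 0 = A2 i j" by (auto simp: A3_def)
            then show ?case using relations_inv_upd[of k N F "A2 i j" N3 F3 27] j by simp
          next
            case q: (2 q N4 F4)
            have r: "relations_inv k N F (A3 i j q) N4 F4" and r1: "N4 25 [] = i" "N4 26 [] = j" using q by simp_all
            have A3S: "A3 i j (Suc q) = insert (i, j, q) (A3 i j q)" by (auto simp: A3_def less_Suc_eq)
            have nv: "nval N4 (Rd 7 [Minus (Rd 8 []) (Num 1), Rd 27 []]) = N 7 [k', q]" using inv[OF r] q by simp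
            show ?case
            proof (cases "N 7 [k', q] = 0")
              case True
              have "relations_inv k N F (A3 i j (Suc q)) N4 F4"
                using r True Suc unfolding A3S relations_inv_def by auto
              then have "relations_inv k N F (A3 i j (Suc q)) (N4(27 := (N4 27)([] := Suc q))) F4" by (rule relations_inv_upd) simp
              then show ?thesis unfolding wp_Cond nv using True r1 q by simp
            next
              case False
              have "wp (koszul_vec ;; insertion 13 20 7) N4 F4 (\<lambda>t N' F'. t \<le> h * 4 + insertion_cost \<and>
                 N' 25 [] = i \<and> N' 26 [] = j \<and> N' 27 [] = q \<and> relations_inv k N F (insert (i, j, q) (A3 i j q)) N' F')"
                by (rule relations_inv_step[OF bd r Suc]) (use i j q r1 False in auto)
              then have "wp (koszul_vec ;; insertion 13 20 7) N4 F4 (\<lambda>t N' F'. t \<le> relation_cost \<and> N' 27 [] = q \<and>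
                  relations_inv k N F (A3 i j (Suc q)) (N'(27 := (N' 27)([] := Suc q))) F' \<and>
                  (N'(27 := (N' 27)([] := Suc q))) 25 [] = i \<and> (N'(27 := (N' 27)([] := Suc q))) 26 [] = j)"
                by (rule wp_mono) (use relations_inv_upd A3S in \<open>auto simp: relation_cost_def\<close>)
              then show ?thesis unfolding wp_Cond nv using False by simp
            qed
          next
            case (3 q Na Fa)
            then show ?case using inv(2)[of _ Na Fa] by auto
          next
            case (4 t N' F')
            have "A2 i (Suc j) \<subseteq> A3 i j h" by (auto simp: A3_def A2_def less_Suc_eq)
            then have "relations_inv k N F (A2 i (Suc j)) N' F'" using 4 relations_inv_mono by blast
            then show ?case using 4 relations_inv_upd[of k N F "A2 i (Suc j)" N' F' 26] by simp
          qed
        next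
          case (3 j Na Fa)
          then show ?case using inv(1)[of _ Na Fa] by auto
        next
          case (4 t N' F')
          have "A (Suc i) \<subseteq> A2 i (Suc n)" by (auto simp: A2_def A_def less_Suc_eq)
          then have "relations_inv k N F (A (Suc i)) N' F'" using 4 relations_inv_mono by blast
          then show ?case using 4 relations_inv_upd[of k N F "A (Suc i)" N' F' 25] by simp
        qed
      next
        case (3 i Na Fa)
        then show ?case using inv(1)[of _ Na Fa] by auto
      next
        case (4 t N' F')
        have "lift_elim (Suc k) {} N' F'" by (rule relations_inv_lift_elim[OF bd 4(3)]) (auto simp: A_def)
        then show ?case using 4 post t1 by auto
      qed
    qed
  qed
  done

end

section \<open>The test for superfluous border polynomials\<close>

text \<open>The vector of a border polynomial: the product itself and every monomial of the new family are written as a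
  variable times a monomial of the previous degree, whose values are stored.\<close>
definition lift_vec :: com where
  "lift_vec = clear_vec ;;
     For 21 (Rd 12 []) (FCopy (7, [block_index (Rd 10 [])]) (2, [Rd 8 [], Rd 11 [], Rd 21 []])) ;;
     For 23 (Rd 12 []) (Cond (Rd 7 [Rd 9 [], Rd 23 []])
       (For 21 (Rd 12 [])
         (FOp FMul (10, []) (5, [Rd 23 []]) (2, [Rd 8 [], Rd 15 [Rd 9 [], Rd 23 []], Rd 21 []]) ;;
          FOp FSub (7, [block_index (Rd 14 [Rd 9 [], Rd 23 []])])
            (7, [block_index (Rd 14 [Rd 9 [], Rd 23 []])]) (10, []))) Skip)"

lemma lift_first_wp:
  fixes F :: "'k::field mem"
  assumes "N 12 [] = h" "N 10 [] = j" and z: "\<forall>x<D. F 7 [x] = 0"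
  shows "wp (For 21 (Rd 12 []) (FCopy (7, [block_index (Rd 10 [])]) (2, [Rd 8 [], Rd 11 [], Rd 21 []]))) N F
    (\<lambda>t N' F'. t = 0 \<and> same {21} N N' \<and> same {7} F F' \<and>
      (\<forall>x<D. x mod h < h \<longrightarrow> F' 7 [x] = (if x div h = j then F 2 [N 8 [], N 11 [], x mod h] else 0)))"
  apply (rule wp_For[where D = h and b = 0 and I = "\<lambda>m N' F'. same {21} N N' \<and> same {7} F F' \<and>
      (\<forall>x<D. F' 7 [x] = (if x mod h < m \<and> x div h = j then F 2 [N 8 [], N 11 [], x mod h] else 0))"])
  subgoal using z by simp
  subgoal premises r for c N2 F2
  proof -
    note e = sameD[OF conjunct1[OF r(3)]] r(2) sameD[OF conjunct1[OF conjunct2[OF r(3)]]]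
    note b = block_eq[OF r(1)]
    show ?thesis using r(3) by (auto simp: e assms b less_Suc_eq)
  qed
  subgoal using assms by (simp add: same_def)
  subgoal by auto
  done

lemma lift_sub_wp:
  fixes F :: "'k::field mem"
  assumes "N 12 [] = h" "N 14 [N 9 [], N 23 []] = l" "N 15 [N 9 [], N 23 []] = i"
  shows "wp (For 21 (Rd 12 [])
         (FOp FMul (10, []) (5, [Rd 23 []]) (2, [Rd 8 [], Rd 15 [Rd 9 [], Rd 23 []], Rd 21 []]) ;;
          FOp FSub (7, [block_index (Rd 14 [Rd 9 [], Rd 23 []])])
            (7, [block_index (Rd 14 [Rd 9 [], Rd 23 []])]) (10, []))) N F
    (\<lambda>t N' F'. t \<le> h * 2 \<and> same {21} N N' \<and> same {7, 10} F F' \<and>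
      (\<forall>x<D. x mod h < h \<longrightarrow> F' 7 [x] = F 7 [x] - (if x div h = l then F 5 [N 23 []] * F 2 [N 8 [], i, x mod h] else 0)))"
  apply (rule wp_For[where D = h and b = 2 and I = "\<lambda>m N' F'. same {21} N N' \<and> same {7, 10} F F' \<and>
      (\<forall>x. F' 7 [x] = F 7 [x] - (if x mod h < m \<and> x div h = l then F 5 [N 23 []] * F 2 [N 8 [], i, x mod h] else 0))"])
  subgoal by simp
  subgoal premises r for c N2 F2
  proof -
    note e = sameD[OF conjunct1[OF r(3)]] r(2) sameD[OF conjunct1[OF conjunct2[OF r(3)]]]
    note b = block_eq[OF r(1)]
    have "(l * h + c) div h = l" "(l * h + c) mod h = c" using b[of "l * h + c" l] by simp_all
    moreover have "x = l * h + c" if "x div h = l" "x mod h = c" for x using that b by simp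
    ultimately show ?thesis using r(3) by (auto simp: e assms b less_Suc_eq)
  qed
  subgoal using assms by (simp add: same_def)
  subgoal by auto
  done

lemma lift_vec_wp:
  fixes F :: "'k::field mem"
  assumes "N 13 [] = D" "N 12 [] = h" "N 10 [] = j"
  shows "wp lift_vec N F (\<lambda>t N' F'. t \<le> h * (h * 2) \<and> same {21, 23} N N' \<and> same {7, 10} F F' \<and>
    (\<forall>x<D. x mod h < h \<longrightarrow> F' 7 [x] = (if x div h = j then F 2 [N 8 [], N 11 [], x mod h] else 0)
       - (\<Sum>t<h. if N 7 [N 9 [], t] \<noteq> 0 \<and> x div h = N 14 [N 9 [], t]
            then F 5 [t] * F 2 [N 8 [], N 15 [N 9 [], t], x mod h] else 0)))"
  unfolding lift_vec_def
  apply (simp only: wp_Seq)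
  apply (rule wp_mono[OF clear_vec_wp[of N D, OF assms(1)]])
  subgoal premises p for t1 N1 F1
  proof -
    have s1: "same {21} N N1" "same {7} F F1" using p by simp_all
    note e1 = sameD[OF s1(1)] sameD[OF s1(2)]
    show ?thesis
      apply (rule wp_mono[OF lift_first_wp[where h = h and j = j and D = D]])
      subgoal using e1 assms by simp
      subgoal using e1 assms by simp
      subgoal using p by simp
      subgoal premises q for t2 N2 F2
      proof -
        have s2: "same {21} N N2" "same {7} F F2" using s1 q by (auto simp: same_def)
        note e2 = sameD[OF s2(1)] sameD[OF s2(2)]
        have v2: "F2 7 [x] = (if x div h = j then F 2 [N 8 [], N 11 [], x mod h] else 0)" if "x < D" "x mod h < h" for x
          using q that e1 by simp
        show ?thesis
          apply (rule wp_For[where D = h and b = "h * 2" and I = "\<lambda>m N' F'. same {21, 23} N N' \<and> same {7, 10} F F' \<and>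
            (\<forall>x<D. x mod h < h \<longrightarrow> F' 7 [x] = (if x div h = j then F 2 [N 8 [], N 11 [], x mod h] else 0)
              - (\<Sum>t<m. if N 7 [N 9 [], t] \<noteq> 0 \<and> x div h = N 14 [N 9 [], t]
                then F 5 [t] * F 2 [N 8 [], N 15 [N 9 [], t], x mod h] else 0))"])
          subgoal using s2 v2 by (auto simp: same_def)
          subgoal premises r for t N3 F3
          proof -
            have s3: "same {21, 23} N N3" "same {7, 10} F F3" using r by simp_all
            note e3 = sameD[OF s3(1)] sameD[OF s3(2)] r(2)
            show ?thesis
            proof (cases "N 7 [N 9 [], t] = 0")
              case True
              then show ?thesis using r(3) e3 by simp
            next
              case False
              have c: "nval N3 (Rd 7 [Rd 9 [], Rd 23 []]) \<noteq> 0" using e3 False by simp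
              show ?thesis
                apply (simp only: wp_Cond c if_True not_False_eq_True)
                apply (rule wp_mono[OF lift_sub_wp[where h = h and l = "N 14 [N 9 [], t]" and i = "N 15 [N 9 [], t]" and D = D]])
                subgoal using e3 assms by simp
                subgoal using e3 by simp
                subgoal using e3 by simp
                subgoal premises u for t4 N4 F4
                proof -
                  have "same {21, 23} N N4" "same {7, 10} F F4" "N4 23 = N3 23"
                    using s3 u by (auto simp: same_def)
                  moreover have "F4 7 [x] = F3 7 [x] - (if x div h = N 14 [N 9 [], t]
                      then F 5 [t] * F 2 [N 8 [], N 15 [N 9 [], t], x mod h] else 0)" if "x < D" "x mod h < h" for x
                    using u that e3 by simp
                  ultimately show ?thesis using r(3) u e3 False by (auto simp: diff_diff_add)
                qed
                done
            qed
          qed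
          subgoal using assms by (simp add: same_def)
          subgoal using p q by simp
          done
      qed
      done
  qed
  done

definition independent_lift :: com where
  "independent_lift = lift_vec ;; insertion 13 20 7 ;; NSet (17, []) (Rd 16 [])"

context points
begin

definition lift_of :: "nat mem \<Rightarrow> 'k mem \<Rightarrow> nat \<Rightarrow> nat \<Rightarrow> 'k mpoly" where
  "lift_of N F k l = (if l = N 10 [] then mon (row_mono N k (N 11 [])) else 0)
     - (\<Sum>t<h. if N 7 [Suc k, t] \<noteq> 0 \<and> l = N 14 [Suc k, t]
          then scale (F 5 [t]) (mon (row_mono N k (N 15 [Suc k, t]))) else 0)"

lemma unlift_at: "j \<le> n \<Longrightarrow> unlift (\<lambda>l. if l = j then p else 0) = X j * p"
  by (simp add: unlift_def if_distrib[of "\<lambda>x. _ * x"] cong: if_cong)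

lemma unlift_diff: "unlift (\<lambda>l. f l - g l) = unlift f - unlift g"
  by (simp add: unlift_def right_diff_distrib sum_subtractf)

lemma unlift_sum: "unlift (\<lambda>l. \<Sum>t\<in>A. f t l) = (\<Sum>t\<in>A. unlift (f t))"
  unfolding unlift_def sum_distrib_left by (rule sum.swap)

lemma unlift_lift_of:
  assumes bd: "building s k N F0" and j: "N 10 [] \<le> n"
    and w: "\<And>t. t < h \<Longrightarrow> N 7 [Suc k, t] = 0 \<Longrightarrow> F 5 [t] = 0"
  shows "unlift (lift_of N F k) = mon (var (N 10 []) + row_mono N k (N 11 []))
    + (\<Sum>t<h. Poly_Mapping.single (row_mono N (Suc k) t) (- F 5 [t]))"
proof -
  let ?g = "\<lambda>t l. if N 7 [Suc k, t] \<noteq> 0 \<and> l = N 14 [Suc k, t]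
          then scale (F 5 [t]) (mon (row_mono N k (N 15 [Suc k, t]))) else 0"
  have src: "sources N k" using bd by (simp add: building_def)
  have "unlift (?g t) = - Poly_Mapping.single (row_mono N (Suc k) t) (- F 5 [t])" if t: "t < h" for t
  proof (cases "N 7 [Suc k, t] = 0")
    case True
    then show ?thesis using w[OF t] by (simp add: unlift_def)
  next
    case False
    then have s: "N 14 [Suc k, t] \<le> n" "row_mono N (Suc k) t = var (N 14 [Suc k, t]) + row_mono N k (N 15 [Suc k, t])"
      using src t by (auto simp: sources_def)
    have "unlift (?g t) = X (N 14 [Suc k, t]) * scale (F 5 [t]) (mon (row_mono N k (N 15 [Suc k, t])))"
      using unlift_at[OF s(1)] False by simp
    then show ?thesis using s(2) by (simp add: scale_mult_left mon_mult) (simp add: mon_def single_uminus)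
  qed
  then have "(\<Sum>t<h. unlift (?g t)) = - (\<Sum>t<h. Poly_Mapping.single (row_mono N (Suc k) t) (- F 5 [t]))"
    by (simp add: sum_negf)
  then show ?thesis
    unfolding lift_of_def unlift_diff unlift_sum unlift_at[OF j] mon_mult by simp
qed

lemma independent_lift_wp:
  assumes bd: "building s k N F" and X: "lift_elim (Suc k) G N F" and j: "N 10 [] \<le> n" and i: "N 11 [] < h"
    and used: "N 7 [k, N 11 []] \<noteq> 0" and w: "\<And>t. t < h \<Longrightarrow> N 7 [Suc k, t] = 0 \<Longrightarrow> F 5 [t] = 0"
    and b: "b = mon (var (N 10 []) + row_mono N k (N 11 [])) + (\<Sum>t<h. Poly_Mapping.single (row_mono N (Suc k) t) (- F 5 [t]))"
  shows "wp independent_lift N F (\<lambda>t N' F'. t \<le> h * (h * 2) + insertion_cost \<and> same select_nats N N' \<and> same select_fields F F' \<and>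
        (N' 17 [] \<noteq> 0 \<and> b \<noteq> 0 \<and> lift_elim (Suc k) (insert b G) N' F' \<or>
         N' 17 [] = 0 \<and> b \<in> J_times_span (Suc k) G \<and> lift_elim (Suc k) G N' F'))"
proof -
  obtain B where irr: "irredundant (Suc k) G"
    and dual_inv: "dual_inv lift_dim (\<lambda>i c. F 8 [i, c]) (\<lambda>i. N 20 [Suc k, i] \<noteq> 0) B"
    and used_span: "used_span lift_dim (\<lambda>i. N 20 [Suc k, i] \<noteq> 0) B = lifts (Suc k) (J_times_span (Suc k) G)"
    using X unfolding lift_elim_def by (elim conjE exE)
  have K: "N 13 [] = lift_dim" "N 12 [] = h" "N 8 [] = k" "N 9 [] = Suc k"
    and lev: "level N F k" and src: "sources N k"
    using bd by (simp_all add: building_def registers_ok_def)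
  have E: "F 2 [k, q, c] = mono_value (R c) (row_mono N k q)" if "c < h" "q < h" "N 7 [k, q] \<noteq> 0" for q c
    using lev that by (simp add: level_def)
  have hom: "(mon (row_mono N k q) :: 'k mpoly) \<in> homog n k" if "q < h" "N 7 [k, q] \<noteq> 0" for q
  proof -
    have "row_mono N k q \<in> row_monos N k" using that by (auto simp: row_monos_def)
    moreover have "staircase k (row_monos N)" using bd by (simp add: building_def)
    ultimately show ?thesis
      using staircase_monomials[of k "row_monos N" k] by (auto simp: homog_def intro!: mon_in_kspan)
  qed
  let ?f = "lift_of N F k"
  have S: "N 14 [Suc k, t] \<le> n" "N 15 [Suc k, t] < h" "N 7 [k, N 15 [Suc k, t]] \<noteq> 0"
    if "t < h" "N 7 [Suc k, t] \<noteq> 0" for t using src that by (auto simp: sources_def)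
  have fhom: "\<forall>l\<le>n. ?f l \<in> homog n (Suc k - 1)"
    unfolding lift_of_def diff_Suc_1
  proof (intro allI impI sc.subspace_diff[OF subspace_homog] sc.subspace_sum[OF subspace_homog])
    fix l
    show "(if l = N 10 [] then mon (row_mono N k (N 11 [])) else 0 :: 'k mpoly) \<in> homog n k"
      using hom[OF i used] by (simp add: sc.subspace_0 subspace_homog)
    fix t assume "t \<in> {..<h}"
    then show "(if N 7 [Suc k, t] \<noteq> 0 \<and> l = N 14 [Suc k, t]
          then scale (F 5 [t]) (mon (row_mono N k (N 15 [Suc k, t]))) else 0) \<in> homog n k"
      using S hom by (auto simp: sc.subspace_0 subspace_homog sc.subspace_scale)
  qed
  have mulf: "unlift ?f = b" unfolding b by (rule unlift_lift_of[of s k N F F, OF bd j w])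
  show ?thesis
    unfolding independent_lift_def
    apply (simp only: wp_Seq)
    apply (rule wp_mono[OF lift_vec_wp[of N lift_dim h "N 10 []", OF K(1,2) refl]])
    subgoal premises p1 for t1 N1 F1
    proof -
      have t1: "t1 \<le> h * (h * 2)" and s1: "same {21, 23} N N1" "same {7, 10} F F1" using p1 by simp_all
      note e1 = sameD[OF s1(1)] sameD[OF s1(2)]
      have v: "F1 7 [x] = lift ?f x" if x: "x < lift_dim" for x
      proof -
        note bb = block_bounds[OF x]
        have "F1 7 [x] = (if x div h = N 10 [] then F 2 [k, N 11 [], x mod h] else 0)
          - (\<Sum>t<h. if N 7 [Suc k, t] \<noteq> 0 \<and> x div h = N 14 [Suc k, t]
               then F 5 [t] * F 2 [k, N 15 [Suc k, t], x mod h] else 0)"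
          using p1[unfolded K(3,4)] x bb(1) by blast
        also have "\<dots> = (if x div h = N 10 [] then mono_value (R (x mod h)) (row_mono N k (N 11 [])) else 0)
          - (\<Sum>t<h. if N 7 [Suc k, t] \<noteq> 0 \<and> x div h = N 14 [Suc k, t]
               then F 5 [t] * mono_value (R (x mod h)) (row_mono N k (N 15 [Suc k, t])) else 0)"
          using E[OF bb(1) i used] by (intro arg_cong2[of _ _ _ _ "(-)"] sum.cong) (auto simp: E[OF bb(1)] S)
        also have "\<dots> = lift ?f x"
          unfolding lift_def lift_of_def eval_diff eval_sum
          by (intro arg_cong2[of _ _ _ _ "(-)"] sum.cong) (auto simp: eval_scale)
        finally show ?thesis .
      qed
      then have vf: "\<forall>x<lift_dim. F1 7 [x] = lift ?f x" by blast
      show ?thesis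
        apply (rule wp_mono[OF insertion_dual_inv_wp[where D = lift_dim and B = B]])
        subgoal by simp
        subgoal using K e1 by simp
        subgoal by simp
        subgoal using dual_inv e1 K by simp
        subgoal premises p2 for t2 N2 F2
        proof -
          have t2: "t2 \<le> insertion_cost" using p2 by (simp add: insertion_cost_def)
          have s2: "same {16, 21, 22, 20} N1 N2" "same {8, 9, 10} F1 F2" using p2 by simp_all
          have n1: "N1 9 [] = Suc k" "N1 20 = N 20" using K e1 by simp_all
          have s': "same select_nats N N2" "same select_fields F F2" using s1 s2 by (auto simp: same_def)
          let ?U = "\<lambda>i. N 20 [Suc k, i] \<noteq> 0" and ?v = "\<lambda>c. F1 7 [c]"
          have iff: "?v \<in> used_span lift_dim ?U B \<longleftrightarrow> b \<in> J_times_span (Suc k) G"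
            unfolding used_span mulf[symmetric] by (rule lifts_iff[OF _ fhom vf]) simp
          from p2[unfolded n1] consider
            (dep) "N2 16 [] = 0" "N2 20 = N 20" "dual_inv lift_dim (\<lambda>i c. F2 8 [i, c]) (\<lambda>i. N2 20 [Suc k, i] \<noteq> 0) B" "?v \<in> used_span lift_dim ?U B"
            | (new) p where "N2 16 [] = Suc p" "dual_inv lift_dim (\<lambda>i c. F2 8 [i, c]) (\<lambda>i. N2 20 [Suc k, i] \<noteq> 0) (B(p := ?v))"
              "?v \<notin> used_span lift_dim ?U B"
              "used_span lift_dim (\<lambda>i. N2 20 [Suc k, i] \<noteq> 0) (B(p := ?v))
                = {y. \<exists>x\<in>used_span lift_dim ?U B. \<exists>a. \<forall>c<lift_dim. y c = x c + a * ?v c}"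
            by (elim conjE disjE exE) simp_all
          then show ?thesis
          proof cases
            case dep
            have "lift_elim (Suc k) G N2 F2" unfolding lift_elim_def using irr dep(2,3) used_span by (intro conjI exI[of _ B]) auto
            then have "lift_elim (Suc k) G (N2(17 := (N2 17)([] := 0))) F2" by (simp add: lift_elim_def)
            then show ?thesis using dep t1 t2 s' iff by simp
          next
            case new
            have bZ: "b \<notin> J_times_span (Suc k) G" using iff new(3) by simp
            then have b0: "b \<noteq> 0" using sc.subspace_0[OF subspace_J_times_span] by auto
            have "lifts (Suc k) (J_times_span (Suc k) (insert b G)) = {y. \<exists>x\<in>used_span lift_dim ?U B. \<exists>a. \<forall>c<lift_dim. y c = x c + a * ?v c}"
              unfolding used_span mulf[symmetric] by (rule lifts_insert[OF fhom vf])
            then have "lift_elim (Suc k) (insert b G) N2 F2"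
              unfolding lift_elim_def using irredundant_insert[OF irr bZ] new(2,4) by (intro conjI exI[of _ "B(p := ?v)"]) simp_all
            then have "lift_elim (Suc k) (insert b G) (N2(17 := (N2 17)([] := Suc p))) F2" by (simp add: lift_elim_def)
            then show ?thesis using new(1) t1 t2 s' b0 by simp
          qed
        qed
        done
    qed
    done
qed

lemma minimal_selection:
  "selection n h R s koszul_prep independent_lift J_times_span lift_elim irredundant
     (Suc n * (Suc n * (h * relation_cost))) (h * (h * 2) + insertion_cost)"
proof (unfold_locales, goal_cases)
  case (1 K G)
  show ?case by (rule sc.subspace_0[OF subspace_J_times_span])
next
  case (2 G G' K)
  then show ?case by (rule J_times_span_mono)
next
  case (3 K G N F)
  then show ?case by (simp add: lift_elim_def)
next
  case (4 N' N F' F K G)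
  then show ?case by (simp add: lift_elim_def)
next
  case (5 k N F)
  then show ?case by (rule koszul_prep_wp)
next
  case (6 k N F G b)
  show ?case by (rule independent_lift_wp[OF 6(1-7)])
qed

end

text \<open>The dominating cost is that of the Koszul relations: \<open>(n + 1)\<^sup>2 h\<close> insertions in dimension \<open>(n + 1) h\<close>.\<close>
theorem minimal_algorithm:
  fixes R :: "nat \<Rightarrow> nat \<Rightarrow> 'k::field"
  assumes n: "n \<ge> 1" and h: "h \<ge> 1"
  shows "\<exists>t \<sigma>. exec (main_prog koszul_prep independent_lift) (input n h s R) t \<sigma> \<and>
     t \<le> implied_constant * (s * n ^ 4 * h ^ 3) \<and>
     minimal_generators n (out_polys n \<sigma>) (truncated_ideal n (vanishing_ideal n h R) s)"
proof -
  interpret points n h R by unfold_locales (rule h)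
  interpret selection n h R s koszul_prep independent_lift J_times_span lift_elim irredundant
    "Suc n * (Suc n * (h * relation_cost))" "h * (h * 2) + insertion_cost"
    by (rule minimal_selection)
  obtain t N F where e: "exec (main_prog koszul_prep independent_lift) (input n h s R) t (N, F)"
    and t: "t \<le> s * (Suc n * (Suc n * (h * relation_cost)) + Suc n * (h * pair_cost))" and inv: "main_inv s N F"
    using main_wp unfolding wp_def by auto
  obtain G where st: "staircase s (listed_monos N)" and G: "output_polys N F = (\<Union>k\<in>{1..s}. G k)"
    and good: "\<And>k. k \<in> {1..s} \<Longrightarrow> good k (listed_monos N) (G k)" using main_inv_output[OF inv] by blast
  have "J_deg k = J_times_span k (G k) \<and> irredundant k (G k)" if "k \<in> {1..s}" for k
    using selected_J_times_span[OF st that good[OF that] order_refl] good[OF that] by (simp add: good_def)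
  then have "minimal_generators n (out_polys n (N, F)) (truncated_ideal n J s)"
    using minimal_truncated[of s G] G by (simp add: output_polys_def)
  moreover have "t \<le> implied_constant * (s * n ^ 4 * h ^ 3)"
  proof -
    let ?A = "(n * n) * (h * h)"
    have n2: "Suc n \<le> 2 * n" using n by simp
    have hA: "h * h \<le> ?A" using n by simp
    have h1: "h \<le> ?A"
    proof -
      have "h * 1 \<le> h * h" using h by (intro mult_le_mono) auto
      then show ?thesis using hA by linarith
    qed
    have D: "lift_dim \<le> 2 * (n * h)" using n2 by (metis Suc_eq_plus1 mult.assoc mult_le_mono1)
    have "n * h * 1 \<le> (n * h) * (n * h)" using n h by (intro mult_le_mono) auto
    also have "\<dots> = ?A" by (simp only: mult_ac)
    finally have D1: "lift_dim \<le> 2 * ?A" using D by linarith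
    have "lift_dim * lift_dim \<le> (2 * (n * h)) * (2 * (n * h))" by (rule mult_le_mono[OF D D])
    then have D2: "lift_dim * lift_dim \<le> 4 * ?A" by (simp add: mult_ac)
    have insertion_cost: "insertion_cost \<le> 20 * ?A"
    proof -
      have "insertion_cost = 4 * (lift_dim * lift_dim) + 2 * lift_dim" by (simp add: insertion_cost_def)
      then show ?thesis using D1 D2 by linarith
    qed
    have relation_cost: "relation_cost \<le> 24 * ?A" using insertion_cost h1 unfolding relation_cost_def by linarith
    have pair_cost: "pair_cost \<le> 30 * ?A"
    proof -
      have "pair_cost = 4 * h + 6 * (h * h) + insertion_cost" by (simp add: pair_cost_def)
      then show ?thesis using insertion_cost h1 hA by linarith
    qed
    have "Suc n * (Suc n * (h * relation_cost)) \<le> (2 * n) * ((2 * n) * (h * (24 * ?A)))"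
      by (intro mult_le_mono n2 relation_cost le_refl)
    also have "\<dots> = 96 * (n ^ 4 * h ^ 3)" by (simp add: power4_eq_xxxx power3_eq_cube mult_ac)
    finally have a: "Suc n * (Suc n * (h * relation_cost)) \<le> 96 * (n ^ 4 * h ^ 3)" .
    have "Suc n * (h * pair_cost) \<le> (2 * n) * (h * (30 * ?A))"
      by (intro mult_le_mono n2 pair_cost le_refl)
    also have "\<dots> \<le> (2 * n * n) * (h * (30 * ?A))" using n by (intro mult_le_mono1) simp
    also have "\<dots> = 60 * (n ^ 4 * h ^ 3)" by (simp add: power4_eq_xxxx power3_eq_cube mult_ac)
    finally have "Suc n * (h * pair_cost) \<le> 60 * (n ^ 4 * h ^ 3)" .
    with a have "Suc n * (Suc n * (h * relation_cost)) + Suc n * (h * pair_cost) \<le> implied_constant * (n ^ 4 * h ^ 3)"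
      by (simp add: implied_constant_def)
    then have "s * (Suc n * (Suc n * (h * relation_cost)) + Suc n * (h * pair_cost)) \<le> s * (implied_constant * (n ^ 4 * h ^ 3))"
      by (rule mult_le_mono2)
    also have "\<dots> = implied_constant * (s * n ^ 4 * h ^ 3)" by (simp add: mult_ac)
    finally show ?thesis using t by (rule order_trans[rotated])
  qed
  ultimately show ?thesis using e by blast
qed

theorem mainTheorem3:
  shows
    "(\<exists>prog. \<forall>n h s (R :: nat \<Rightarrow> nat \<Rightarrow> 'k::alg_closed_field).
        n \<ge> 1 \<longrightarrow> h \<ge> 1 \<longrightarrow> s \<ge> 1 \<longrightarrow> distinct_points n h R \<longrightarrow>
        (\<exists>t \<sigma>. exec prog (input n h s R) t \<sigma> \<and>
           t \<le> implied_constant * (s * n * h ^ 3) \<and>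
           complement n (vanishing_ideal n h R) s (out_family n \<sigma>) \<and>
           out_polys n \<sigma> = border_basis n (vanishing_ideal n h R) s (out_family n \<sigma>) \<and>
           ideal_gen n (out_polys n \<sigma>) = truncated_ideal n (vanishing_ideal n h R) s)) \<and>
     (\<exists>prog. \<forall>n h s (R :: nat \<Rightarrow> nat \<Rightarrow> 'k).
        n \<ge> 1 \<longrightarrow> h \<ge> 1 \<longrightarrow> s \<ge> 1 \<longrightarrow> distinct_points n h R \<longrightarrow>
        (\<exists>t \<sigma>. exec prog (input n h s R) t \<sigma> \<and>
           t \<le> implied_constant * (s * n ^ 4 * h ^ 3) \<and>
           minimal_generators n (out_polys n \<sigma>) (truncated_ideal n (vanishing_ideal n h R) s)))"
  by (intro conjI exI[of _ "main_prog Skip new_monomial"] exI[of _ "main_prog koszul_prep independent_lift"]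
        allI impI border_algorithm minimal_algorithm)

end
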